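(* Rewiring and inverse rewiring are necklace-preserving bijections between (i) the class $\mathcal{F}_k$ of non-negative $\mathcal{Q}$-trees with excess $k\geq 0$, (ii) and the class $\mathbf{B}_k$ of balanced box-rooted $\mathcal{Q}$-companion trees with $k$ external defects and no internal defects.
   Context: Pearls are of four kinds: box-pearls, dot-pearls ($\bullet$), red diamond-pearls and blue triangle-pearls. $\mathcal{Q}$ is a set of words on the alphabet {dot, diamond, triangle}; each word is identified with a clockwise oriented necklace carrying one box-pearl followed by the letters of the word (as pearls). $\mathcal{Q}$ contains at least one necklace with no dot- and no diamond-pearl. A rooted $\mathcal{Q}$-tree is a plane tree rooted at a box-pearl, whose vertices are copies of necklaces of $\mathcal{Q}$, with black edges joining a dot-pearl to a box-pearl and red edges joining a diamond-pearl to a box-pearl, every pearl incident to exactly one edge except the root box-pearl and the triangle-pearls, which are free (incident to no edge). The excess of a pearl $x$ is the number of triangle-pearls minus the number of diamond-pearls in the subtree planted at $x$ ($x$ included); the excess of the tree is that of its root. A non-negative $\mathcal{Q}$-tree is a rooted $\mathcal{Q}$-tree with non-negative excess at every pearl; $\mathcal{F}_k$ denotes those with excess $k$. Rewiring $\phi(\tau)$: around $\tau$, a left diamond-corner is the exterior angular sector following a red edge in counterclockwise direction around a diamond-pearl, and a triangle-corner is the exterior angular sector around a triangle-pearl. The closure $c(\tau)$ is obtained by iteratively matching an unmatched left diamond-corner followed in clockwise direction around the tree by an unmatched triangle-corner, creating non-crossing diamond-to-triangle edges (blue edges); $\phi(\tau)$ is $c(\tau)$ with red edges removed. A rooted $\mathcal{Q}$-companion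 tree is a pearl-rooted plane tree whose vertices are copies of necklaces of $\mathcal{Q}$, with black edges joining a dot-pearl to a box-pearl and blue edges joining a diamond-pearl to a triangle-pearl, such that each non-root dot- or diamond-pearl is incident to exactly one edge, the root pearl is free, and each box- or triangle-pearl is incident to at most one edge; non-root free triangle-pearls are called defects. The inverse closure $\bar c(\tau')$ is obtained by iteratively matching a right diamond-corner followed in counterclockwise direction around the tree by an unmatched free box-pearl corner, creating non-crossing diamond-to-box (red) edges; exactly one box-pearl remains unmatched. A box-rooted $\mathcal{Q}$-companion tree is balanced if it is rooted at this unmatched box-pearl. A defect is external (resp. internal) if it lies in the unbounded face (resp. an inner face) of $\bar c(\tau')$. Inverse rewiring $\bar\phi(\tau')$ is $\bar c(\tau')$ with blue edges removed. *)

theory Defs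
  imports Main "HOL-Library.Multiset"
begin

section \<open>Plane maps whose vertices are necklaces\<close>

datatype letter = Dot | Diamond | Triangle

text \<open>
  A vertex \<open>v\<close> carrying the word \<open>w\<close> has the pearls \<open>(v, 0), \<dots>, (v, length w)\<close> in clockwise
  order: \<open>(v, 0)\<close> is its unique box-pearl and \<open>(v, Suc i)\<close> is the pearl of the letter \<open>w ! i\<close>.
\<close>

type_synonym 'v pearl = "'v \<times> nat"

text \<open>
  An edge is a pair of pearls, listed in the order (dot, box) for a black edge, (diamond, box) for
  a red edge and (diamond, triangle) for a blue edge.  The cyclic order of the pearls on each
  necklace is the plane structure.  A diamond-pearl may carry both a blue and a red edge (this
  happens in closures only); then the blue edge leaves on its left, and the red edge on its
  right, seen from the centre of the necklace.
\<close>

record 'v config =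
  neck :: "'v \<Rightarrow> letter list option"
  root_pearl :: "'v pearl"
  black_edges :: "('v pearl \<times> 'v pearl) set"
  red_edges :: "('v pearl \<times> 'v pearl) set"
  blue_edges :: "('v pearl \<times> 'v pearl) set"

definition verts_of :: "'v config \<Rightarrow> 'v set" where
  "verts_of T = dom (neck T)"

definition box_pearls :: "'v config \<Rightarrow> 'v pearl set" where
  "box_pearls T = {(v, 0) | v. v \<in> verts_of T}"

definition letter_pearls :: "'v config \<Rightarrow> letter \<Rightarrow> 'v pearl set" where
  "letter_pearls T a = {(v, Suc i) | v i w. neck T v = Some w \<and> i < length w \<and> w ! i = a}"

definition pearls :: "'v config \<Rightarrow> 'v pearl set" where
  "pearls T = box_pearls T \<union> (\<Union>a. letter_pearls T a)"

definition all_edges :: "'v config \<Rightarrow> ('v pearl \<times> 'v pearl) set" where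
  "all_edges T = black_edges T \<union> red_edges T \<union> blue_edges T"

definition incident_edges :: "'v config \<Rightarrow> 'v pearl \<Rightarrow> ('v pearl \<times> 'v pearl) set" where
  "incident_edges T p = {e \<in> all_edges T. fst e = p \<or> snd e = p}"

definition free_pearl :: "'v config \<Rightarrow> 'v pearl \<Rightarrow> bool" where
  "free_pearl T p \<longleftrightarrow> incident_edges T p = {}"

definition necklace_config :: "letter list set \<Rightarrow> 'v config \<Rightarrow> bool" where
  "necklace_config Q T \<longleftrightarrow>
     finite (verts_of T) \<and> ran (neck T) \<subseteq> Q \<and> root_pearl T \<in> pearls T \<and>
     black_edges T \<subseteq> letter_pearls T Dot \<times> box_pearls T \<and>
     red_edges T \<subseteq> letter_pearls T Diamond \<times> box_pearls T \<and>
     blue_edges T \<subseteq> letter_pearls T Diamond \<times> letter_pearls T Triangle"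

text \<open>
  The graph on the necklaces: connected, and no edge lies on a cycle.  Edges are pairs of pearls,
  so loops and parallel edges between two necklaces count as cycles.
\<close>

definition necklace_adj :: "('v pearl \<times> 'v pearl) set \<Rightarrow> ('v \<times> 'v) set" where
  "necklace_adj E = {(fst p, fst q) | p q. (p, q) \<in> E \<or> (q, p) \<in> E}"

definition is_tree :: "'v config \<Rightarrow> bool" where
  "is_tree T \<longleftrightarrow>
     (\<forall>u\<in>verts_of T. \<forall>v\<in>verts_of T. (u, v) \<in> (necklace_adj (all_edges T))\<^sup>*) \<and>
     (\<forall>(p, q)\<in>all_edges T. (fst p, fst q) \<notin> (necklace_adj (all_edges T - {(p, q)}))\<^sup>*)"


section \<open>Non-negative trees\<close>

definition Q_tree :: "letter list set \<Rightarrow> 'v config \<Rightarrow> bool" where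
  "Q_tree Q T \<longleftrightarrow>
     necklace_config Q T \<and> blue_edges T = {} \<and> is_tree T \<and> root_pearl T \<in> box_pearls T \<and>
     (\<forall>p\<in>pearls T. card (incident_edges T p) =
        (if p = root_pearl T \<or> p \<in> letter_pearls T Triangle then 0 else 1))"

text \<open>
  Parent-to-child relation on the pearls of a rooted \<open>\<Q>\<close>-tree: the box-pearl of a necklace is above
  its other pearls, and a dot- or diamond-pearl is above the box-pearl it is joined to.
\<close>

definition child_rel :: "'v config \<Rightarrow> ('v pearl \<times> 'v pearl) set" where
  "child_rel T = {((v, 0), (v, Suc i)) | v i. (v, Suc i) \<in> pearls T} \<union> all_edges T"

definition planted_subtree :: "'v config \<Rightarrow> 'v pearl \<Rightarrow> 'v pearl set" where
  "planted_subtree T x = (child_rel T)\<^sup>* `` {x}"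

definition excess :: "'v config \<Rightarrow> 'v pearl \<Rightarrow> int" where
  "excess T x =
     int (card (planted_subtree T x \<inter> letter_pearls T Triangle)) -
     int (card (planted_subtree T x \<inter> letter_pearls T Diamond))"

definition nonneg_Q_tree :: "letter list set \<Rightarrow> 'v config \<Rightarrow> bool" where
  "nonneg_Q_tree Q T \<longleftrightarrow> Q_tree Q T \<and> (\<forall>x\<in>pearls T. 0 \<le> excess T x)"


section \<open>Walking around a tree and matching corners\<close>

definition cw_rot :: "'v config \<Rightarrow> 'v pearl \<Rightarrow> 'v pearl" where
  "cw_rot T = (\<lambda>(v, i). (v, Suc i mod Suc (length (the (neck T v)))))"

definition ccw_rot :: "'v config \<Rightarrow> 'v pearl \<Rightarrow> 'v pearl" where
  "ccw_rot T = (\<lambda>(v, i). (v, if i = 0 then length (the (neck T v)) else i - 1))"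

text \<open>The other end of the edge at \<open>p\<close>; meant for pearls incident to at most one edge.\<close>

definition mate :: "'v config \<Rightarrow> 'v pearl \<Rightarrow> 'v pearl" where
  "mate T p = (if free_pearl T p then p
     else THE q. (p, q) \<in> all_edges T \<or> (q, p) \<in> all_edges T)"

text \<open>
  In the clockwise walk around a tree, a pearl \<open>p\<close> stands for the exterior corner at \<open>p\<close> met just
  before the edge at \<open>p\<close>, if there is one: its left corner, i.e. the one that follows the edge
  counterclockwise around \<open>p\<close>.  The walk then follows the edge at \<open>p\<close> (if any) to its other end
  and proceeds to the clockwise next pearl of the necklace reached.  Symmetrically, in the
  counterclockwise walk \<open>p\<close> stands for its right corner.  A free pearl has only one corner.
\<close>

definition cw_next :: "'v config \<Rightarrow> 'v pearl \<Rightarrow> 'v pearl" where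
  "cw_next T p = cw_rot T (mate T p)"

definition ccw_next :: "'v config \<Rightarrow> 'v pearl \<Rightarrow> 'v pearl" where
  "ccw_next T p = ccw_rot T (mate T p)"

text \<open>
  One step of the iterative matching, for a walk \<open>f\<close>, opening corners \<open>A\<close> and closing corners \<open>B\<close>:
  an unmatched opening corner is matched to an unmatched closing corner following it, i.e. with
  no other unmatched corner in between.
\<close>

definition match_step ::
  "('p \<Rightarrow> 'p) \<Rightarrow> 'p set \<Rightarrow> 'p set \<Rightarrow> ('p \<times> 'p) set \<Rightarrow> ('p \<times> 'p) set \<Rightarrow> bool" where
  "match_step f A B M M' \<longleftrightarrow>
     (\<exists>a \<in> A - Domain M. \<exists>b \<in> B - Range M.
        (\<exists>n>0. (f ^^ n) a = b \<and>
           (\<forall>j. 0 < j \<and> j < n \<longrightarrow> (f ^^ j) a \<notin> (A - Domain M) \<union> (B - Range M))) \<and>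
        M' = insert (a, b) M)"

text \<open>The final state of the iteration (it does not depend on the choices made).\<close>

definition iter_matching :: "('p \<Rightarrow> 'p) \<Rightarrow> 'p set \<Rightarrow> 'p set \<Rightarrow> ('p \<times> 'p) set" where
  "iter_matching f A B =
     (THE M. (match_step f A B)\<^sup>*\<^sup>* {} M \<and> (\<nexists>M'. match_step f A B M M'))"

definition cw_closure :: "'v config \<Rightarrow> 'v config" where
  "cw_closure T = T\<lparr>blue_edges :=
     iter_matching (cw_next T) (Domain (red_edges T)) (letter_pearls T Triangle)\<rparr>"

definition rewire :: "'v config \<Rightarrow> 'v config" where
  "rewire T = (cw_closure T)\<lparr>red_edges := {}\<rparr>"


section \<open>Companion trees\<close>

definition companion_tree :: "letter list set \<Rightarrow> 'v config \<Rightarrow> bool" where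
  "companion_tree Q T \<longleftrightarrow>
     necklace_config Q T \<and> red_edges T = {} \<and> is_tree T \<and> free_pearl T (root_pearl T) \<and>
     (\<forall>p \<in> letter_pearls T Dot \<union> letter_pearls T Diamond - {root_pearl T}.
        card (incident_edges T p) = 1) \<and>
     (\<forall>p \<in> box_pearls T \<union> letter_pearls T Triangle. card (incident_edges T p) \<le> 1)"

definition defects :: "'v config \<Rightarrow> 'v pearl set" where
  "defects T = {t \<in> letter_pearls T Triangle. t \<noteq> root_pearl T \<and> free_pearl T t}"

definition free_boxes :: "'v config \<Rightarrow> 'v pearl set" where
  "free_boxes T = {b \<in> box_pearls T. free_pearl T b}"

definition inv_closure :: "'v config \<Rightarrow> 'v config" where
  "inv_closure T = T\<lparr>red_edges :=
     iter_matching (ccw_next T) (Domain (blue_edges T)) (free_boxes T)\<rparr>"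

definition inv_rewire :: "'v config \<Rightarrow> 'v config" where
  "inv_rewire T = (inv_closure T)\<lparr>blue_edges := {}\<rparr>"

definition balanced_companion_tree :: "letter list set \<Rightarrow> 'v config \<Rightarrow> bool" where
  "balanced_companion_tree Q T \<longleftrightarrow>
     companion_tree Q T \<and> root_pearl T \<in> box_pearls T \<and>
     {b \<in> box_pearls T. free_pearl (inv_closure T) b} = {root_pearl T}"

text \<open>
  \<open>strictly_between f a x b\<close>: the walk \<open>f\<close> started at \<open>a\<close> visits \<open>x\<close> strictly before it first
  reaches \<open>b\<close>.
\<close>

definition strictly_between :: "('p \<Rightarrow> 'p) \<Rightarrow> 'p \<Rightarrow> 'p \<Rightarrow> 'p \<Rightarrow> bool" where
  "strictly_between f a x b \<longleftrightarrow>
     (\<exists>i n. 0 < i \<and> i < n \<and> (f ^^ i) a = x \<and> (f ^^ n) a = b \<and>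
        (\<forall>j. 0 < j \<and> j < n \<longrightarrow> (f ^^ j) a \<noteq> b))"

text \<open>
  The tree has a single face; the red edges of the inverse closure are non-crossing arcs in it,
  the arc from \<open>d\<close> to \<open>b\<close> running counterclockwise alongside the tree.  It separates exactly the
  corners met strictly between \<open>d\<close> and \<open>b\<close> from infinity.  Hence a free pearl lies in an inner
  face iff some arc passes over it, and in the unbounded face otherwise.
\<close>

definition internal_defects :: "'v config \<Rightarrow> 'v pearl set" where
  "internal_defects T = {t \<in> defects T.
     \<exists>(d, b) \<in> red_edges (inv_closure T). strictly_between (ccw_next T) d t b}"

definition external_defects :: "'v config \<Rightarrow> 'v pearl set" where
  "external_defects T = defects T - internal_defects T"


section \<open>Unlabelled classes\<close>

text \<open>
  Trees are considered up to renaming of the vertices (orientation, words, root and edge colours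
  being preserved).  As trees are finite, vertex names in \<open>nat\<close> represent all of them.
\<close>

definition config_iso :: "('v config \<times> 'v config) set" where
  "config_iso = {(S, T). \<exists>f. bij_betw f (verts_of S) (verts_of T) \<and>
     (\<forall>v\<in>verts_of S. neck T (f v) = neck S v) \<and>
     root_pearl T = map_prod f id (root_pearl S) \<and>
     black_edges T = map_prod (map_prod f id) (map_prod f id) ` black_edges S \<and>
     red_edges T = map_prod (map_prod f id) (map_prod f id) ` red_edges S \<and>
     blue_edges T = map_prod (map_prod f id) (map_prod f id) ` blue_edges S}"

definition F_class :: "letter list set \<Rightarrow> nat \<Rightarrow> nat config set set" where
  "F_class Q k = {T. nonneg_Q_tree Q T \<and> excess T (root_pearl T) = int k} // config_iso"

definition B_class :: "letter list set \<Rightarrow> nat \<Rightarrow> nat config set set" where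
  "B_class Q k = {T. balanced_companion_tree Q T \<and>
     card (external_defects T) = k \<and> internal_defects T = {}} // config_iso"

text \<open>
  All configurations isomorphic to the image of some representative; this is a single isomorphism
  class exactly if the images of all representatives are isomorphic.
\<close>

definition on_class :: "('v config \<Rightarrow> 'v config) \<Rightarrow> 'v config set \<Rightarrow> 'v config set" where
  "on_class f C = config_iso `` (f ` C)"

definition necklaces :: "'v config \<Rightarrow> letter list multiset" where
  "necklaces T = image_mset (\<lambda>v. the (neck T v)) (mset_set (verts_of T))"

definition necklace_preserving ::
  "('v config set \<Rightarrow> 'v config set) \<Rightarrow> 'v config set set \<Rightarrow> bool" where
  "necklace_preserving g \<C> \<longleftrightarrow>
     (\<forall>C\<in>\<C>. \<forall>S\<in>C. \<forall>T\<in>g C. necklaces T = necklaces S)"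

end

(*
  Both kinds of trees are read through the cyclic walk around them, which visits every pearl once
  because the graph of necklaces is a tree.  Started at the free root, the walk around a non-negative
  tree visits the subtree planted at a diamond d as an interval from d to the box of d, so
  non-negativity says precisely that the triangle matched to d lies in that interval.

  The red edges are then replaced by the blue ones one diamond at a time.  If the walk reads
  a d x t y b z, where d is joined to the box b and its other edge is the arc from d to the triangle
  t, then after the replacement it reads a d y b x t z, and the new arc, from b to the right corner
  of d (the corner at t), passes over the same corners x.  Hence the arcs stay non-crossing and
  never pass over the root or over a defect.  Since a non-crossing family of arcs
  that leaves nothing matchable is the result of the iterative matching, the closure of the final
  tree consists of the original red edges.  The same exchange run backwards, in the opposite order
  of diamonds, recovers a non-negative tree from a balanced companion tree: the leftmost blue
  diamond always precedes its box and its triangle, as no free box precedes it.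
*)
theory Submission
  imports Defs "HOL-Library.Confluence" "HOL-Library.Infinite_Set"
begin

subsection \<open>Walks and order along a list\<close>

text \<open>The matching is a \<open>THE\<close> over sequences of steps along a cyclic walk,
  whereas non-crossing arcs are easy to handle on a line. The root, free in every tree involved,
  provides the cut: the walk becomes a list without repetition, and the danger that remains is a
  matching step running past the root. In a non-negative tree such a step is excluded by counting
  triangles and diamonds in a planted subtree; in a balanced companion tree the root is itself a
  free box that is never matched, so it stops every step. Exchanging the edge of \<open>d\<close>
  moves a block of the list. This is harmless for the other diamonds if those still joined to their
  boxes lie before \<open>d\<close> and those already joined to their triangles lie after it, which
  is why one direction takes the last remaining diamond and the other the first. One exchange is
  proved as an equivalence, so that it serves both directions. The two maps are mutually inverse on
  the configurations themselves; isomorphism enters only through the choice of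
  representatives.\<close>

primrec walks :: "('p \<Rightarrow> 'p) \<Rightarrow> 'p \<Rightarrow> 'p list \<Rightarrow> 'p \<Rightarrow> bool" where
  "walks f x [] y \<longleftrightarrow> f x = y"
| "walks f x (z # zs) y \<longleftrightarrow> f x = z \<and> walks f z zs y"

lemma walks_append [simp]:
  "walks f x (us @ z # vs) y \<longleftrightarrow> walks f x us z \<and> walks f z vs y"
  by (induction us arbitrary: x) auto

lemma walks_cong:
  "walks f x us y \<Longrightarrow> f x = g x' \<Longrightarrow> (\<And>z. z \<in> set us \<Longrightarrow> f z = g z) \<Longrightarrow> walks g x' us y"
  by (induction us arbitrary: x x') auto

text \<open>Link to the iterates used by \<open>match_step\<close>: the list omits both ends of the
  walk, hence the \<open>Suc (length us)\<close> steps.\<close>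

lemma walks_iff_funpow:
  "walks f x us y \<longleftrightarrow>
     (f ^^ Suc (length us)) x = y \<and> (\<forall>i<length us. us ! i = (f ^^ Suc i) x)"
proof (induction us arbitrary: x)
  case (Cons z us)
  show ?case
    unfolding walks.simps Cons.IH
    by (auto simp: All_less_Suc2 funpow_swap1)
qed auto

text \<open>Walks from a common start are comparable because \<open>f\<close> is a function; the end
  points are appended so that a walk ending inside the other one is covered too.\<close>

lemma walks_prefix:
  "walks f x us y \<Longrightarrow> walks f x vs z \<Longrightarrow>
     (\<exists>ws. vs @ [z] = us @ [y] @ ws) \<or> (\<exists>ws. us @ [y] = vs @ [z] @ ws)"
proof (induction us arbitrary: x vs)
  case Nil
  then show ?case by (cases vs) auto
next
  case (Cons a us)
  show ?case
  proof (cases vs)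
    case (Cons b vs')
    with Cons.prems Cons.IH[of a vs'] show ?thesis by auto
  qed (use Cons.prems in auto)
qed

lemma walks_successor:
  assumes "walks f x us y" and "z \<in> set (x # us)"
  shows "f z \<in> set (us @ [y])"
  using assms by (induction us arbitrary: x) auto

lemma walks_closed:
  assumes "walks f x us x"
  shows "f ` set (x # us) \<subseteq> set (x # us)"
  using walks_successor[OF assms] by auto

lemma walks_rtrancl:
  assumes "walks f x us y" and "\<And>z. z \<in> set (x # us) \<Longrightarrow> (z, f z) \<in> R\<^sup>*"
    and "z \<in> set (us @ [y])"
  shows "(x, z) \<in> R\<^sup>*"
  using assms
proof (induction us arbitrary: x)
  case (Cons a us)
  then have "(x, a) \<in> R\<^sup>*" by auto
  moreover have "z \<noteq> a \<Longrightarrow> (a, z) \<in> R\<^sup>*"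
    using Cons by auto
  ultimately show ?case by (metis rtrancl_trans)
qed auto

text \<open>Order of occurrence without indices; it is a strict linear order on the members as soon
  as the list is \<open>distinct\<close>.\<close>

primrec before :: "'p list \<Rightarrow> 'p \<Rightarrow> 'p \<Rightarrow> bool" where
  "before [] x y \<longleftrightarrow> False"
| "before (a # us) x y \<longleftrightarrow> x = a \<and> y \<in> set us \<or> before us x y"

lemma before_in_set: "before us x y \<Longrightarrow> x \<in> set us \<and> y \<in> set us"
  by (induction us) auto

lemma before_append [simp]:
  "before (us @ vs) x y \<longleftrightarrow> before us x y \<or> before vs x y \<or> x \<in> set us \<and> y \<in> set vs"
  by (induction us) auto

lemma before_split:
  assumes "before us x y"
  obtains as bs cs where "us = as @ x # bs @ y # cs"
  using assms
proof (induction us arbitrary: thesis)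
  case (Cons a us)
  from Cons.prems(2) consider "x = a" "y \<in> set us" | "before us x y" by auto
  then show ?case
  proof cases
    case 1
    then obtain bs cs where "us = bs @ y # cs" by (meson split_list)
    with 1 Cons.prems(1)[of "[]" bs cs] show ?thesis by auto
  next
    case 2
    then obtain as bs cs where "us = as @ x # bs @ y # cs" using Cons.IH by blast
    with Cons.prems(1)[of "a # as"] show ?thesis by auto
  qed
qed auto

lemma before_irrefl: "distinct us \<Longrightarrow> \<not> before us x x"
  by (induction us) (auto dest: before_in_set)

lemma before_asym: "distinct us \<Longrightarrow> before us x y \<Longrightarrow> \<not> before us y x"
  by (induction us) (auto dest: before_in_set)

lemma before_trans: "distinct us \<Longrightarrow> before us x y \<Longrightarrow> before us y z \<Longrightarrow> before us x z"
  by (induction us) (auto dest: before_in_set)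

lemma before_total: "x \<in> set us \<Longrightarrow> y \<in> set us \<Longrightarrow> x \<noteq> y \<Longrightarrow> before us x y \<or> before us y x"
  by (induction us) auto

lemma before_rev: "before (rev us) x y \<longleftrightarrow> before us y x"
  by (induction us) (auto dest: before_in_set)

lemma before_map_iff:
  "before (map h us) u v \<longleftrightarrow> (\<exists>x y. before us x y \<and> u = h x \<and> v = h y)"
  by (induction us) auto

lemma before_map:
  "inj_on h (set us) \<Longrightarrow> x \<in> set us \<Longrightarrow> y \<in> set us \<Longrightarrow>
    before (map h us) (h x) (h y) \<longleftrightarrow> before us x y"
  unfolding before_map_iff by (metis before_in_set inj_onD)

lemma before_first:
  assumes "X \<noteq> {}" "X \<subseteq> set us" "distinct us"
  obtains x where "x \<in> X" "\<And>y. y \<in> X \<Longrightarrow> y \<noteq> x \<Longrightarrow> before us x y"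
proof -
  have "\<exists>x\<in>set us. x \<in> X" using assms by auto
  from split_list_first_prop[OF this]
  obtain as a bs where us: "us = as @ a # bs" "a \<in> X" "\<forall>y\<in>set as. y \<notin> X" by blast
  then have "before us a y" if "y \<in> X" "y \<noteq> a" for y
    using assms(2) that by auto
  with us that show thesis by blast
qed

lemma before_last:
  assumes "X \<noteq> {}" "X \<subseteq> set us" "distinct us"
  obtains x where "x \<in> X" "\<And>y. y \<in> X \<Longrightarrow> y \<noteq> x \<Longrightarrow> before us y x"
proof -
  from assms have sub: "X \<subseteq> set (rev us)" "distinct (rev us)" by auto
  from before_first[OF assms(1) sub]
  obtain x where "x \<in> X" "\<And>y. y \<in> X \<Longrightarrow> y \<noteq> x \<Longrightarrow> before (rev us) x y" by metis
  with that show thesis by (simp add: before_rev)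
qed

section \<open>Non-crossing arcs over a list\<close>

definition between :: "'p list \<Rightarrow> 'p \<Rightarrow> 'p \<Rightarrow> 'p \<Rightarrow> bool" where
  "between us x z y \<longleftrightarrow> before us x z \<and> before us z y"

lemma between_split:
  "distinct (as @ x # bs @ y # cs) \<Longrightarrow> between (as @ x # bs @ y # cs) x z y \<longleftrightarrow> z \<in> set bs"
  by (auto simp: between_def dest: before_in_set)

text \<open>Arcs drawn above a line, with \<open>U\<close> the points that must stay visible from
  above. On a distinct list, testing both ends against an open interval also excludes two arcs with
  a common start or a common end.\<close>

definition noncrossing :: "'p list \<Rightarrow> ('p \<times> 'p) set \<Rightarrow> 'p set \<Rightarrow> bool" where
  "noncrossing us C U \<longleftrightarrow> (\<forall>(x, y)\<in>C. before us x y \<and> (\<forall>z\<in>U. \<not> between us x z y) \<and>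
     (\<forall>(x', y')\<in>C. between us x x' y \<longleftrightarrow> between us x y' y))"

lemma noncrossing_mono: "noncrossing us C U \<Longrightarrow> C' \<subseteq> C \<Longrightarrow> U' \<subseteq> U \<Longrightarrow> noncrossing us C' U'"
  unfolding noncrossing_def by blast

text \<open>The lists differ by moving the block \<open>\<xi> @ [t]\<close> across
  \<open>\<beta> @ [b]\<close>, and the two arcs pass over exactly the same points, those of \<xi>.
  Either side forces every other arc to have both ends in \<xi> or both outside. Inside nothing
  changes; an outer arc passes over all of the block or none of it, so the move affects no crossing.
  Only \<open>t\<close> itself changes sides with \<beta>, whence
  \<open>t \<notin> U\<close>.\<close>

lemma noncrossing_swap:
  fixes \<alpha> \<beta> \<gamma> \<xi> :: "'p list"
  assumes dist: "distinct (\<alpha> @ d # \<xi> @ t # \<beta> @ b # \<gamma>)"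
    and ends: "\<And>x y. (x, y) \<in> C \<Longrightarrow> x \<notin> {d, t, b} \<and> y \<notin> {d, t, b}" and "t \<notin> U"
  shows "noncrossing (\<alpha> @ d # \<xi> @ t # \<beta> @ b # \<gamma>) (insert (d, t) C) U \<longleftrightarrow>
         noncrossing (\<alpha> @ d # \<beta> @ b # \<xi> @ t # \<gamma>) (insert (b, t) C) U"
    (is "noncrossing ?L _ _ \<longleftrightarrow> noncrossing ?L' _ _")
proof -
  have dist': "distinct ?L'" using dist by auto
  have mem: "set ?L' = set ?L" by auto
  define out where "out = set \<alpha> \<union> set \<beta> \<union> set \<gamma>"
  have nb: "\<not> before us x y" if "x \<notin> set us \<or> y \<notin> set us" for us and x y :: 'p
    using that before_in_set by metis
  have notin: "d \<notin> set \<xi>" "t \<notin> set \<xi>" "b \<notin> set \<xi>" "d \<notin> out" "t \<notin> out" "b \<notin> out"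
    "set \<xi> \<inter> out = {}" "b \<noteq> t" "b \<noteq> d" "t \<noteq> d"
    using dist unfolding out_def by auto
  have dt: "between ?L d z t \<longleftrightarrow> z \<in> set \<xi>" for z
    using between_split[of \<alpha> d \<xi> t "\<beta> @ b # \<gamma>"] dist by simp
  have bt: "between ?L' b z t \<longleftrightarrow> z \<in> set \<xi>" for z
    using between_split[of "\<alpha> @ d # \<beta>" b \<xi> t \<gamma>] dist by auto
  have before_dt: "before ?L d t" "before ?L' b t" by auto
  have disj: "set \<alpha> \<inter> set \<beta> = {}" "set \<alpha> \<inter> set \<gamma> = {}" "set \<beta> \<inter> set \<gamma> = {}"
    "set \<alpha> \<inter> set \<xi> = {}" "set \<beta> \<inter> set \<xi> = {}" "set \<gamma> \<inter> set \<xi> = {}"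
    using dist by auto
  have db: "d \<notin> set \<alpha>" "d \<notin> set \<beta>" "d \<notin> set \<gamma>" "b \<notin> set \<alpha>" "b \<notin> set \<beta>" "b \<notin> set \<gamma>"
     "t \<notin> set \<alpha>" "t \<notin> set \<beta>" "t \<notin> set \<gamma>" using notin unfolding out_def by auto
  have ins: "x \<notin> set \<alpha>" "x \<notin> set \<beta>" "x \<notin> set \<gamma>" "x \<noteq> d" "x \<noteq> t" "x \<noteq> b" if "x \<in> set \<xi>" for x
    using that disj notin by auto
  have inner1: "before ?L x z \<longleftrightarrow> before \<xi> x z \<or> z \<in> {t, b} \<union> set \<beta> \<union> set \<gamma>"
    "before ?L z x \<longleftrightarrow> before \<xi> z x \<or> z \<in> {d} \<union> set \<alpha>"
    "before ?L' x z \<longleftrightarrow> before \<xi> x z \<or> z \<in> {t} \<union> set \<gamma>"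
    "before ?L' z x \<longleftrightarrow> before \<xi> z x \<or> z \<in> {d, b} \<union> set \<beta> \<union> set \<alpha>"
    if "x \<in> set \<xi>" for x z
    using that ins[OF that] by (simp_all add: nb) blast+
  have inner: "before ?L x y \<longleftrightarrow> before \<xi> x y" "before ?L' x y \<longleftrightarrow> before \<xi> x y"
    if "x \<in> set \<xi>" "y \<in> set \<xi>" for x y
    using inner1[OF that(1), of y] ins[OF that(2)] by auto
  have inner_btw: "between ?L x z y \<longleftrightarrow> between \<xi> x z y" "between ?L' x z y \<longleftrightarrow> between \<xi> x z y"
    if "x \<in> set \<xi>" "y \<in> set \<xi>" for x y z
  proof -
    have "between ?L x z y = between \<xi> x z y \<and> between ?L' x z y = between \<xi> x z y"
    proof (cases "z \<in> set \<xi>")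
      case True
      then show ?thesis using inner that by (simp add: between_def)
    next
      case False
      then have "\<not> before \<xi> x z" "\<not> before \<xi> z y" using nb by metis+
      moreover have "z \<notin> ({t, b} \<union> set \<beta> \<union> set \<gamma>) \<inter> ({d} \<union> set \<alpha>)"
        "z \<notin> ({t} \<union> set \<gamma>) \<inter> ({d, b} \<union> set \<beta> \<union> set \<alpha>)"
        using db disj notin(8-10) by auto
      ultimately show ?thesis
        unfolding between_def inner1[OF that(1)] inner1[OF that(2)] by blast
    qed
    then show "between ?L x z y \<longleftrightarrow> between \<xi> x z y" "between ?L' x z y \<longleftrightarrow> between \<xi> x z y" by auto
  qed
  have outs: "x \<notin> set \<xi>" "x \<noteq> d" "x \<noteq> t" "x \<noteq> b"
    "x \<in> set \<alpha> \<and> x \<notin> set \<beta> \<and> x \<notin> set \<gamma> \<or> x \<notin> set \<alpha> \<and> x \<in> set \<beta> \<and> x \<notin> set \<gamma> \<or>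
     x \<notin> set \<alpha> \<and> x \<notin> set \<beta> \<and> x \<in> set \<gamma>" if "x \<in> out" for x
    using that disj notin unfolding out_def by auto
  have outer1: "before ?L x z \<longleftrightarrow> x \<in> set \<alpha>" "before ?L z x \<longleftrightarrow> x \<in> set \<beta> \<union> set \<gamma>"
    if "x \<in> out" "z \<in> set \<xi> \<union> {d, t}" for x z
    using that(2) outs[OF that(1)] notin db ins[of z] by (auto simp: nb)
  have outer2: "before ?L' x z \<longleftrightarrow> x \<in> set \<alpha> \<union> set \<beta>" "before ?L' z x \<longleftrightarrow> x \<in> set \<gamma>"
    if "x \<in> out" "z \<in> set \<xi> \<union> {b, t}" for x z
    using that(2) outs[OF that(1)] notin db ins[of z] by (auto simp: nb)
  have outer3: "before ?L x d \<longleftrightarrow> x \<in> set \<alpha>" "before ?L d x \<longleftrightarrow> x \<in> set \<beta> \<union> set \<gamma>"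
     "before ?L' x d \<longleftrightarrow> x \<in> set \<alpha>" "before ?L' d x \<longleftrightarrow> x \<in> set \<beta> \<union> set \<gamma>"
     "before ?L x b \<longleftrightarrow> x \<in> set \<alpha> \<union> set \<beta>" "before ?L b x \<longleftrightarrow> x \<in> set \<gamma>"
     "before ?L' x b \<longleftrightarrow> x \<in> set \<alpha> \<union> set \<beta>" "before ?L' b x \<longleftrightarrow> x \<in> set \<gamma>"
    if "x \<in> out" for x
    using outs[OF that(1)] notin db by (auto simp: nb)
  have outer0: "before ?L x y \<longleftrightarrow> before ?L' x y"
    if "x \<in> out" "y \<in> out" for x y
    using outs[OF that(1)] outs[OF that(2)] by (auto simp: nb)
  have outer: "before ?L x y \<longleftrightarrow> before ?L' x y" "before ?L y x \<longleftrightarrow> before ?L' y x"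
    if "x \<in> out" "y \<in> out \<union> {d, b}" for x y
    using that(2) outer0[of x y] outer0[of y x] outer3[OF that(1)] that(1) by blast+
  define L L' where "L = ?L" and "L' = ?L'"
  note outer = outer[folded L_def L'_def] and outer0 = outer0[folded L_def L'_def]
    and outer1 = outer1[folded L_def] and outer2 = outer2[folded L'_def]
    and inner = inner[folded L_def L'_def] and inner_btw = inner_btw[folded L_def L'_def]
    and dt = dt[folded L_def] and bt = bt[folded L'_def] and before_dt = before_dt[folded L_def L'_def]
    and mem = mem[folded L_def L'_def]
  have btw_eq: "between L x z y \<longleftrightarrow> between L' x z y"
    if "x \<in> out" "y \<in> out" "z \<notin> set \<xi>" "z \<noteq> t" for x y z
  proof (cases "z \<in> out \<union> {d, b}")
    case True
    then show ?thesis using outer that by (metis between_def)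
  next
    case False
    then have "z \<notin> set L" "z \<notin> set L'" using that unfolding out_def L_def L'_def by auto
    then show ?thesis unfolding between_def using nb by metis
  qed
  \<comment> \<open>Seen from outside, the moved block together with \<open>d\<close> in the old
    list, or with \<open>b\<close> in the new one, behaves like the single point
    \<open>t\<close>.\<close>
  have btw_all: "z \<in> set \<xi> \<union> {d, t} \<Longrightarrow> between L x z y \<longleftrightarrow> between L x t y"
    "z \<in> set \<xi> \<union> {b, t} \<Longrightarrow> between L' x z y \<longleftrightarrow> between L' x t y"
    if "x \<in> out" "y \<in> out" for x y z
    using outer1[OF that(1)] outer1[OF that(2)] outer2[OF that(1)] outer2[OF that(2)]
    unfolding between_def by simp_all
  define chord where "chord us C x y \<longleftrightarrow> before us x y \<and> (\<forall>z\<in>U. \<not> between us x z y) \<and>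
     (\<forall>(x', y')\<in>C. between us x x' y \<longleftrightarrow> between us x y' y)" for us C and x y :: 'p
  have nc: "noncrossing us C U \<longleftrightarrow> (\<forall>(x, y)\<in>C. chord us C x y)" for us C
    unfolding noncrossing_def chord_def by blast
  \<comment> \<open>Legality of the exchanged arc, expressed by \<xi> alone and therefore the same
    condition for both lists.\<close>
  define inn where "inn \<longleftrightarrow> U \<inter> set \<xi> = {} \<and> (\<forall>(x, y)\<in>C. x \<in> set \<xi> \<longleftrightarrow> y \<in> set \<xi>)"
  have dt_chord: "chord L (insert (d, t) C) d t \<longleftrightarrow> inn"
    unfolding chord_def inn_def using before_dt dt notin by auto
  have bt_chord: "chord L' (insert (b, t) C) b t \<longleftrightarrow> inn"
    unfolding chord_def inn_def using before_dt bt notin by auto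
  have same: "chord L (insert (d, t) C) x y \<longleftrightarrow> chord L' (insert (b, t) C) x y"
    if inn and xy: "(x, y) \<in> C" and C: "\<And>x y. (x, y) \<in> C \<Longrightarrow> x \<in> set L \<and> y \<in> set L" for x y
  proof -
    have sep: "x \<in> set \<xi> \<and> y \<in> set \<xi> \<or> x \<in> out \<and> y \<in> out" if "(x, y) \<in> C" for x y
      using C[OF that] ends[OF that] that \<open>inn\<close> unfolding inn_def out_def L_def by auto
    from sep[OF xy] show ?thesis
    proof
      assume *: "x \<in> set \<xi> \<and> y \<in> set \<xi>"
      then have eq: "before L x y \<longleftrightarrow> before L' x y" "\<And>z. between L x z y \<longleftrightarrow> between L' x z y"
        using inner inner_btw by auto
      have "\<not> between L' x z y" if "z \<notin> set \<xi>" for z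
        using inner_btw(2)[of x y z] * that nb unfolding between_def by metis
      then have "\<not> between L' x d y" "\<not> between L' x t y" "\<not> between L' x b y"
        using notin by auto
      then show ?thesis unfolding chord_def eq by auto
    next
      assume *: "x \<in> out \<and> y \<in> out"
      have U: "(\<forall>z\<in>U. \<not> between L x z y) \<longleftrightarrow> (\<forall>z\<in>U. \<not> between L' x z y)"
        using btw_eq[of x y] * \<open>inn\<close> \<open>t \<notin> U\<close> unfolding inn_def by blast
      have pair: "(between L x x' y \<longleftrightarrow> between L x y' y) \<longleftrightarrow>
          (between L' x x' y \<longleftrightarrow> between L' x y' y)" if "(x', y') \<in> C" for x' y'
        using sep[OF that] btw_all[of x y x'] btw_all[of x y y'] btw_eq[of x y x'] btw_eq[of x y y']
          * ends[OF that] outs(1) by blast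
      have "between L x d y \<longleftrightarrow> between L x t y" "between L' x b y \<longleftrightarrow> between L' x t y"
        using * btw_all[of x y d] btw_all[of x y b] by auto
      moreover have "(\<forall>(x', y')\<in>C. between L x x' y \<longleftrightarrow> between L x y' y) \<longleftrightarrow>
          (\<forall>(x', y')\<in>C. between L' x x' y \<longleftrightarrow> between L' x y' y)"
        using pair by (intro ball_cong) auto
      ultimately show ?thesis
        unfolding chord_def ball_simps(7) using U outer0[of x y] * by simp
    qed
  qed
  have mem_C: "x \<in> set L \<and> y \<in> set L" if "(x, y) \<in> C"
     "chord L (insert (d, t) C) x y \<or> chord L' (insert (b, t) C) x y" for x y
    using that(2) mem before_in_set[of L x y] before_in_set[of L' x y] unfolding chord_def by blast
  have "(\<forall>(x, y)\<in>insert (d, t) C. chord L (insert (d, t) C) x y) \<longleftrightarrow>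
        (\<forall>(x, y)\<in>insert (b, t) C. chord L' (insert (b, t) C) x y)" (is "?A \<longleftrightarrow> ?B")
  proof
    assume A: ?A
    then have inn and c: "\<And>x y. (x, y) \<in> C \<Longrightarrow> chord L (insert (d, t) C) x y"
      using dt_chord by auto
    with same mem_C have "\<And>x y. (x, y) \<in> C \<Longrightarrow> chord L' (insert (b, t) C) x y" by metis
    with \<open>inn\<close> bt_chord show ?B by auto
  next
    assume B: ?B
    then have inn and c: "\<And>x y. (x, y) \<in> C \<Longrightarrow> chord L' (insert (b, t) C) x y"
      using bt_chord by auto
    with same mem_C have "\<And>x y. (x, y) \<in> C \<Longrightarrow> chord L (insert (d, t) C) x y" by metis
    with \<open>inn\<close> dt_chord show ?A by auto
  qed
  then show ?thesis
    unfolding L_def[symmetric] L'_def[symmetric] nc .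
qed

subsection \<open>Iterative matching\<close>

definition unmatched :: "'p set \<Rightarrow> 'p set \<Rightarrow> ('p \<times> 'p) set \<Rightarrow> 'p set" where
  "unmatched A B M = (A - Domain M) \<union> (B - Range M)"

definition one_one :: "('a \<times> 'b) set \<Rightarrow> bool" where
  "one_one M \<longleftrightarrow> (\<forall>x y x' y'. (x, y) \<in> M \<longrightarrow> (x', y') \<in> M \<longrightarrow> (x = x' \<longleftrightarrow> y = y'))"

lemma one_oneD: "one_one M \<Longrightarrow> (x, y) \<in> M \<Longrightarrow> (x', y') \<in> M \<Longrightarrow> x = x' \<longleftrightarrow> y = y'"
  unfolding one_one_def by blast

lemma one_one_subset: "one_one M \<Longrightarrow> N \<subseteq> M \<Longrightarrow> one_one N"
  unfolding one_one_def by blast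

lemma one_one_insert:
  assumes "one_one M" "a \<notin> Domain M" "b \<notin> Range M"
  shows "one_one (insert (a, b) M)"
proof -
  have "x \<noteq> a \<and> y \<noteq> b" if "(x, y) \<in> M" for x y using that assms by auto
  with assms(1) show ?thesis unfolding one_one_def by (metis insert_iff prod.inject)
qed

lemma walks_of_funpow:
  "walks f a (map (\<lambda>i. (f ^^ Suc i) a) [0..<n]) ((f ^^ Suc n) a)"
  by (subst walks_iff_funpow) simp

lemma match_stepE:
  assumes "match_step f A B M M'"
  obtains a b us where "a \<in> A - Domain M" "b \<in> B - Range M" "walks f a us b"
    "set us \<inter> unmatched A B M = {}" "M' = insert (a, b) M"
proof -
  from assms obtain a b n where *: "a \<in> A - Domain M" "b \<in> B - Range M" "n > 0" "(f ^^ n) a = b"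
    "\<forall>j. 0 < j \<and> j < n \<longrightarrow> (f ^^ j) a \<notin> (A - Domain M) \<union> (B - Range M)" "M' = insert (a, b) M"
    unfolding match_step_def by blast
  from \<open>n > 0\<close> obtain m where m: "n = Suc m" by (cases n) auto
  let ?us = "map (\<lambda>i. (f ^^ Suc i) a) [0..<m]"
  have "walks f a ?us b" using walks_of_funpow[of f a m] * m by simp
  moreover have "set ?us \<inter> unmatched A B M = {}"
  proof -
    have "(f ^^ Suc i) a \<notin> unmatched A B M" if "i < m" for i
      using *(5)[rule_format, of "Suc i"] that m unfolding unmatched_def by simp
    then show ?thesis by auto
  qed
  ultimately show thesis using that * by blast
qed

lemma match_stepI:
  assumes "a \<in> A - Domain M" "b \<in> B - Range M" "walks f a us b"
    "set us \<inter> unmatched A B M = {}"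
  shows "match_step f A B M (insert (a, b) M)"
  unfolding match_step_def
proof (intro bexI[OF _ assms(1)] bexI[OF _ assms(2)] conjI exI[of _ "Suc (length us)"] allI impI)
  show "(f ^^ Suc (length us)) a = b" using assms(3) unfolding walks_iff_funpow by simp
  fix j assume "0 < j \<and> j < Suc (length us)"
  then obtain i where "j = Suc i" "i < length us" by (cases j) auto
  then have "(f ^^ j) a \<in> set us" using assms(3) unfolding walks_iff_funpow by (metis nth_mem)
  then show "(f ^^ j) a \<notin> (A - Domain M) \<union> (B - Range M)"
    using assms(4) unfolding unmatched_def by blast
qed auto

text \<open>Backward counterpart of \<open>walks_prefix\<close>: injectivity on an invariant set
  makes predecessors unique.\<close>

lemma walks_suffix:
  assumes "inj_on f P" "f ` P \<subseteq> P"
  shows "walks f x us y \<Longrightarrow> walks f x' us' y \<Longrightarrow> x \<in> P \<Longrightarrow> x' \<in> P \<Longrightarrow>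
    (\<exists>ws. x' # us' = ws @ x # us) \<or> (\<exists>ws. x # us = ws @ x' # us')"
proof (induction us arbitrary: y us' rule: rev_induct)
  have last_in: "\<exists>z vs. x # us = vs @ [z] \<and> f z = y \<and> z \<in> P" if "walks f x us y" "x \<in> P" for x us y
    using that
  proof (induction us arbitrary: x)
    case (Cons a us)
    then have "walks f a us y" "a \<in> P" using assms by auto
    with Cons.IH obtain z vs where "a # us = vs @ [z]" "f z = y" "z \<in> P" by blast
    then show ?case by (metis append_Cons)
  qed auto
  {
    case Nil
    from last_in[OF Nil(2,4)] obtain z vs where z: "x' # us' = vs @ [z]" "f z = y" "z \<in> P" by blast
    with Nil assms have "z = x" by (auto dest: inj_onD)
    with z show ?case by auto
  next
    case (snoc u us)
    from snoc.prems have u: "walks f x us u" "f u = y" by simp_all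
    have "u \<in> P" using last_in[OF snoc.prems(1,3)] by auto
    show ?case
    proof (cases us' rule: rev_exhaust)
      case Nil
      with snoc.prems u \<open>u \<in> P\<close> assms have "u = x'" by (auto dest: inj_onD)
      with Nil show ?thesis by auto
    next
      case (snoc vs v)
      with snoc.prems have v: "walks f x' vs v" "f v = y" by simp_all
      have "v \<in> P" using last_in[OF \<open>walks f x' us' y\<close> \<open>x' \<in> P\<close>] snoc by auto
      with u v \<open>u \<in> P\<close> assms have "u = v" by (auto dest: inj_onD)
      with snoc.IH[OF u(1), of vs] v \<open>x \<in> P\<close> \<open>x' \<in> P\<close> snoc show ?thesis by auto
    qed
  }
qed

text \<open>Two different steps use different openers and different closers: an opener has only one
  first unmatched successor and, by injectivity, a closer only one last unmatched predecessor.
  Neither step then blocks the other, since matching only removes obstacles.\<close>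

lemma match_step_commute:
  assumes f: "inj_on f P" "f ` P \<subseteq> P" "A \<subseteq> P"
    and "match_step f A B M M1" "match_step f A B M M2" "M1 \<noteq> M2"
  shows "\<exists>M3. match_step f A B M1 M3 \<and> match_step f A B M2 M3"
proof -
  from assms(4) obtain a b us where 1: "a \<in> A - Domain M" "b \<in> B - Range M" "walks f a us b"
    "set us \<inter> unmatched A B M = {}" "M1 = insert (a, b) M" by (rule match_stepE)
  from assms(5) obtain a' b' us' where 2: "a' \<in> A - Domain M" "b' \<in> B - Range M" "walks f a' us' b'"
    "set us' \<inter> unmatched A B M = {}" "M2 = insert (a', b') M" by (rule match_stepE)
  have un: "{a, a', b, b'} \<subseteq> unmatched A B M" using 1 2 unfolding unmatched_def by auto
  have "a \<noteq> a'"
  proof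
    assume "a = a'"
    with walks_prefix[OF 1(3)] 2(3)
    have "(\<exists>ws. us' @ [b'] = us @ [b] @ ws) \<or> (\<exists>ws. us @ [b] = us' @ [b'] @ ws)" by blast
    moreover have "c = d \<or> d \<in> set vs" if "vs @ [c] = xs @ [d] @ ws" for vs xs ws and c d :: 'a
      using that by (cases ws rule: rev_exhaust) auto
    ultimately have "b = b' \<or> b \<in> set us' \<or> b' \<in> set us" by metis
    with un 1(4) 2(4) \<open>a = a'\<close> 1(5) 2(5) \<open>M1 \<noteq> M2\<close> show False by blast
  qed
  have "b \<noteq> b'"
  proof
    assume "b = b'"
    with walks_suffix[OF f(1,2) 1(3)] 2(3) 1(1) 2(1) f(3)
    have "(\<exists>ws. a' # us' = ws @ a # us) \<or> (\<exists>ws. a # us = ws @ a' # us')" by blast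
    with \<open>a \<noteq> a'\<close> have "a \<in> set us' \<or> a' \<in> set us"
      by (auto simp: Cons_eq_append_conv)
    with un 1(4) 2(4) show False by blast
  qed
  have "match_step f A B M1 (insert (a', b') M1)"
    by (rule match_stepI[of _ _ _ _ _ _ us']) (use 1 2 \<open>a \<noteq> a'\<close> \<open>b \<noteq> b'\<close> in \<open>auto simp: unmatched_def\<close>)
  moreover have "match_step f A B M2 (insert (a, b) M2)"
    by (rule match_stepI[of _ _ _ _ _ _ us]) (use 1 2 \<open>a \<noteq> a'\<close> \<open>b \<noteq> b'\<close> in \<open>auto simp: unmatched_def\<close>)
  moreover have "insert (a', b') M1 = insert (a, b) M2" using 1 2 by auto
  ultimately show ?thesis by metis
qed

definition final_matching ::
    "('p \<Rightarrow> 'p) \<Rightarrow> 'p set \<Rightarrow> 'p set \<Rightarrow> ('p \<times> 'p) set \<Rightarrow> bool" where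
  "final_matching f A B M \<longleftrightarrow> (match_step f A B)\<^sup>*\<^sup>* {} M \<and> (\<nexists>M'. match_step f A B M M')"

text \<open>Confluence makes the final state unique, which gives the \<open>THE\<close> in
  \<open>iter_matching\<close> its meaning.\<close>

lemma iter_matching_eq:
  assumes "inj_on f P" "f ` P \<subseteq> P" "A \<subseteq> P" "final_matching f A B M"
  shows "iter_matching f A B = M"
proof -
  have "strong_confluentp (match_step f A B)"
    using match_step_commute[OF assms(1-3)] by (intro strong_confluentpI) blast
  then have conf: "confluentp (match_step f A B)"
    by (rule strong_confluentp_imp_confluentp)
  have "M' = M" if "final_matching f A B M'" for M'
  proof -
    have "\<exists>M''. (match_step f A B)\<^sup>*\<^sup>* M M'' \<and> (match_step f A B)\<^sup>*\<^sup>* M' M''"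
      by (rule confluentpD[OF conf]) (use that assms(4) in \<open>auto simp: final_matching_def\<close>)
    then obtain M'' where M'': "(match_step f A B)\<^sup>*\<^sup>* M M''" "(match_step f A B)\<^sup>*\<^sup>* M' M''" by blast
    have stuck: "N = M''" if "(match_step f A B)\<^sup>*\<^sup>* N M''" "final_matching f A B N" for N
      using that(1)
    proof (cases rule: converse_rtranclpE)
      case (step N')
      then show ?thesis using that(2) unfolding final_matching_def by blast
    qed
    show ?thesis using stuck[OF M''(1) assms(4)] stuck[OF M''(2) that] by simp
  qed
  then show ?thesis
    unfolding iter_matching_def final_matching_def[symmetric] using assms(4) by (intro the_equality)
qed

lemma match_step_reachable_invariant:
  assumes "(match_step f A B)\<^sup>*\<^sup>* {} M"
  shows "M \<subseteq> A \<times> B \<and> one_one M"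
  using assms
proof induction
  case (step M M')
  from step(2) obtain a b us where "a \<in> A - Domain M" "b \<in> B - Range M" "M' = insert (a, b) M"
    by (rule match_stepE)
  with step.IH show ?case by (auto intro: one_one_insert)
qed (auto simp: one_one_def)

text \<open>Every step adds one arc and the arcs stay in the finite set \<open>A \<times> B\<close>,
  so the iteration stops.\<close>

lemma final_matching_exists:
  assumes "finite A" "finite B"
  shows "\<exists>M. final_matching f A B M"
proof -
  have fin: "finite M \<and> card M \<le> card (A \<times> B)" if "(match_step f A B)\<^sup>*\<^sup>* {} M" for M
    using match_step_reachable_invariant[OF that] assms
    by (meson card_mono finite_SigmaI finite_subset)
  have "(match_step f A B)\<^sup>*\<^sup>* {} M \<Longrightarrow> \<exists>M. final_matching f A B M" for M
  proof (induction "card (A \<times> B) - card M" arbitrary: M rule: less_induct)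
    case less
    show ?case
    proof (cases "\<exists>M'. match_step f A B M M'")
      case True
      then obtain M' where M': "match_step f A B M M'" by blast
      with less.prems have reach: "(match_step f A B)\<^sup>*\<^sup>* {} M'" by auto
      from M' obtain a b where "a \<in> A - Domain M" "M' = insert (a, b) M" by (rule match_stepE)
      then have "card M' = Suc (card M)" using fin[OF less.prems]
        by (metis DiffD2 Domain.DomainI card_insert_disjoint)
      with fin[OF reach] have "card (A \<times> B) - card M' < card (A \<times> B) - card M" by linarith
      from less.hyps[OF this reach] show ?thesis .
    qed (use less.prems in \<open>auto simp: final_matching_def\<close>)
  qed
  then show ?thesis by blast
qed

lemma iter_matching_final:
  assumes "inj_on f P" "f ` P \<subseteq> P" "A \<subseteq> P" "finite A" "finite B"
  shows "final_matching f A B (iter_matching f A B)"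
  using final_matching_exists[OF assms(4,5)] iter_matching_eq[OF assms(1-3)] by metis

lemma walks_before:
  assumes "walks f r L r" "distinct (r # L)" "before L a b"
  obtains us where "walks f a us b" "\<And>z. z \<in> set us \<longleftrightarrow> between L a z b"
proof -
  from assms(3) obtain as bs cs where L: "L = as @ a # bs @ b # cs" by (rule before_split)
  with assms have "walks f a bs b" by simp
  with that[of bs] between_split[of as a bs b cs] L assms(2) show thesis by simp
qed

text \<open>Arcs can be added from the inside out, so the arc with the leftmost start is added last.\<close>

lemma noncrossing_reachable:
  assumes L: "walks f r L r" "distinct (r # L)"
  shows "finite M \<Longrightarrow> M \<subseteq> A \<times> B \<Longrightarrow> one_one M \<Longrightarrow>
    noncrossing L M (unmatched A B M) \<Longrightarrow> (match_step f A B)\<^sup>*\<^sup>* {} M"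
proof (induction "card M" arbitrary: M)
  case (Suc n)
  have "Domain M \<noteq> {}" using Suc(2) Domain_empty_iff[of M] by auto
  moreover have "Domain M \<subseteq> set L"
    using Suc.prems(4) before_in_set[of L] unfolding noncrossing_def by fastforce
  moreover have "distinct L" using L by auto
  ultimately obtain a where a: "a \<in> Domain M" "\<And>x. x \<in> Domain M \<Longrightarrow> x \<noteq> a \<Longrightarrow> before L a x"
    using before_first by metis
  then obtain b where ab: "(a, b) \<in> M" by auto
  define M' where "M' = M - {(a, b)}"
  have M: "M = insert (a, b) M'" using ab M'_def by auto
  have ends: "a \<notin> Domain M'" "b \<notin> Range M'" using one_oneD[OF Suc.prems(3) ab] unfolding M'_def by auto
  have U: "unmatched A B M' = unmatched A B M \<union> {a, b}"
    using ab Suc.prems(2) ends unfolding unmatched_def M by blast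
  have nab: "before L a b" using ab Suc.prems(4) unfolding noncrossing_def by blast
  \<comment> \<open>No other arc passes over the leftmost start \<open>a\<close>; not crossing
    \<open>(a, b)\<close>, it does not pass over \<open>b\<close> either. So both may count as
    unmatched points for the smaller family.\<close>
  have uncov: "\<not> between L x a y \<and> \<not> between L x b y" if "(x, y) \<in> M'" for x y
  proof -
    have "x \<noteq> a" "before L a x" using that a(2)[of x] ends M by auto
    then have "\<not> between L x a y" using \<open>distinct L\<close> unfolding between_def by (metis before_asym)
    moreover have "between L x a y \<longleftrightarrow> between L x b y"
      using Suc.prems(4) ab that unfolding noncrossing_def M by blast
    ultimately show ?thesis by blast
  qed
  have "noncrossing L M' (unmatched A B M)"
    using noncrossing_mono[OF Suc.prems(4)] M by blast
  then have nc: "noncrossing L M' (unmatched A B M')"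
    unfolding noncrossing_def U using uncov by fast
  have "(match_step f A B)\<^sup>*\<^sup>* {} M'"
  proof (rule Suc.hyps)
    show "n = card M'" using Suc(2) ab \<open>finite M\<close> by (simp add: M'_def)
  qed (use Suc.prems nc M one_one_subset in auto)
  moreover have "match_step f A B M' M"
  proof -
    obtain us where us: "walks f a us b" "\<And>z. z \<in> set us \<longleftrightarrow> between L a z b"
      using walks_before[OF L nab] by blast
    have "set us \<inter> unmatched A B M' = {}"
    proof -
      have "\<not> between L a a b" "\<not> between L a b b"
        using \<open>distinct L\<close> unfolding between_def by (auto simp: before_irrefl)
      moreover have "\<not> between L a z b" if "z \<in> unmatched A B M" for z
        using Suc.prems(4) ab that unfolding noncrossing_def by blast
      ultimately show ?thesis unfolding U using us(2) by blast
    qed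
    moreover have "a \<in> A - Domain M'" "b \<in> B - Range M'" using ab ends Suc.prems(2) by auto
    ultimately show ?thesis unfolding M using us(1) by (intro match_stepI)
  qed
  ultimately show ?case by (rule rtranclp.rtrancl_into_rtrancl)
qed simp

text \<open>Recognises the result of the iteration without following its choices: the family can be
  built by steps, and once all openers are matched no step is left.\<close>

lemma noncrossing_iter_matching:
  assumes L: "walks f r L r" "distinct (r # L)" and P: "P = set (r # L)" "inj_on f P"
    and "A \<subseteq> P" "finite A" "finite B" "M \<subseteq> A \<times> B" "one_one M"
    and "noncrossing L M (unmatched A B M)" "A \<subseteq> Domain M"
  shows "iter_matching f A B = M"
proof (rule iter_matching_eq[OF P(2) _ \<open>A \<subseteq> P\<close>])
  show "f ` P \<subseteq> P" using walks_closed[OF L(1)] P by simp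
  have "finite M" using assms(6-8) by (meson finite_SigmaI finite_subset)
  then show "final_matching f A B M"
    unfolding final_matching_def
    using noncrossing_reachable[OF L, of M A B] assms(8-11)
    by (auto elim: match_stepE)
qed

text \<open>An old arc crossing the new one would pass over one of its ends, but these lie in
  \<open>U\<close> and are still visible.\<close>

lemma noncrossing_insert:
  assumes "noncrossing L M U" "distinct L" "a \<in> U" "b \<in> U" "before L a b"
    "\<And>z. z \<in> U \<Longrightarrow> \<not> between L a z b" "\<And>x y. (x, y) \<in> M \<Longrightarrow> x \<notin> U \<and> y \<notin> U"
  shows "noncrossing L (insert (a, b) M) U"
proof -
  have "between L a x b \<longleftrightarrow> between L a y b" if xy: "(x, y) \<in> M" for x y
  proof -
    have b: "before L x y" "\<not> between L x a y" "\<not> between L x b y"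
      using assms(1,3,4) xy unfolding noncrossing_def by blast+
    have ne: "x \<noteq> a" "y \<noteq> b" "x \<noteq> b" "y \<noteq> a" using assms(3,4,7) xy by auto
    have "x \<in> set L" "y \<in> set L" "a \<in> set L" "b \<in> set L" using b assms(5) before_in_set by metis+
    then have "before L x a \<or> before L a x" "before L y b \<or> before L b y"
      using ne before_total by metis+
    then show ?thesis
      using b assms(5) before_trans[OF assms(2)] unfolding between_def by blast
  qed
  moreover have "\<not> between L a a b" "\<not> between L a b b"
    using assms(2) unfolding between_def by (auto simp: before_irrefl)
  moreover have "before L x y" "\<not> between L x a y" "\<not> between L x b y"
    "\<And>z. z \<in> U \<Longrightarrow> \<not> between L x z y"
    "\<And>x' y'. (x', y') \<in> M \<Longrightarrow> between L x x' y \<longleftrightarrow> between L x y' y" if "(x, y) \<in> M" for x y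
    using assms(1,3,4) that unfolding noncrossing_def by blast+
  ultimately show ?thesis using assms(5,6)
    unfolding noncrossing_def by auto
qed

subsection \<open>Forests of necklaces and the walk around them\<close>

text \<open>A matching as an involution with the free pearls as fixed points. It agrees with
  \<open>mate\<close> but depends on an edge set only, so edges can be exchanged without building
  configurations.\<close>

definition partner :: "('p \<times> 'p) set \<Rightarrow> 'p \<Rightarrow> 'p" where
  "partner E p = (if \<exists>q. (p, q) \<in> E \<or> (q, p) \<in> E then THE q. (p, q) \<in> E \<or> (q, p) \<in> E else p)"

definition matching :: "('p \<times> 'p) set \<Rightarrow> bool" where
  "matching E \<longleftrightarrow> (\<forall>p q q'. (p, q) \<in> E \<or> (q, p) \<in> E \<longrightarrow> (p, q') \<in> E \<or> (q', p) \<in> E \<longrightarrow> q = q') \<and>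
     (\<forall>p. (p, p) \<notin> E)"

lemma matching_unique:
  "matching E \<Longrightarrow> (p, q) \<in> E \<or> (q, p) \<in> E \<Longrightarrow> (p, q') \<in> E \<or> (q', p) \<in> E \<Longrightarrow> q = q'"
  unfolding matching_def by blast

lemma matching_irrefl: "matching E \<Longrightarrow> (p, p) \<notin> E"
  unfolding matching_def by blast

lemma matching_subset: "matching E \<Longrightarrow> E' \<subseteq> E \<Longrightarrow> matching E'"
  unfolding matching_def by blast

lemma partner_eq:
  assumes "matching E" "(p, q) \<in> E \<or> (q, p) \<in> E"
  shows "partner E p = q"
proof -
  have ex: "\<exists>q. (p, q) \<in> E \<or> (q, p) \<in> E" using assms(2) by (rule exI)
  show ?thesis unfolding partner_def if_P[OF ex]
    using assms(2) by (rule the_equality) (rule matching_unique[OF assms(1) _ assms(2)])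
qed

lemma partner_free: "(\<And>q. (p, q) \<notin> E \<and> (q, p) \<notin> E) \<Longrightarrow> partner E p = p"
  unfolding partner_def by (rule if_not_P) blast

lemma partner_cases:
  assumes "matching E"
  obtains "partner E p = p" "\<And>q. (p, q) \<notin> E \<and> (q, p) \<notin> E"
  | "partner E p \<noteq> p" "(p, partner E p) \<in> E \<or> (partner E p, p) \<in> E"
proof (cases "\<exists>q. (p, q) \<in> E \<or> (q, p) \<in> E")
  case True
  then obtain q where q: "(p, q) \<in> E \<or> (q, p) \<in> E" by blast
  have "partner E p = q" using partner_eq[OF assms q] .
  moreover have "q \<noteq> p" using q matching_irrefl[OF assms] by auto
  ultimately show thesis using q that(2) by simp
next
  case False
  then have free: "(p, q) \<notin> E \<and> (q, p) \<notin> E" for q by blast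
  from that(1)[OF partner_free[OF free] free] show thesis .
qed

lemma partner_partner:
  assumes "matching E"
  shows "partner E (partner E p) = p"
proof (rule partner_cases[OF assms, of p])
  assume "(p, partner E p) \<in> E \<or> (partner E p, p) \<in> E"
  then show ?thesis using partner_eq[OF assms, of "partner E p" p] by blast
qed simp

lemma partner_in:
  assumes "matching E" "E \<subseteq> P \<times> P" "p \<in> P"
  shows "partner E p \<in> P"
  by (rule partner_cases[OF assms(1), of p]) (use assms(2,3) in auto)

section \<open>Connectivity and cycles in the graph of necklaces\<close>

lemma necklace_adj_mono: "E \<subseteq> E' \<Longrightarrow> necklace_adj E \<subseteq> necklace_adj E'"
  unfolding necklace_adj_def by blast

lemma necklace_adj_rtrancl_mono:
  "E \<subseteq> E' \<Longrightarrow> (x, y) \<in> (necklace_adj E)\<^sup>* \<Longrightarrow> (x, y) \<in> (necklace_adj E')\<^sup>*"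
  using rtrancl_mono[OF necklace_adj_mono] by blast

lemma necklace_adj_rtrancl_sym:
  "(x, y) \<in> (necklace_adj E)\<^sup>* \<Longrightarrow> (y, x) \<in> (necklace_adj E)\<^sup>*"
proof -
  have "sym (necklace_adj E)" unfolding necklace_adj_def sym_def by blast
  then have "sym ((necklace_adj E)\<^sup>*)" by (rule sym_rtrancl)
  then show "(x, y) \<in> (necklace_adj E)\<^sup>* \<Longrightarrow> (y, x) \<in> (necklace_adj E)\<^sup>*" by (rule symD)
qed

lemma necklace_adj_insert:
  "necklace_adj (insert (p, q) E) = necklace_adj E \<union> {(fst p, fst q), (fst q, fst p)}"
  unfolding necklace_adj_def by blast

lemma necklace_adj_edge:
  "(p, q) \<in> E \<Longrightarrow> (fst p, fst q) \<in> (necklace_adj E)\<^sup>*"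
  unfolding necklace_adj_def by blast

text \<open>A path can be shortened until it uses the new edge at most once; the disjuncts are no
  use and one use in either direction.\<close>

lemma necklace_adj_insert_cases:
  assumes "(x, y) \<in> (necklace_adj (insert (p, q) E))\<^sup>*"
  shows "(x, y) \<in> (necklace_adj E)\<^sup>* \<or>
    (x, fst p) \<in> (necklace_adj E)\<^sup>* \<and> (fst q, y) \<in> (necklace_adj E)\<^sup>* \<or>
    (x, fst q) \<in> (necklace_adj E)\<^sup>* \<and> (fst p, y) \<in> (necklace_adj E)\<^sup>*"
  using assms
proof induction
  case (step y z)
  then have "(y, z) \<in> necklace_adj E \<or> (y, z) = (fst p, fst q) \<or> (y, z) = (fst q, fst p)"
    unfolding necklace_adj_insert by blast
  with step.IH show ?case
    by (elim disjE conjE) (auto intro: rtrancl_into_rtrancl rtrancl_trans)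
qed auto

definition forest :: "('v pearl \<times> 'v pearl) set \<Rightarrow> bool" where
  "forest E \<longleftrightarrow> (\<forall>(p, q)\<in>E. (fst p, fst q) \<notin> (necklace_adj (E - {(p, q)}))\<^sup>*)"

lemma forest_subset:
  assumes "forest E" "E' \<subseteq> E"
  shows "forest E'"
  unfolding forest_def
proof safe
  fix u i v j
  assume e: "((u, i), (v, j)) \<in> E'"
    and c: "(fst (u, i), fst (v, j)) \<in> (necklace_adj (E' - {((u, i), (v, j))}))\<^sup>*"
  have "E' - {((u, i), (v, j))} \<subseteq> E - {((u, i), (v, j))}" using assms(2) by blast
  from necklace_adj_rtrancl_mono[OF this c] e assms show False
    unfolding forest_def by blast
qed

text \<open>If an old edge lay on a cycle, that cycle would contain the new edge, and the rest of it
  would join \<open>p\<close> and \<open>q\<close> inside \<open>E\<close>.\<close>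

lemma forest_insert:
  assumes "forest E" "(fst p, fst q) \<notin> (necklace_adj E)\<^sup>*"
  shows "forest (insert (p, q) E)"
  unfolding forest_def
proof (rule ballI, rule case_prodI2, rule notI)
  fix e x y
  assume e: "e \<in> insert (p, q) E" "e = (x, y)"
    and c: "(fst x, fst y) \<in> (necklace_adj (insert (p, q) E - {(x, y)}))\<^sup>*"
  show False
  proof (cases "(x, y) = (p, q)")
    case True
    have "insert (p, q) E - {(p, q)} \<subseteq> E" by auto
    from necklace_adj_rtrancl_mono[OF this] c True assms(2) show False by blast
  next
    case False
    let ?E = "E - {(x, y)}"
    have xy: "(x, y) \<in> E" using e False by blast
    have eq: "insert (p, q) E - {(x, y)} = insert (p, q) ?E" using False by blast
    have no: "(fst x, fst y) \<notin> (necklace_adj ?E)\<^sup>*" using assms(1) xy unfolding forest_def by blast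
    have up: "(u, v) \<in> (necklace_adj E)\<^sup>*" if "(u, v) \<in> (necklace_adj ?E)\<^sup>*" for u v
      using necklace_adj_rtrancl_mono[OF _ that] by blast
    have xyE: "(fst x, fst y) \<in> (necklace_adj E)\<^sup>*" using necklace_adj_edge[OF xy] .
    from necklace_adj_insert_cases[OF c[unfolded eq]] no
    have "(fst p, fst q) \<in> (necklace_adj E)\<^sup>*"
      using up xyE necklace_adj_rtrancl_sym by (metis rtrancl_trans)
    with assms(2) show False by blast
  qed
qed

lemma forest_edge:
  "forest E \<Longrightarrow> (p, q) \<in> E \<Longrightarrow> (fst p, fst q) \<notin> (necklace_adj (E - {(p, q)}))\<^sup>*"
  unfolding forest_def by blast

text \<open>A permutation of the pearls whose orbits are the necklaces. Walks around forests depend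
  on nothing else, so words, colours and roots are left out.\<close>

locale necklace_rotation =
  fixes P :: "'v pearl set" and \<rho> :: "'v pearl \<Rightarrow> 'v pearl"
  assumes finite_pearls: "finite P"
    and rot_in: "x \<in> P \<Longrightarrow> \<rho> x \<in> P"
    and rot_inj: "inj_on \<rho> P"
    and rot_fst: "fst (\<rho> x) = fst x"
    and rot_reach: "x \<in> P \<Longrightarrow> y \<in> P \<Longrightarrow> fst x = fst y \<Longrightarrow> (x, y) \<in> {(x, \<rho> x) | x. x \<in> P}\<^sup>*"
begin

definition steps :: "('v pearl \<Rightarrow> 'v pearl) \<Rightarrow> ('v pearl \<times> 'v pearl) set" where
  "steps f = {(x, f x) | x. x \<in> P}"

definition walk :: "('v pearl \<times> 'v pearl) set \<Rightarrow> 'v pearl \<Rightarrow> 'v pearl" where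
  "walk E x = \<rho> (partner E x)"

text \<open>On a finite set an injective self-map is a permutation, so every walk returns. Otherwise
  \<open>f\<close> would map \<open>insert y R\<close> injectively into the smaller set
  \<open>R\<close> of points reachable from \<open>f y\<close>.\<close>

lemma steps_sym:
  assumes "inj_on f P" "f ` P \<subseteq> P" "(x, y) \<in> (steps f)\<^sup>*"
  shows "(y, x) \<in> (steps f)\<^sup>*"
  using assms(3)
proof induction
  case (step y z)
  then have y: "y \<in> P" and z: "z = f y" unfolding steps_def by auto
  define R where "R = (steps f)\<^sup>* `` {z}"
  have "R \<subseteq> P"
  proof
    fix u assume "u \<in> R"
    then have "(z, u) \<in> (steps f)\<^sup>*" unfolding R_def by simp
    then show "u \<in> P" by induction (use y z assms(2) in \<open>auto simp: steps_def\<close>)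
  qed
  have closed: "f u \<in> R" if "u \<in> R" for u
  proof -
    have "(u, f u) \<in> steps f" using that \<open>R \<subseteq> P\<close> unfolding steps_def by blast
    then show ?thesis using that unfolding R_def by (simp add: rtrancl_into_rtrancl)
  qed
  have "z \<in> R" unfolding R_def by simp
  then have "f ` insert y R \<subseteq> R" using closed z by auto
  moreover have fin: "finite R" using \<open>R \<subseteq> P\<close> finite_pearls finite_subset by blast
  moreover have "inj_on f (insert y R)" using assms(1) y \<open>R \<subseteq> P\<close> by (meson inj_on_subset insert_subset)
  ultimately have "card (insert y R) \<le> card R" by (metis card_image card_mono)
  then have "y \<in> R" using fin by (metis card_insert_disjoint not_less_eq_eq order_refl)
  then have "(z, y) \<in> (steps f)\<^sup>*" unfolding R_def by simp
  from rtrancl_trans[OF this step.IH] show ?case .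
qed simp

lemma walk_in: "matching E \<Longrightarrow> E \<subseteq> P \<times> P \<Longrightarrow> walk E ` P \<subseteq> P"
  by (auto simp: walk_def intro!: rot_in partner_in)

lemma walk_inj:
  assumes "matching E" "E \<subseteq> P \<times> P"
  shows "inj_on (walk E) P"
proof (rule inj_onI)
  fix x y assume "x \<in> P" "y \<in> P" "walk E x = walk E y"
  then have "partner E x = partner E y"
    using inj_onD[OF rot_inj _ partner_in[OF assms] partner_in[OF assms]] unfolding walk_def by blast
  then show "x = y" using partner_partner[OF assms(1)] by metis
qed

lemma steps_walk_connected:
  assumes "matching E" "(x, y) \<in> (steps (walk E))\<^sup>*"
  shows "(fst x, fst y) \<in> (necklace_adj E)\<^sup>*"
  using assms(2)
proof induction
  case (step y z)
  then have z: "fst z = fst (partner E y)" unfolding steps_def walk_def by (auto simp: rot_fst)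
  have "(fst y, fst z) \<in> (necklace_adj E)\<^sup>*" unfolding z
    by (rule partner_cases[OF assms(1), of y])
      (auto intro: necklace_adj_edge necklace_adj_rtrancl_sym)
  with step.IH show ?case by (rule rtrancl_trans)
qed simp

text \<open>Joining two components by an edge merges the walks around them into one.\<close>

lemma steps_walk_component:
  assumes "finite E"
  shows "matching E \<Longrightarrow> forest E \<Longrightarrow> E \<subseteq> P \<times> P \<Longrightarrow> x \<in> P \<Longrightarrow> y \<in> P \<Longrightarrow>
    (fst x, fst y) \<in> (necklace_adj E)\<^sup>* \<Longrightarrow> (x, y) \<in> (steps (walk E))\<^sup>*"
  using assms
proof (induction E arbitrary: x y)
  case empty
  have "necklace_adj {} = ({} :: ('v \<times> 'v) set)" unfolding necklace_adj_def by simp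
  then have "fst x = fst y" using empty by simp
  moreover have "walk {} = \<rho>" unfolding walk_def partner_def by auto
  ultimately show ?case using rot_reach empty unfolding steps_def by simp
next
  case (insert e E)
  obtain p q where e: "e = (p, q)" by (cases e)
  let ?f = "walk E" and ?g = "walk (insert e E)"
  let ?F = "(steps ?f)\<^sup>*" and ?G = "(steps ?g)\<^sup>*"
  have E: "matching E" "forest E" "E \<subseteq> P \<times> P" and pq: "p \<in> P" "q \<in> P"
    using insert.prems matching_subset[OF insert.prems(1)] forest_subset[OF insert.prems(2)] e by blast+
  have ncon: "(fst p, fst q) \<notin> (necklace_adj E)\<^sup>*"
    using forest_edge[OF insert.prems(2), of p q] insert.hyps e by simp
  have free: "(p, z) \<notin> E \<and> (z, p) \<notin> E" "(q, z) \<notin> E \<and> (z, q) \<notin> E" for z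
  proof -
    have "(q, z) \<in> insert e E \<or> (z, q) \<in> insert e E \<Longrightarrow> z = p"
      "(p, z) \<in> insert e E \<or> (z, p) \<in> insert e E \<Longrightarrow> z = q"
      using matching_unique[OF insert.prems(1)] e by blast+
    moreover have "(p, q) \<notin> E" "(q, p) \<notin> E"
      using ncon necklace_adj_edge necklace_adj_rtrancl_sym by metis+
    ultimately show "(p, z) \<notin> E \<and> (z, p) \<notin> E" "(q, z) \<notin> E \<and> (z, q) \<notin> E" by blast+
  qed
  have partners: "partner E p = p" "partner E q = q"
    "partner (insert e E) p = q" "partner (insert e E) q = p"
    using free partner_free[of p E] partner_free[of q E] partner_eq[OF insert.prems(1), of p q]
      partner_eq[OF insert.prems(1), of q p] e by auto
  have g: "?g p = ?f q" "?g q = ?f p" using partners unfolding walk_def by simp_all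
  have g_other: "?g z = ?f z" if "z \<noteq> p" "z \<noteq> q" for z
  proof -
    have "(z, w) \<in> insert e E \<longleftrightarrow> (z, w) \<in> E" "(w, z) \<in> insert e E \<longleftrightarrow> (w, z) \<in> E" for w
      using that e by auto
    then show ?thesis unfolding walk_def partner_def by simp
  qed
  \<comment> \<open>The old walk does not meet \<open>a\<close> on its way to \<open>b\<close>,
    because these two ends lie in different components before the edge is added; hence it is a new
    walk as well.\<close>
  have to_end: "(z, b) \<in> ?G" if "(z, b) \<in> ?F" "{a, b} = {p, q}" for z a b
    using that(1)
  proof (induction rule: converse_rtrancl_induct)
    case (step z z')
    then have z: "z \<in> P" "z' = ?f z" unfolding steps_def by auto
    show ?case
    proof (cases "z = b")
      case False
      moreover have "z \<noteq> a"
      proof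
        assume "z = a"
        then have "(a, b) \<in> ?F" using step.hyps by (meson converse_rtrancl_into_rtrancl)
        from steps_walk_connected[OF E(1) this] ncon that(2) show False
          using necklace_adj_rtrancl_sym by (metis doubleton_eq_iff)
      qed
      ultimately have "?g z = z'" using g_other z that(2) by (metis insertCI insertE singletonD)
      then have "(z, z') \<in> steps ?g" using z unfolding steps_def by blast
      with step.IH show ?thesis by (meson converse_rtrancl_into_rtrancl)
    qed simp
  qed simp
  have inP: "?f ` P \<subseteq> P" "inj_on ?f P" using walk_in walk_inj E by blast+
  have return: "(?f z, z) \<in> ?F" if "z \<in> P" for z
  proof -
    have "(z, ?f z) \<in> ?F" using that unfolding steps_def by blast
    from steps_sym[OF inP(2,1) this] show ?thesis .
  qed
  have stepG: "(z, ?g z) \<in> ?G" if "z \<in> P" for z using that unfolding steps_def by blast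
  \<comment> \<open>From \<open>p\<close> the new walk steps to \<open>?f q\<close>, runs around the
    old component of \<open>q\<close> and arrives at \<open>q\<close>; the way from \<open>q\<close>
    to \<open>p\<close> is symmetric.\<close>
  have "(?f q, q) \<in> ?G" using to_end[OF return, of q p] pq by simp
  then have pq_G: "(p, q) \<in> ?G" using stepG[OF pq(1)] g by (metis rtrancl_trans)
  have "(?f p, p) \<in> ?G" using to_end[OF return, of p q] pq by (simp add: insert_commute)
  then have qp_G: "(q, p) \<in> ?G" using stepG[OF pq(2)] g by (metis rtrancl_trans)
  have F_step: "(z, ?f z) \<in> ?G" if "z \<in> P" for z
    using g_other[of z] g stepG[of z] that stepG[OF pq(1)] stepG[OF pq(2)] pq_G qp_G
    by (metis rtrancl_trans)
  have F_G: "(u, v) \<in> ?G" if "(u, v) \<in> ?F" for u v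
    using that
  proof induction
    case (step v w)
    then have "v \<in> P" "w = ?f v" unfolding steps_def by auto
    with F_step step.IH show ?case by (metis rtrancl_trans)
  qed simp
  have E_G: "(u, v) \<in> ?G" if "u \<in> P" "v \<in> P" "(fst u, fst v) \<in> (necklace_adj E)\<^sup>*" for u v
    using F_G insert.IH[OF E that] by blast
  from necklace_adj_insert_cases[OF insert.prems(6)[unfolded e]] show ?case
    using E_G insert.prems(4,5) pq pq_G qp_G by (elim disjE conjE) (meson rtrancl_trans)+
qed

text \<open>A closed walk through \<open>r\<close> of minimal length repeats nothing, since any
  repetition could be cut out.\<close>

lemma cycle_list:
  assumes f: "f ` P \<subseteq> P" and "r \<in> P" and all: "\<And>x. x \<in> P \<Longrightarrow> (r, x) \<in> (steps f)\<^sup>* \<and> (x, r) \<in> (steps f)\<^sup>*"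
  obtains L where "walks f r L r" "distinct (r # L)" "set (r # L) = P"
proof -
  have "\<exists>L. walks f z L r" if "(x, r) \<in> (steps f)\<^sup>*" "f z = x" for x z
    using that
  proof (induction arbitrary: z rule: converse_rtrancl_induct)
    case base
    then have "walks f z [] r" by simp
    then show ?case by blast
  next
    case (step x y)
    then have "f x = y" unfolding steps_def by auto
    with step.IH obtain L where "walks f x L r" by blast
    with step.prems have "walks f z (x # L) r" by simp
    then show ?case by blast
  qed
  then have "\<exists>L. walks f r L r" using all f \<open>r \<in> P\<close> by blast
  then obtain L where L: "walks f r L r" "\<And>L'. walks f r L' r \<Longrightarrow> length L \<le> length L'"
    using ex_has_least_nat[of "\<lambda>L. walks f r L r" _ length] by blast
  have "r \<notin> set L"
  proof
    assume "r \<in> set L"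
    then obtain us vs where "L = us @ r # vs" by (meson split_list)
    with L(1) L(2)[of us] show False by simp
  qed
  moreover have "distinct L"
  proof (rule ccontr)
    assume "\<not> distinct L"
    then obtain us vs ws y where "L = us @ [y] @ vs @ [y] @ ws" by (meson not_distinct_decomp)
    with L(1) L(2)[of "us @ y # ws"] show False by simp
  qed
  moreover have "set (r # L) = P"
  proof
    have "(r, z) \<in> (steps f)\<^sup>* \<Longrightarrow> z \<in> set (r # L)" for z
    proof (induction rule: rtrancl_induct)
      case (step y z)
      then show ?case using walks_closed[OF L(1)] unfolding steps_def by blast
    qed simp
    then show "P \<subseteq> set (r # L)" using all by blast
    have "walks f x us y \<Longrightarrow> x \<in> P \<Longrightarrow> set us \<subseteq> P" for x us y
    proof (induction us arbitrary: x)
      case (Cons a us)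
      then have "a \<in> P" using f by auto
      with Cons.IH[of a] Cons.prems show ?case by simp
    qed simp
    then show "set (r # L) \<subseteq> P" using L(1) \<open>r \<in> P\<close> by simp
  qed
  ultimately show thesis using that L(1) by simp
qed

section \<open>Trees read as lists: cutting and moving an edge\<close>

definition tree_list :: "('v pearl \<times> 'v pearl) set \<Rightarrow> 'v pearl \<Rightarrow> 'v pearl list \<Rightarrow> bool" where
  "tree_list E r L \<longleftrightarrow> E \<subseteq> P \<times> P \<and> matching E \<and> forest E \<and>
     (\<forall>x\<in>P. \<forall>y\<in>P. (fst x, fst y) \<in> (necklace_adj E)\<^sup>*) \<and>
     walks (walk E) r L r \<and> distinct (r # L) \<and> set (r # L) = P"

lemma finite_edges: "E \<subseteq> P \<times> P \<Longrightarrow> finite E"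
  using finite_pearls by (meson finite_SigmaI finite_subset)

lemma tree_list_exists:
  assumes "E \<subseteq> P \<times> P" "matching E" "forest E"
    "\<And>x y. x \<in> P \<Longrightarrow> y \<in> P \<Longrightarrow> (fst x, fst y) \<in> (necklace_adj E)\<^sup>*" "r \<in> P"
  obtains L where "tree_list E r L"
proof -
  have "(x, y) \<in> (steps (walk E))\<^sup>*" if "x \<in> P" "y \<in> P" for x y
    using steps_walk_component[OF finite_edges[OF assms(1)] assms(2,3,1) that assms(4)[OF that]] .
  then obtain L where "walks (walk E) r L r" "distinct (r # L)" "set (r # L) = P"
    using cycle_list[OF walk_in[OF assms(2,1)] \<open>r \<in> P\<close>] \<open>r \<in> P\<close> by metis
  then have "tree_list E r L" using assms(1-4) unfolding tree_list_def by simp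
  with that show thesis .
qed

text \<open>Without \<open>e\<close> the pearl \<open>q\<close> is free and inherits the old
  successor of \<open>p\<close>, so the stretch \<xi> closes up at \<open>q\<close> and becomes the
  whole walk around the component of \<open>q\<close>. Thus an edge cuts off an interval of the
  list.\<close>

lemma edge_split:
  assumes T: "tree_list E r (\<alpha> @ p # \<xi> @ q # \<gamma>)"
    and e: "e \<in> E" "e = (p, q) \<or> e = (q, p)"
  shows "set (\<xi> @ [q]) = {x \<in> P. (fst x, fst q) \<in> (necklace_adj (E - {e}))\<^sup>*}"
proof -
  let ?E = "E - {e}"
  have E: "E \<subseteq> P \<times> P" "matching E" "forest E" and dist: "distinct (r # \<alpha> @ p # \<xi> @ q # \<gamma>)"
    and set: "set (r # \<alpha> @ p # \<xi> @ q # \<gamma>) = P" and w: "walks (walk E) p \<xi> q"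
    using T unfolding tree_list_def by auto
  have E0: "?E \<subseteq> P \<times> P" "matching ?E" "forest ?E"
    using E(1) matching_subset[OF E(2), of ?E] forest_subset[OF E(3), of ?E] by auto
  have part: "partner E p = q" by (rule partner_eq[OF E(2)]) (use e in auto)
  have freeq: "partner ?E q = q"
  proof (rule partner_free)
    fix z
    have "(z, q) \<in> E \<or> (q, z) \<in> E \<Longrightarrow> z = p"
      by (rule matching_unique[OF E(2), of q]) (use e in auto)
    \<comment> \<open>Both orientations at once would be parallel edges and hence a cycle.\<close>
    moreover have "(p, q) \<in> E \<Longrightarrow> (q, p) \<notin> E"
    proof
      assume "(p, q) \<in> E" "(q, p) \<in> E"
      then have "(q, p) \<in> E - {(p, q)}" using dist by auto
      from necklace_adj_rtrancl_sym[OF necklace_adj_edge[OF this]]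
      show False using forest_edge[OF E(3) \<open>(p, q) \<in> E\<close>] by blast
    qed
    ultimately show "(q, z) \<notin> ?E \<and> (z, q) \<notin> ?E" using e by blast
  qed
  have "walk ?E q = walk E p" unfolding walk_def freeq part ..
  moreover have "walk E z = walk ?E z" if "z \<in> set \<xi>" for z
  proof -
    have "z \<noteq> p" "z \<noteq> q" using that dist by auto
    then have "(z, u) \<in> ?E \<longleftrightarrow> (z, u) \<in> E" "(u, z) \<in> ?E \<longleftrightarrow> (u, z) \<in> E" for u using e by auto
    then show ?thesis unfolding walk_def partner_def by simp
  qed
  ultimately have w0: "walks (walk ?E) q \<xi> q" using walks_cong[OF w, of "walk ?E" q] by auto
  have sub: "set (\<xi> @ [q]) \<subseteq> P" using set by auto
  show ?thesis
  proof (intro equalityI subsetI)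
    fix x assume x: "x \<in> set (\<xi> @ [q])"
    have "(q, x) \<in> (steps (walk ?E))\<^sup>*"
      by (rule walks_rtrancl[OF w0 _ x]) (use sub in \<open>auto simp: steps_def\<close>)
    from steps_walk_connected[OF E0(2) this] x sub
    show "x \<in> {x \<in> P. (fst x, fst q) \<in> (necklace_adj ?E)\<^sup>*}"
      using necklace_adj_rtrancl_sym by auto
  next
    fix x assume "x \<in> {x \<in> P. (fst x, fst q) \<in> (necklace_adj ?E)\<^sup>*}"
    then have "x \<in> P" "(fst q, fst x) \<in> (necklace_adj ?E)\<^sup>*"
      using necklace_adj_rtrancl_sym[of "fst x"] by auto
    then have "(q, x) \<in> (steps (walk ?E))\<^sup>*"
      using steps_walk_component[OF finite_edges[OF E0(1)] E0(2,3,1), of q x] sub by auto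
    then show "x \<in> set (\<xi> @ [q])"
    proof induction
      case (step y z)
      then show ?case using walks_closed[OF w0] unfolding steps_def by auto
    qed simp
  qed
qed

lemma edge_split_edges:
  assumes "tree_list E r (\<alpha> @ p # \<xi> @ q # \<gamma>)" "e \<in> E" "e = (p, q) \<or> e = (q, p)"
    and "(x, y) \<in> E" "(x, y) \<noteq> e"
  shows "x \<in> set (\<xi> @ [q]) \<longleftrightarrow> y \<in> set (\<xi> @ [q])"
proof -
  have xy: "(fst x, fst y) \<in> (necklace_adj (E - {e}))\<^sup>*"
    using assms(4,5) by (intro necklace_adj_edge) blast
  note yx = necklace_adj_rtrancl_sym[OF xy]
  have "x \<in> P" "y \<in> P" using assms(1,4) unfolding tree_list_def by auto
  then show ?thesis
    unfolding edge_split[OF assms(1-3)]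
    using rtrancl_trans[OF xy, of "fst q"] rtrancl_trans[OF yx, of "fst q"] by blast
qed

text \<open>The pearl \<open>t\<close> lies on the stretch ending at \<open>b\<close>, hence on the
  side of \<open>b\<close> when the edge is cut, so joining \<open>d\<close> to \<open>t\<close>
  reconnects the two sides. The four stretches of the walk survive; only the successors of
  \<open>d\<close>, \<open>t\<close> and \<open>b\<close> are permuted cyclically.\<close>

lemma tree_list_switch:
  assumes T: "tree_list E r (\<alpha> @ d # \<xi> @ t # \<beta> @ b # \<gamma>)"
    and db: "(d, b) \<in> E" and free: "\<And>z. (t, z) \<notin> E \<and> (z, t) \<notin> E"
    and E': "E' = insert (d, t) (E - {(d, b)})"
  shows "tree_list E' r (\<alpha> @ d # \<beta> @ b # \<xi> @ t # \<gamma>)"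
proof -
  let ?L = "\<alpha> @ d # \<xi> @ t # \<beta> @ b # \<gamma>" and ?E = "E - {(d, b)}"
  have E: "E \<subseteq> P \<times> P" "matching E" "forest E"
    "\<And>x y. x \<in> P \<Longrightarrow> y \<in> P \<Longrightarrow> (fst x, fst y) \<in> (necklace_adj E)\<^sup>*"
    and dist: "distinct (r # ?L)"
    and set: "set (r # ?L) = P" and w: "walks (walk E) r ?L r"
    using T unfolding tree_list_def by auto
  have dtP: "d \<in> P" "t \<in> P" "b \<in> P" using set by auto
  have ne: "d \<noteq> t" "d \<noteq> b" "t \<noteq> b" using dist by auto
  have "t \<in> set ((\<xi> @ t # \<beta>) @ [b])" by simp
  then have tb: "(fst t, fst b) \<in> (necklace_adj ?E)\<^sup>*"
    using edge_split[of E r \<alpha> d "\<xi> @ t # \<beta>" b \<gamma> "(d, b)"] T db by auto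
  have dt: "(fst d, fst t) \<notin> (necklace_adj ?E)\<^sup>*"
    using tb forest_edge[OF E(3) db] rtrancl_trans[of "fst d" "fst t" _ "fst b"] by blast
  have "forest E'" unfolding E' using forest_subset[OF E(3), of ?E] by (intro forest_insert dt) auto
  moreover have m: "matching E'"
  proof -
    have dz: "z = b" if "(d, z) \<in> E \<or> (z, d) \<in> E" for z
      by (rule matching_unique[OF E(2) that]) (use db in auto)
    have nbd: "(b, d) \<notin> E"
    proof
      assume "(b, d) \<in> E"
      then have "(b, d) \<in> ?E" using ne by auto
      from necklace_adj_rtrancl_sym[OF necklace_adj_edge[OF this]]
      show False using forest_edge[OF E(3) db] by blast
    qed
    have iff: "(p, q) \<in> E' \<or> (q, p) \<in> E' \<longleftrightarrow> 
      (if p = d then q = t else if p = t then q = d else ((p, q) \<in> ?E \<or> (q, p) \<in> ?E))" for p q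
      unfolding E' using dz[of q] dz[of p] nbd free[of p] free[of q] ne by auto
    show ?thesis
      unfolding matching_def iff
    proof (intro conjI allI impI)
      show "(p, p) \<notin> E'" for p using matching_irrefl[OF E(2), of p] ne unfolding E' by auto
      fix p q q'
      assume "if p = d then q = t else if p = t then q = d else (p, q) \<in> ?E \<or> (q, p) \<in> ?E"
        "if p = d then q' = t else if p = t then q' = d else (p, q') \<in> ?E \<or> (q', p) \<in> ?E"
      then show "q = q'" using matching_unique[OF E(2), of p q q'] by (auto split: if_splits)
    qed
  qed
  moreover have "E' \<subseteq> P \<times> P" unfolding E' using E(1) dtP by auto
  moreover have "(fst x, fst y) \<in> (necklace_adj E')\<^sup>*" if "x \<in> P" "y \<in> P" for x y
  proof -
    have up: "(u, v) \<in> (necklace_adj E')\<^sup>*" if "(u, v) \<in> (necklace_adj ?E)\<^sup>*" for u v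
      using necklace_adj_rtrancl_mono[OF _ that, of E'] unfolding E' by blast
    have "(fst d, fst t) \<in> (necklace_adj E')\<^sup>*" unfolding E' by (intro necklace_adj_edge) simp
    then have "(fst d, fst b) \<in> (necklace_adj E')\<^sup>*" using up[OF tb] by (rule rtrancl_trans)
    moreover have "(fst x, fst y) \<in> (necklace_adj (insert (d, b) ?E))\<^sup>*"
      using E(4)[OF that] db by (simp add: insert_absorb)
    ultimately have *: "(fst d, fst b) \<in> (necklace_adj E')\<^sup>*" "(fst b, fst d) \<in> (necklace_adj E')\<^sup>*"
      and "(fst x, fst y) \<in> (necklace_adj (insert (d, b) ?E))\<^sup>*"
      using necklace_adj_rtrancl_sym by auto
    from necklace_adj_insert_cases[OF this(3)] show ?thesis
      using up rtrancl_trans[OF rtrancl_trans[OF _ *(1)]] rtrancl_trans[OF rtrancl_trans[OF _ *(2)]]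
      by blast
  qed
  moreover have "walks (walk E') r (\<alpha> @ d # \<beta> @ b # \<xi> @ t # \<gamma>) r"
  proof -
    have old: "partner E d = b" "partner E b = d" "partner E t = t"
      using partner_eq[OF E(2)] db partner_free[of t E] free by auto
    have new: "partner E' d = t" "partner E' t = d"
      using partner_eq[OF m] E' by auto
    have "partner E' b = b"
    proof (rule partner_free)
      fix z
      have "(b, z) \<in> E \<or> (z, b) \<in> E \<Longrightarrow> z = d"
        by (rule matching_unique[OF E(2), of b]) (use db in auto)
      moreover have "(b, d) \<notin> E"
      proof
        assume "(b, d) \<in> E"
        then have "(b, d) \<in> ?E" using ne by auto
        from necklace_adj_rtrancl_sym[OF necklace_adj_edge[OF this]]
        show False using forest_edge[OF E(3) db] by blast
      qed
      ultimately show "(b, z) \<notin> E' \<and> (z, b) \<notin> E'" unfolding E' using ne by auto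
    qed
    with old new have three: "walk E' d = walk E t" "walk E' t = walk E b" "walk E' b = walk E d"
      unfolding walk_def by simp_all
    have other: "walk E z = walk E' z" if "z \<notin> {d, t, b}" for z
    proof -
      have "(z, u) \<in> E' \<longleftrightarrow> (z, u) \<in> E" "(u, z) \<in> E' \<longleftrightarrow> (u, z) \<in> E" for u
        using that unfolding E' by auto
      then show ?thesis unfolding walk_def partner_def by simp
    qed
    have o: "z \<in> set us \<Longrightarrow> set us \<subseteq> insert r (set \<alpha> \<union> set \<beta> \<union> set \<gamma> \<union> set \<xi>) \<Longrightarrow> walk E z = walk E' z" for z us
      using dist by (intro other) auto
    have ws: "walks (walk E) r \<alpha> d" "walks (walk E) d \<xi> t" "walks (walk E) t \<beta> b" "walks (walk E) b \<gamma> r"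
      using w by auto
    have "walks (walk E') r \<alpha> d" by (rule walks_cong[OF ws(1)]) (use o[of _ "[r]"] o[of _ \<alpha>] in auto)
    moreover have "walks (walk E') d \<beta> b" by (rule walks_cong[OF ws(3)]) (use three o[of _ \<beta>] in auto)
    moreover have "walks (walk E') b \<xi> t" by (rule walks_cong[OF ws(2)]) (use three o[of _ \<xi>] in auto)
    moreover have "walks (walk E') t \<gamma> r" by (rule walks_cong[OF ws(4)]) (use three o[of _ \<gamma>] in auto)
    ultimately show ?thesis by simp
  qed
  moreover have "distinct (r # \<alpha> @ d # \<beta> @ b # \<xi> @ t # \<gamma>)" "set (r # \<alpha> @ d # \<beta> @ b # \<xi> @ t # \<gamma>) = P"
    using dist set by auto
  ultimately show ?thesis unfolding tree_list_def by blast
qed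

text \<open>The right corner of \<open>x\<close> in the reverse walk is the left corner of its partner.\<close>

lemma walks_reverse:
  assumes "matching E" "E \<subseteq> P \<times> P" and inv: "\<And>x. x \<in> P \<Longrightarrow> \<rho>' (\<rho> x) = x"
  shows "walks (walk E) x L y \<Longrightarrow> x \<in> P \<Longrightarrow> set L \<subseteq> P \<Longrightarrow>
    walks (\<lambda>z. \<rho>' (partner E z)) (partner E y) (rev (map (partner E) L)) (partner E x)"
proof (induction L arbitrary: x)
  case Nil
  then show ?case
    using inv[OF partner_in[OF assms(1,2)], of x]
    by (auto simp: walk_def partner_partner[OF assms(1)])
next
  case (Cons a L)
  from Cons.IH[of a] Cons.prems show ?case
    using inv[OF partner_in[OF assms(1,2)], of x]
    by (auto simp: walk_def partner_partner[OF assms(1)])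
qed

text \<open>The edge towards the root leaves the necklace of \<open>p\<close> at its last listed
  pearl \<open>q\<close>, and its other end \<open>m\<close> precedes the whole necklace. As the
  partner of \<open>p\<close> does not come first, \<open>p\<close> is not \<open>q\<close>, and a
  necklace has one box only. Applied to a leftmost bad box this produces an earlier pearl, which
  drives the descents further on.\<close>

lemma enclosing_edge:
  assumes T: "tree_list E r L" and r: "snd r = 0" "partner E r = r"
    and p: "p \<in> set L" "snd p = 0" "partner E p = p \<or> before L p (partner E p)"
  obtains m q where "partner E q = m" "q \<in> P" "m \<in> P" "before L m q" "before L m p" "snd q \<noteq> 0"
proof -
  have E: "E \<subseteq> P \<times> P" "matching E" and dist: "distinct (r # L)"
    and set: "set (r # L) = P" and w: "walks (walk E) r L r"
    using T unfolding tree_list_def by auto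
  define V where "V = {x \<in> P. fst x = fst p}"
  have pV: "p \<in> V" unfolding V_def using p(1) set by auto
  have rV: "r \<notin> V"
  proof
    assume "r \<in> V"
    then have "r = p" using r(1) p(2) unfolding V_def by (auto simp: prod_eq_iff)
    then show False using p(1) dist by simp
  qed
  have "V \<noteq> {}" "distinct L" using pV dist by auto
  have "V \<subseteq> P" unfolding V_def by blast
  then have "V \<subseteq> set L" using set rV by auto
  obtain q where q: "q \<in> V" "\<And>y. y \<in> V \<Longrightarrow> y \<noteq> q \<Longrightarrow> before L y q"
    using before_last[OF \<open>V \<noteq> {}\<close> \<open>V \<subseteq> set L\<close> \<open>distinct L\<close>] by metis
  have qP: "q \<in> P" using q(1) unfolding V_def by simp
  define m where "m = partner E q"
  have mP: "m \<in> P" using m_def partner_in[OF E(2,1) qP] by simp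
  have mq: "partner E m = q" unfolding m_def using partner_partner[OF E(2)] .
  \<comment> \<open>Crossing from \<open>m\<close> to \<open>q\<close>, the walk continues on the
    necklace of \<open>q\<close> at a pearl no later than \<open>q\<close>, the last one; so
    \<open>m\<close> precedes \<open>q\<close>.\<close>
  have "walk E m = \<rho> q" unfolding walk_def mq ..
  then have fm: "walk E m \<in> V" using q(1) rot_in[OF qP] rot_fst[of q] unfolding V_def by simp
  have after: "walk E z = r \<or> before L z (walk E z)" if "z \<in> set L" for z
  proof -
    from split_list[OF that] obtain us vs where L: "L = us @ z # vs" by blast
    then have "walks (walk E) z vs r" using w by simp
    then have "walk E z = r \<or> walk E z \<in> set vs" by (cases vs) auto
    then show ?thesis unfolding L by auto
  qed
  have "m \<noteq> r" using mq r(2) q(1) rV by auto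
  then have mL: "m \<in> set L" using mP set by auto
  have lt: "before L m (walk E m)" using after[OF mL] fm rV by auto
  have "walk E m = q \<or> before L (walk E m) q" using q(2)[OF fm] by blast
  then have mbq: "before L m q" using lt before_trans[OF \<open>distinct L\<close>] by blast
  then obtain \<alpha> \<xi> \<gamma> where L: "L = \<alpha> @ m # \<xi> @ q # \<gamma>" by (rule before_split)
  have "m \<noteq> q" using mbq before_irrefl[OF \<open>distinct L\<close>, of m] by auto
  then have "(q, m) \<in> E \<or> (m, q) \<in> E"
    unfolding m_def by (metis partner_cases[OF E(2), of q])
  then obtain e where e: "e \<in> E" "e = (m, q) \<or> e = (q, m)" by blast
  have "p \<in> set (\<xi> @ [q])"
    unfolding edge_split[OF T[unfolded L] e] using pV q(1) unfolding V_def by simp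
  moreover have "p \<noteq> q"
    using p(3) m_def mbq \<open>m \<noteq> q\<close> before_asym[OF \<open>distinct L\<close>, of m q] by auto
  ultimately have "before L m p" "snd q \<noteq> 0"
    using q(1) p(2) L unfolding V_def by (auto simp: prod_eq_iff)
  with that[of q m] m_def qP mP mbq show thesis by blast
qed

end

subsection \<open>Switching red edges to blue edges one at a time\<close>

text \<open>
  Each diamond \<open>d\<close> has a box \<open>bx d\<close> and a triangle \<open>tr d\<close>.  It is joined to \<open>tr d\<close> if \<open>d \<in> S\<close> and to
  \<open>bx d\<close> otherwise; the other one of its two edges is drawn as an arc along the tree.  In terms of the
  clockwise walk, the arc of the edge to \<open>tr d\<close> starts at the left corner \<open>d\<close>, while the arc of the edge
  to \<open>bx d\<close> starts at the right corner of \<open>d\<close>, which is the corner of the partner \<open>tr d\<close>.  Both arcs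
  pass over the same corners, which is why switching a single edge keeps the arcs non-crossing.
\<close>

locale switching = necklace_rotation P \<rho>
  for P :: "'v pearl set" and \<rho> :: "'v pearl \<Rightarrow> 'v pearl" +
  fixes r :: "'v pearl" and K :: "('v pearl \<times> 'v pearl) set" and D :: "'v pearl set"
    and bx tr :: "'v pearl \<Rightarrow> 'v pearl" and Z :: "'v pearl set"
  assumes root: "r \<in> P" "snd r = 0"
    and fixed_edge: "(x, y) \<in> K \<Longrightarrow> x \<in> P \<and> y \<in> P \<and> snd x \<noteq> 0 \<and> snd y = 0 \<and> y \<noteq> r \<and>
      x \<notin> D \<and> x \<notin> tr ` D \<and> y \<notin> bx ` D"
    and diamond: "d \<in> D \<Longrightarrow> d \<in> P \<and> snd d \<noteq> 0 \<and> d \<notin> tr ` D \<and> bx d \<in> P \<and> snd (bx d) = 0 \<and> bx d \<noteq> r \<and>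
      tr d \<in> P \<and> snd (tr d) \<noteq> 0 \<and> tr d \<notin> Z"
    and inj_bx: "inj_on bx D" and inj_tr: "inj_on tr D"
begin

definition active :: "'v pearl set \<Rightarrow> ('v pearl \<times> 'v pearl) set" where
  "active S = K \<union> {(d, bx d) | d. d \<in> D - S} \<union> {(d, tr d) | d. d \<in> D \<inter> S}"

definition arcs :: "'v pearl set \<Rightarrow> ('v pearl \<times> 'v pearl) set" where
  "arcs S = {(d, tr d) | d. d \<in> D - S} \<union> {(bx d, tr d) | d. d \<in> D \<inter> S}"

text \<open>The last two conjuncts keep the exchange going: an unswitched diamond, its triangle and
  its box occur in this order (the first half being its arc), and unswitched diamonds precede
  switched ones. In the applications \<open>Z\<close> is the set of defects, which no arc may ever
  cover.\<close>

definition state :: "'v pearl set \<Rightarrow> 'v pearl list \<Rightarrow> bool" where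
  "state S L \<longleftrightarrow> S \<subseteq> D \<and> tree_list (active S) r L \<and> noncrossing L (arcs S) Z \<and>
     (\<forall>d\<in>D - S. before L (tr d) (bx d)) \<and> (\<forall>d\<in>D - S. \<forall>d'\<in>S. before L d d')"

lemma activeE:
  assumes "(x, y) \<in> active S"
  obtains "(x, y) \<in> K" | "x \<in> D" "x \<notin> S" "y = bx x" | "x \<in> D" "x \<in> S" "y = tr x"
  using assms unfolding active_def by blast

lemma free_root: "(r, z) \<notin> active S \<and> (z, r) \<notin> active S"
  using root diamond fixed_edge by (metis activeE)

lemma free_tr:
  assumes "d \<in> D" "d \<notin> S"
  shows "(tr d, z) \<notin> active S \<and> (z, tr d) \<notin> active S"
proof (intro conjI notI)
  assume "(tr d, z) \<in> active S"
  then show False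
    by (rule activeE) (use fixed_edge[of "tr d" z] diamond[OF assms(1)] diamond[of "tr d"] assms in auto)
next
  assume "(z, tr d) \<in> active S"
  then show False
  proof (rule activeE)
    assume "z \<in> D" "z \<in> S" "tr d = tr z"
    then show False using inj_onD[OF inj_tr, of d z] assms by auto
  qed (use fixed_edge[of z "tr d"] diamond[OF assms(1)] diamond[of z] in auto)
qed

lemma free_bx:
  assumes "d \<in> D" "d \<in> S"
  shows "(bx d, z) \<notin> active S \<and> (z, bx d) \<notin> active S"
proof (intro conjI notI)
  assume "(bx d, z) \<in> active S"
  then show False
    by (rule activeE) (use fixed_edge[of "bx d" z] diamond[OF assms(1)] diamond[of "bx d"] assms in auto)
next
  assume "(z, bx d) \<in> active S"
  then show False
  proof (rule activeE)
    assume "z \<in> D" "z \<notin> S" "bx d = bx z"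
    then show False using inj_onD[OF inj_bx, of d z] assms by auto
  qed (use fixed_edge[of z "bx d"] diamond[OF assms(1)] diamond[of z] assms in auto)
qed

lemma active_insert:
  assumes "d \<in> D" "d \<notin> S"
  shows "active (insert d S) = insert (d, tr d) (active S - {(d, bx d)})"
    and "active S = insert (d, bx d) (active (insert d S) - {(d, tr d)})"
proof -
  have "(d, y) \<notin> K" for y using fixed_edge[of d y] assms(1) by auto
  moreover have "bx d \<noteq> tr d" using diamond[OF assms(1)] by auto
  ultimately show "active (insert d S) = insert (d, tr d) (active S - {(d, bx d)})"
    "active S = insert (d, bx d) (active (insert d S) - {(d, tr d)})"
    unfolding active_def using assms by auto
qed

text \<open>Common part of \<open>arcs S\<close> and \<open>arcs (insert d S)\<close>, isolated so
  that the two families differ in one arc as in \<open>noncrossing_swap\<close>.\<close>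

definition other_arcs :: "'v pearl set \<Rightarrow> 'v pearl \<Rightarrow> ('v pearl \<times> 'v pearl) set" where
  "other_arcs S d = {(d', tr d') | d'. d' \<in> D - S - {d}} \<union> {(bx d', tr d') | d'. d' \<in> D \<inter> S - {d}}"

lemma arcs_insert:
  assumes "d \<in> D" "d \<notin> S"
  shows "arcs S = insert (d, tr d) (other_arcs S d)"
    and "arcs (insert d S) = insert (bx d, tr d) (other_arcs S d)"
  unfolding arcs_def other_arcs_def using assms by blast+

lemma other_arcs_ends:
  assumes "d \<in> D" "(x, y) \<in> other_arcs S d"
  shows "x \<notin> {d, tr d, bx d} \<and> y \<notin> {d, tr d, bx d}"
proof -
  from assms(2) obtain d' where d': "d' \<in> D" "d' \<noteq> d" "y = tr d'" "x = d' \<or> x = bx d'"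
    unfolding other_arcs_def by blast
  then have "tr d' \<noteq> tr d" "bx d' \<noteq> bx d" using inj_onD[OF inj_tr] inj_onD[OF inj_bx] assms(1) by blast+
  moreover have "d' \<noteq> tr d" "d \<noteq> tr d'"
    using diamond[OF d'(1)] diamond[OF assms(1)] d'(1) assms(1) by blast+
  ultimately show ?thesis using d' diamond[OF d'(1)] diamond[OF assms(1)] by auto
qed

lemma stateD:
  assumes "state S L"
  shows "S \<subseteq> D" "tree_list (active S) r L" "noncrossing L (arcs S) Z"
    "\<And>d. d \<in> D \<Longrightarrow> d \<notin> S \<Longrightarrow> before L (tr d) (bx d)"
    "\<And>d d'. d \<in> D \<Longrightarrow> d \<notin> S \<Longrightarrow> d' \<in> S \<Longrightarrow> before L d d'"
    "distinct L" "r \<notin> set L" "set L = P - {r}"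
  using assms unfolding state_def tree_list_def by auto

lemma diamonds_in_list: "state S L \<Longrightarrow> D \<subseteq> set L"
  using stateD(8)[of S L] diamond diamond[of r] root(2) by auto

lemma before_split3:
  assumes "distinct us" "before us x y" "before us y z"
  obtains as bs cs ds where "us = as @ x # bs @ y # cs @ z # ds"
proof -
  from assms(2) obtain as bs es where us: "us = as @ x # bs @ y # es" by (rule before_split)
  have "z \<in> set es" using assms(1,3) unfolding us by (auto dest: before_in_set)
  from split_list[OF this] obtain cs ds where "es = cs @ z # ds" by blast
  with us that show thesis by blast
qed

lemma switch_keeps_before:
  assumes "distinct (\<alpha> @ d # \<xi> @ t # \<beta> @ b # \<gamma>)"
    and "x \<notin> {d, t, b}" "y \<notin> {d, t, b}" "x \<notin> set \<xi>" "y \<notin> set \<xi>" "y \<notin> set \<beta>"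
  shows "before (\<alpha> @ d # \<xi> @ t # \<beta> @ b # \<gamma>) x y \<longleftrightarrow> before (\<alpha> @ d # \<beta> @ b # \<xi> @ t # \<gamma>) x y"
proof -
  have "\<not> before \<xi> x y" "\<not> before \<beta> x y" using assms before_in_set by metis+
  then show ?thesis using assms(2-6) by auto
qed

text \<open>Tree and arcs are settled by \<open>tree_list_switch\<close>, used once in each
  direction, and by \<open>noncrossing_swap\<close>. What remains is the order of
  \<open>tr d0\<close> and \<open>bx d0\<close> for another unswitched \<open>d0\<close>. Since
  \<open>d0\<close> lies in \<alpha>, its arc cannot end in \<xi>, and its edge cannot end on the
  stretch cut off by the edge of \<open>d\<close>; so the moved block does not alter their
  order.\<close>

lemma switch_state:
  assumes d: "d \<in> D" "d \<notin> S" "S \<subseteq> D"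
    and L: "L = \<alpha> @ d # \<xi> @ tr d # \<beta> @ bx d # \<gamma>" and L': "L' = \<alpha> @ d # \<beta> @ bx d # \<xi> @ tr d # \<gamma>"
    and pre: "\<And>d0. d0 \<in> D \<Longrightarrow> d0 \<notin> S \<Longrightarrow> d0 \<noteq> d \<Longrightarrow> d0 \<in> set \<alpha>"
    and suf: "\<And>d0. d0 \<in> S \<Longrightarrow> d0 \<notin> set \<alpha>"
  shows "state S L \<longleftrightarrow> state (insert d S) L'"
proof -
  let ?t = "tr d" and ?b = "bx d"
  have d_edge: "(d, ?b) \<in> active S" "(d, ?t) \<in> active (insert d S)"
    unfolding active_def using d by blast+
  have tree: "tree_list (active S) r L \<longleftrightarrow> tree_list (active (insert d S)) r L'"
    using tree_list_switch[of "active S" r \<alpha> d \<xi> ?t \<beta> ?b \<gamma>, OF _ d_edge(1) free_tr[OF d(1,2)] active_insert(1)[OF d(1,2)]]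
      tree_list_switch[of "active (insert d S)" r \<alpha> d \<beta> ?b \<xi> ?t \<gamma>, OF _ d_edge(2) free_bx[OF d(1)] active_insert(2)[OF d(1,2)]]
    unfolding L L' by auto
  show ?thesis
  proof (cases "tree_list (active S) r L")
    case True
    with tree have T: "tree_list (active S) r L" "tree_list (active (insert d S)) r L'" by auto
    then have dist: "distinct L" "distinct L'" and set: "set L' = set L" "set L = P - {r}"
      unfolding tree_list_def L L' by auto
    have "tr d \<notin> Z" using diamond d by blast
    have nc: "noncrossing L (arcs S) Z \<longleftrightarrow> noncrossing L' (arcs (insert d S)) Z"
      unfolding arcs_insert[OF d(1,2)] L L'
      by (rule noncrossing_swap[OF dist(1)[unfolded L] _ \<open>tr d \<notin> Z\<close>])
        (rule other_arcs_ends[OF d(1)])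
    have after: "before L' x y" "before L x y" if "x \<in> insert d (set \<alpha>)" "y \<in> S" for x y
    proof -
      have y: "y \<in> P - {r}" "y \<notin> set \<alpha>" "y \<noteq> d" using that d diamond[of y] suf[OF that(2)] root(2) by auto
      then have "y \<in> set (\<xi> @ tr d # \<beta> @ bx d # \<gamma>)" using set(2) unfolding L by auto
      then show "before L x y" "before L' x y" using that(1) unfolding L L' by (elim insertE; force)+
    qed
    have red: "before L (tr d0) (bx d0) \<longleftrightarrow> before L' (tr d0) (bx d0)"
      if d0: "d0 \<in> D" "d0 \<notin> S" "d0 \<noteq> d"
        and nc: "noncrossing L (arcs S) Z" "noncrossing L' (arcs (insert d S)) Z" for d0
    proof -
      have "d0 \<in> set \<alpha>" using pre[OF d0] .
      then have d0n: "d0 \<notin> set \<xi>" "d0 \<notin> set \<beta>" "d0 \<noteq> ?t" "d0 \<noteq> ?b" using dist unfolding L by auto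
      have arc: "(d0, tr d0) \<in> other_arcs S d" unfolding other_arcs_def using d0 by blast
      have ends: "bx d0 \<noteq> bx d" "bx d0 \<noteq> tr d" "bx d0 \<noteq> d" "tr d0 \<notin> {d, ?t, ?b}"
        using other_arcs_ends[OF d(1) arc] inj_onD[OF inj_bx, of d0 d] d0 d diamond[of d0] diamond[of d] by auto
      have "between L d d0 ?t \<longleftrightarrow> between L d (tr d0) ?t"
        using nc(1) arc arcs_insert(1)[OF d(1,2)] unfolding noncrossing_def by blast
      then have "tr d0 \<notin> set \<xi>"
        using between_split[of \<alpha> d \<xi> ?t "\<beta> @ ?b # \<gamma>"] dist(1) d0n unfolding L by simp
      moreover have "bx d0 \<notin> set (\<xi> @ ?t # \<beta>)"
      proof -
        have "(d0, bx d0) \<in> active S" unfolding active_def using d0 by blast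
        then show ?thesis
          using edge_split_edges[of "active S" r \<alpha> d "\<xi> @ ?t # \<beta>" ?b \<gamma> "(d, ?b)" d0 "bx d0"]
            T(1) d_edge(1) d0(3) d0n unfolding L by auto
      qed
      ultimately show ?thesis
        using switch_keeps_before[of \<alpha> d \<xi> ?t \<beta> ?b \<gamma> "tr d0" "bx d0"] dist(1) ends unfolding L L' by auto
    qed
    have "before L ?t ?b" unfolding L by simp
    have *: "(\<forall>d0\<in>D - S. before L (tr d0) (bx d0)) \<longleftrightarrow>
        (\<forall>d0\<in>D - insert d S. before L' (tr d0) (bx d0))"
      if "noncrossing L (arcs S) Z" "noncrossing L' (arcs (insert d S)) Z"
      using red[OF _ _ _ that] \<open>before L ?t ?b\<close> by (metis DiffD1 DiffD2 DiffI insert_iff)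
    have "\<forall>d0\<in>D - S. \<forall>d'\<in>S. before L d0 d'" using after(2) pre by blast
    moreover have "\<forall>d0\<in>D - insert d S. \<forall>d'\<in>insert d S. before L' d0 d'"
    proof (intro ballI)
      fix d0 d' assume "d0 \<in> D - insert d S" "d' \<in> insert d S"
      then show "before L' d0 d'" using after(1)[of d0 d'] pre[of d0] unfolding L' by auto
    qed
    ultimately show ?thesis unfolding state_def using d T nc * by auto
  qed (use tree in \<open>auto simp: state_def\<close>)
qed

text \<open>Taking the last unswitched diamond puts all other unswitched ones before it; the
  switched ones come after it by the invariant. Both are demanded by
  \<open>switch_state\<close>.\<close>

lemma switch_forward:
  assumes st: "state S L" and "S \<noteq> D"
  shows "\<exists>d\<in>D - S. \<exists>L'. state (insert d S) L'"
proof -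
  note s = stateD[OF st]
  have "D - S \<noteq> {}" "D - S \<subseteq> set L" using s(1) assms(2) diamonds_in_list[OF st] by auto
  from before_last[OF this s(6)] obtain d where d: "d \<in> D - S"
    "\<And>d0. d0 \<in> D - S \<Longrightarrow> d0 \<noteq> d \<Longrightarrow> before L d0 d" by blast
  have "(d, tr d) \<in> arcs S" unfolding arcs_def using d by blast
  then have "before L d (tr d)" using s(3) unfolding noncrossing_def by blast
  moreover have "before L (tr d) (bx d)" using s(4) d by auto
  ultimately obtain \<alpha> \<xi> \<beta> \<gamma> where L: "L = \<alpha> @ d # \<xi> @ tr d # \<beta> @ bx d # \<gamma>"
    using before_split3[OF s(6)] by metis
  have *: "before L x d \<longleftrightarrow> x \<in> set \<alpha>" "before L d x \<Longrightarrow> x \<notin> set \<alpha>" for x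
    using s(6) unfolding L by (auto dest: before_in_set)
  have "state S L \<longleftrightarrow> state (insert d S) (\<alpha> @ d # \<beta> @ bx d # \<xi> @ tr d # \<gamma>)"
  proof (rule switch_state[OF _ _ s(1) L refl])
    show "d0 \<in> set \<alpha>" if "d0 \<in> D" "d0 \<notin> S" "d0 \<noteq> d" for d0 using d(2)[of d0] that *(1) by auto
    show "d0 \<notin> set \<alpha>" if "d0 \<in> S" for d0 using s(5)[of d d0] that d(1) *(2) by auto
  qed (use d in auto)
  then show ?thesis using st d(1) by blast
qed

text \<open>Boxes that precede their partner are included so that the descent closes. The earlier
  end \<open>m'\<close> of the edge enclosing a leftmost such box is one of three: a box, hence a
  smaller counterexample; a switched diamond before \<open>d\<close>, against the choice of
  \<open>d\<close>; or a triangle, whose arc starts at an even earlier free box.\<close>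

lemma no_early_free_box:
  assumes st: "state S L" and d: "d \<in> S" "\<And>d'. d' \<in> S \<Longrightarrow> d' \<noteq> d \<Longrightarrow> before L d d'"
    and p: "before L p d" "snd p = 0"
    "partner (active S) p = p \<or> before L p (partner (active S) p)"
  shows False
proof -
  note s = stateD[OF st]
  let ?E = "active S"
  define X where "X = {p. before L p d \<and> snd p = 0 \<and> (partner ?E p = p \<or> before L p (partner ?E p))}"
  have m: "matching ?E" using s(2) unfolding tree_list_def by simp
  have "X \<noteq> {}" using p unfolding X_def by blast
  moreover have "X \<subseteq> set L"
  proof
    show "p \<in> set L" if "p \<in> X" for p using that before_in_set[of L p d] unfolding X_def by simp
  qed
  ultimately obtain x where x: "x \<in> X" "\<And>y. y \<in> X \<Longrightarrow> y \<noteq> x \<Longrightarrow> before L x y"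
    using before_first[OF _ _ s(6)] by metis
  have first: "y \<notin> X" if "before L y x" for y
    using x(2)[of y] that before_asym[OF s(6) that] before_irrefl[OF s(6)] by metis
  have xd: "before L x d" "snd x = 0" "partner ?E x = x \<or> before L x (partner ?E x)"
    using x(1) unfolding X_def by auto
  have "x \<in> set L" using before_in_set[OF xd(1)] by simp
  have "partner ?E r = r" by (rule partner_free) (rule free_root)
  from enclosing_edge[OF s(2) root(2) this \<open>x \<in> set L\<close> xd(2,3)]
  obtain m' q where q: "partner ?E q = m'" "before L m' q" "before L m' x" "snd q \<noteq> 0" by metis
  have "m' \<noteq> q" using q(2) before_irrefl[OF s(6)] by metis
  have md: "before L m' d" using before_trans[OF s(6) q(3) xd(1)] .
  have mq: "partner ?E m' = q" using partner_partner[OF m, of q] q(1) by simp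
  have "snd m' \<noteq> 0"
    using first[OF q(3)] md mq q(2) unfolding X_def by auto
  have "(q, m') \<in> ?E \<or> (m', q) \<in> ?E"
    using \<open>m' \<noteq> q\<close> q(1) by (metis partner_cases[OF m, of q])
  then show False
  proof
    assume "(m', q) \<in> ?E"
    then show False
    proof (rule activeE)
      assume "m' \<in> S"
      then have "m' = d \<or> before L d m'" using d(2)[of m'] by auto
      then show False using md before_asym[OF s(6) md] before_irrefl[OF s(6), of d] by auto
    qed (use fixed_edge[of m' q] diamond[of m'] q(4) in auto)
  next
    assume "(q, m') \<in> ?E"
    then show False
    proof (rule activeE)
      \<comment> \<open>The arc of \<open>q\<close> comes from its free box \<open>bx q\<close>,
        which is thus a member of \<open>X\<close> before the leftmost one.\<close>
      assume q': "q \<in> D" "q \<in> S" "m' = tr q"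
      have "(bx q, m') \<in> arcs S" using q' unfolding arcs_def by blast
      then have "before L (bx q) m'" using s(3) unfolding noncrossing_def by blast
      then have b: "before L (bx q) x" "before L (bx q) d"
        using before_trans[OF s(6) _ q(3)] before_trans[OF s(6) _ md] by auto
      have "partner ?E (bx q) = bx q" by (rule partner_free) (rule free_bx[OF q'(1,2)])
      then have "bx q \<in> X" unfolding X_def using b(2) diamond[OF q'(1)] by simp
      with first[OF b(1)] show False by simp
    qed (use fixed_edge[of q m'] diamond[of q] \<open>snd m' \<noteq> 0\<close> in auto)
  qed
qed

text \<open>The exchange needs the order \<open>d\<close>, \<open>bx d\<close>, \<open>tr d\<close>.
  The second half is the arc of \<open>d\<close>; the first half is \<open>no_early_free_box\<close>
  for the first switched diamond.\<close>

lemma switch_backward: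
  assumes st: "state S L" and "S \<noteq> {}"
  shows "\<exists>d\<in>S. \<exists>L'. state (S - {d}) L'"
proof -
  note s = stateD[OF st]
  have "S \<subseteq> set L" using s(1) diamonds_in_list[OF st] by auto
  from before_first[OF assms(2) this s(6)] obtain d where d: "d \<in> S"
    "\<And>d'. d' \<in> S \<Longrightarrow> d' \<noteq> d \<Longrightarrow> before L d d'" by blast
  have dD: "d \<in> D" using d(1) s(1) by auto
  have "(bx d, tr d) \<in> arcs S" unfolding arcs_def using d dD by blast
  then have bt: "before L (bx d) (tr d)" using s(3) unfolding noncrossing_def by blast
  have free: "partner (active S) (bx d) = bx d"
    by (rule partner_free) (rule free_bx[OF dD d(1)])
  have "\<not> before L (bx d) d" using no_early_free_box[OF st d _ _ disjI1[OF free]] diamond[OF dD] by auto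
  moreover have "bx d \<noteq> d" using diamond[OF dD] by auto
  moreover have "bx d \<in> set L" using before_in_set[OF bt] by simp
  moreover have "d \<in> set L" using d(1) \<open>S \<subseteq> set L\<close> by auto
  ultimately have "before L d (bx d)" using before_total by metis
  with bt obtain \<alpha> \<xi> \<beta> \<gamma> where L: "L = \<alpha> @ d # \<beta> @ bx d # \<xi> @ tr d # \<gamma>"
    using before_split3[OF s(6)] by metis
  have *: "before L x d \<longleftrightarrow> x \<in> set \<alpha>" "before L d x \<Longrightarrow> x \<notin> set \<alpha>" for x
    using s(6) unfolding L by (auto dest: before_in_set)
  have S: "insert d (S - {d}) = S" using d(1) by auto
  have "state (S - {d}) (\<alpha> @ d # \<xi> @ tr d # \<beta> @ bx d # \<gamma>) \<longleftrightarrow> state (insert d (S - {d})) L"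
  proof (rule switch_state[OF dD _ _ refl L])
    show "d0 \<in> set \<alpha>" if "d0 \<in> D" "d0 \<notin> S - {d}" "d0 \<noteq> d" for d0
      using s(5)[of d0 d] that d(1) *(1) by auto
    show "d0 \<notin> set \<alpha>" if "d0 \<in> S - {d}" for d0 using d(2)[of d0] that *(2) by auto
  qed (use s(1) in auto)
  then show ?thesis using st d(1) unfolding S by blast
qed

lemma finite_diamonds: "finite D"
  using finite_pearls diamond by (metis finite_subset subsetI)

lemma switch_all_forward: "state S L \<Longrightarrow> \<exists>L'. state D L'"
proof (induction "card (D - S)" arbitrary: S L rule: less_induct)
  case less
  show ?case
  proof (cases "S = D")
    case False
    from switch_forward[OF less.prems this] obtain d L' where d: "d \<in> D - S" "state (insert d S) L'" by blast
    have "D - insert d S \<subset> D - S" using d(1) by auto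
    then have "card (D - insert d S) < card (D - S)" using finite_diamonds by (intro psubset_card_mono) auto
    from less.hyps[OF this d(2)] show ?thesis .
  qed (use less.prems in auto)
qed

lemma switch_all_backward: "state S L \<Longrightarrow> \<exists>L'. state {} L'"
proof (induction "card S" arbitrary: S L rule: less_induct)
  case less
  show ?case
  proof (cases "S = {}")
    case False
    from switch_backward[OF less.prems this] obtain d L' where d: "d \<in> S" "state (S - {d}) L'" by blast
    have "S - {d} \<subset> S" using d(1) by auto
    moreover have "finite S" using stateD(1)[OF less.prems] finite_diamonds finite_subset by blast
    ultimately have "card (S - {d}) < card S" by (intro psubset_card_mono)
    from less.hyps[OF this d(2)] show ?thesis .
  qed (use less.prems in auto)
qed

end

subsection \<open>Pearls, edges and planted subtrees of a configuration\<close>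

lemma mem_pearls: "(v, i) \<in> pearls T \<longleftrightarrow> (\<exists>w. neck T v = Some w \<and> i \<le> length w)"
proof
  assume "(v, i) \<in> pearls T"
  then show "\<exists>w. neck T v = Some w \<and> i \<le> length w"
    unfolding pearls_def box_pearls_def letter_pearls_def verts_of_def by auto
next
  assume "\<exists>w. neck T v = Some w \<and> i \<le> length w"
  then show "(v, i) \<in> pearls T"
    unfolding pearls_def box_pearls_def letter_pearls_def verts_of_def by (cases i) auto
qed

lemma mem_box_pearls: "p \<in> box_pearls T \<longleftrightarrow> p \<in> pearls T \<and> snd p = 0"
  by (cases p) (auto simp: mem_pearls box_pearls_def verts_of_def)

lemma mem_letter_pearls:
  "(v, i) \<in> letter_pearls T a \<longleftrightarrow> (\<exists>w. neck T v = Some w \<and> 0 < i \<and> i \<le> length w \<and> w ! (i - 1) = a)"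
  unfolding letter_pearls_def by (cases i) auto

lemma letter_pearls_sub: "p \<in> letter_pearls T a \<Longrightarrow> p \<in> pearls T \<and> snd p \<noteq> 0"
  by (cases p) (auto simp: mem_pearls mem_letter_pearls)

lemma letter_pearls_disjoint: "p \<in> letter_pearls T a \<Longrightarrow> p \<in> letter_pearls T b \<Longrightarrow> a = b"
  by (cases p) (auto simp: mem_letter_pearls)

lemma pearl_cases:
  assumes "p \<in> pearls T"
  obtains "p \<in> box_pearls T" | "p \<in> letter_pearls T Dot" | "p \<in> letter_pearls T Diamond"
    | "p \<in> letter_pearls T Triangle"
proof -
  from assms consider "p \<in> box_pearls T" | a where "p \<in> letter_pearls T a"
    unfolding pearls_def by blast
  then show thesis
  proof cases
    case (2 a)
    then show thesis using that by (cases a) auto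
  qed (rule that(1))
qed

lemma finite_pearls_config: "finite (verts_of T) \<Longrightarrow> finite (pearls T)"
proof -
  assume fin: "finite (verts_of T)"
  have "pearls T \<subseteq> (\<Union>v\<in>verts_of T. Pair v ` {.. length (the (neck T v))})"
  proof
    fix p assume "p \<in> pearls T"
    then show "p \<in> (\<Union>v\<in>verts_of T. Pair v ` {.. length (the (neck T v))})"
      by (cases p) (force simp: mem_pearls verts_of_def)
  qed
  with fin show ?thesis by (meson finite_UN finite_atMost finite_imageI finite_subset)
qed

lemma necklace_rotation_config:
  assumes "finite (verts_of T)"
  shows "necklace_rotation (pearls T) (cw_rot T)"
proof
  show "finite (pearls T)" using finite_pearls_config[OF assms] .
  show "fst (cw_rot T x) = fst x" for x by (cases x) (simp add: cw_rot_def)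
  show "cw_rot T x \<in> pearls T" if "x \<in> pearls T" for x
    using that by (cases x) (auto simp: cw_rot_def mem_pearls less_Suc_eq_le[symmetric])
  show "inj_on (cw_rot T) (pearls T)"
  proof (rule inj_onI)
    fix x y assume "x \<in> pearls T" "y \<in> pearls T" "cw_rot T x = cw_rot T y"
    then show "x = y"
      by (cases x; cases y) (auto simp: cw_rot_def mem_pearls mod_Suc split: if_splits)
  qed
  fix x y assume xy: "x \<in> pearls T" "y \<in> pearls T" "fst x = fst y"
  obtain v i j where v: "x = (v, i)" "y = (v, j)" using xy(3) by (cases x; cases y) auto
  with xy obtain w where w: "neck T v = Some w" "i \<le> length w" "j \<le> length w"
    by (auto simp: mem_pearls)
  let ?R = "{(x, cw_rot T x) | x. x \<in> pearls T}"
  have step: "((v, k), cw_rot T (v, k)) \<in> ?R" if "k \<le> length w" for k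
    using that w by (auto simp: mem_pearls)
  have up: "((v, k), (v, k + m)) \<in> ?R\<^sup>*" if "k + m \<le> length w" for k m
    using that
  proof (induction m)
    case (Suc m)
    have "cw_rot T (v, k + m) = (v, k + Suc m)"
      using Suc.prems w by (simp add: cw_rot_def)
    with step[of "k + m"] Suc.prems have "((v, k + m), (v, k + Suc m)) \<in> ?R" by simp
    moreover have "((v, k), (v, k + m)) \<in> ?R\<^sup>*" using Suc by simp
    ultimately show ?case by (rule rtrancl_into_rtrancl[rotated])
  qed simp
  have "cw_rot T (v, length w) = (v, 0)" using w by (simp add: cw_rot_def)
  with step[of "length w"] have last: "((v, length w), (v, 0)) \<in> ?R" by simp
  moreover have "((v, i), (v, length w)) \<in> ?R\<^sup>*" using up[of i "length w - i"] w by simp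
  moreover have "((v, 0), (v, j)) \<in> ?R\<^sup>*" using up[of 0 j] w by simp
  ultimately show "(x, y) \<in> ?R\<^sup>*" unfolding v
    using rtrancl_trans[OF rtrancl_into_rtrancl[OF _ last], of "(v, i)" "(v, j)"] by blast
qed

lemma ccw_cw_rot: "x \<in> pearls T \<Longrightarrow> ccw_rot T (cw_rot T x) = x"
  by (cases x) (auto simp: cw_rot_def ccw_rot_def mem_pearls mod_Suc)

lemma ccw_rot_inj: "inj_on (ccw_rot T) (pearls T)"
proof (rule inj_onI)
  fix x y assume "x \<in> pearls T" "y \<in> pearls T" "ccw_rot T x = ccw_rot T y"
  then show "x = y"
    by (cases x; cases y) (auto simp: ccw_rot_def mem_pearls split: if_splits)
qed

lemma ccw_rot_in: "x \<in> pearls T \<Longrightarrow> ccw_rot T x \<in> pearls T"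
  by (cases x) (auto simp: ccw_rot_def mem_pearls)

lemma free_pearl_iff: "free_pearl T p \<longleftrightarrow> (\<forall>q. (p, q) \<notin> all_edges T \<and> (q, p) \<notin> all_edges T)"
proof
  assume "free_pearl T p"
  then have "e \<notin> incident_edges T p" for e unfolding free_pearl_def by simp
  from this[of "(p, _)"] this[of "(_, p)"]
  show "\<forall>q. (p, q) \<notin> all_edges T \<and> (q, p) \<notin> all_edges T" unfolding incident_edges_def by simp
next
  assume *: "\<forall>q. (p, q) \<notin> all_edges T \<and> (q, p) \<notin> all_edges T"
  have "e \<notin> incident_edges T p" for e
    using *[rule_format, of "fst e"] *[rule_format, of "snd e"] unfolding incident_edges_def
    by (cases e) auto
  then show "free_pearl T p" unfolding free_pearl_def by blast
qed

lemma mate_partner: "mate T = partner (all_edges T)"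
  unfolding mate_def partner_def free_pearl_iff by (rule ext) simp

lemma cw_next_eq: "cw_next T = (\<lambda>p. cw_rot T (partner (all_edges T) p))"
  unfolding cw_next_def mate_partner ..

lemma ccw_next_eq: "ccw_next T = (\<lambda>p. ccw_rot T (partner (all_edges T) p))"
  unfolding ccw_next_def mate_partner ..

lemma config_edge:
  assumes "necklace_config Q T" "(x, y) \<in> all_edges T"
  shows "x \<in> letter_pearls T Dot \<union> letter_pearls T Diamond"
    "y \<in> box_pearls T \<union> letter_pearls T Triangle"
  using assms unfolding necklace_config_def all_edges_def by auto

lemma config_edges_sub:
  assumes "necklace_config Q T"
  shows "all_edges T \<subseteq> pearls T \<times> pearls T"
proof
  fix e assume "e \<in> all_edges T"
  moreover obtain x y where "e = (x, y)" by (cases e)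
  ultimately show "e \<in> pearls T \<times> pearls T"
    using config_edge[OF assms, of x y] letter_pearls_sub[of x T] letter_pearls_sub[of y T]
    by (auto simp: mem_box_pearls)
qed

text \<open>Edges are listed from dots and diamonds to boxes and triangles, so no pearl is both a
  source and a target.\<close>

lemma config_edge_ends:
  assumes "necklace_config Q T" "(x, y) \<in> all_edges T"
  shows "(y, z) \<notin> all_edges T"
proof
  assume "(y, z) \<in> all_edges T"
  from config_edge(1)[OF assms(1) this] config_edge(2)[OF assms] show False
    using letter_pearls_disjoint[of y T] letter_pearls_sub[of y T] by (auto simp: mem_box_pearls)
qed

lemma finite_incident:
  assumes "necklace_config Q T"
  shows "finite (incident_edges T p)"
proof -
  have "finite (pearls T \<times> pearls T)"
    using finite_pearls_config[of T] assms unfolding necklace_config_def by simp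
  moreover have "incident_edges T p \<subseteq> pearls T \<times> pearls T"
    using config_edges_sub[OF assms] unfolding incident_edges_def by blast
  ultimately show ?thesis using finite_subset by blast
qed

lemma matching_all_edges:
  assumes Q: "necklace_config Q T"
  shows "matching (all_edges T) \<longleftrightarrow> (\<forall>p. card (incident_edges T p) \<le> 1)"
proof
  assume m: "matching (all_edges T)"
  show "\<forall>p. card (incident_edges T p) \<le> 1"
  proof
    fix p
    have "e = e'" if "e \<in> incident_edges T p" "e' \<in> incident_edges T p" for e e'
    proof -
      obtain x y x' y' where e: "e = (x, y)" "e' = (x', y')" by (cases e; cases e')
      then have *: "(x, y) \<in> all_edges T" "(x', y') \<in> all_edges T" "x = p \<or> y = p" "x' = p \<or> y' = p"
        using that unfolding incident_edges_def by auto
      have "x = p \<longleftrightarrow> x' = p"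
        using * config_edge_ends[OF Q *(1)] config_edge_ends[OF Q *(2)] by blast
      with * show ?thesis
        using matching_unique[OF m, of p y y'] matching_unique[OF m, of p x x'] unfolding e by blast
    qed
    then show "card (incident_edges T p) \<le> 1"
      using finite_incident[OF Q, of p] by (metis One_nat_def card_le_Suc0_iff_eq)
  qed
next
  assume c: "\<forall>p. card (incident_edges T p) \<le> 1"
  show "matching (all_edges T)"
    unfolding matching_def
  proof (intro conjI allI impI notI)
    fix p q q' assume "(p, q) \<in> all_edges T \<or> (q, p) \<in> all_edges T"
      "(p, q') \<in> all_edges T \<or> (q', p) \<in> all_edges T"
    then obtain e e' where e: "e = (p, q) \<or> e = (q, p)" "e' = (p, q') \<or> e' = (q', p)"
      "e \<in> all_edges T" "e' \<in> all_edges T" by blast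
    then have "e \<in> incident_edges T p" "e' \<in> incident_edges T p"
      unfolding incident_edges_def by auto
    then have "e = e'" using c finite_incident[OF Q, of p] by (metis One_nat_def card_le_Suc0_iff_eq)
    with e(1,2) show "q = q'" by auto
  next
    fix p assume "(p, p) \<in> all_edges T"
    with config_edge_ends[OF Q this] show False by blast
  qed
qed

lemma incident_outside:
  "necklace_config Q T \<Longrightarrow> p \<notin> pearls T \<Longrightarrow> incident_edges T p = {}"
  using config_edges_sub[of Q T] unfolding incident_edges_def by auto

lemma is_tree_forest:
  "is_tree T \<longleftrightarrow> forest (all_edges T) \<and>
     (\<forall>x\<in>pearls T. \<forall>y\<in>pearls T. (fst x, fst y) \<in> (necklace_adj (all_edges T))\<^sup>*)"
proof -
  have "verts_of T = fst ` pearls T"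
  proof (intro equalityI subsetI)
    fix v assume "v \<in> verts_of T"
    then have "(v, 0) \<in> pearls T" unfolding verts_of_def by (auto simp: mem_pearls)
    then show "v \<in> fst ` pearls T" by force
  next
    fix v assume "v \<in> fst ` pearls T"
    then show "v \<in> verts_of T" unfolding verts_of_def by (auto simp: mem_pearls)
  qed
  then show ?thesis unfolding is_tree_def forest_def by auto
qed

text \<open>An undirected path is followed below \<open>c\<close>. A step upwards leaves a box
  \<open>q\<close> other than \<open>c\<close>; the descent from \<open>c\<close> to
  \<open>q\<close> must already have passed the unique parent of \<open>q\<close> and the box above
  that parent.\<close>

lemma child_rel_reach:
  assumes Q: "necklace_config Q T" "matching (all_edges T)" "blue_edges T = {}"
    and c: "c \<in> box_pearls T" and E: "E \<subseteq> all_edges T" "\<And>p. (p, c) \<notin> E"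
    and "(fst c, v) \<in> (necklace_adj E)\<^sup>*"
  shows "(c, (v, 0)) \<in> (child_rel T)\<^sup>*"
  using assms(7)
proof induction
  case base
  have "c = (fst c, 0)" using c by (simp add: mem_box_pearls prod_eq_iff)
  then show ?case by (metis rtrancl.rtrancl_refl)
next
  case (step v w)
  have edge: "(x, y) \<in> child_rel T" if "(x, y) \<in> E" for x y
    using that E(1) unfolding child_rel_def by blast
  have ends: "x \<in> pearls T \<and> snd x \<noteq> 0 \<and> y = (fst y, 0)" if "(x, y) \<in> all_edges T" for x y
    using that Q(1,3) letter_pearls_sub[of x T]
    unfolding all_edges_def necklace_config_def box_pearls_def by fastforce
  have down: "((fst x, 0), x) \<in> child_rel T" if "x \<in> pearls T" "snd x \<noteq> 0" for x
    using that unfolding child_rel_def by (cases x) (auto simp: gr0_conv_Suc)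
  from step(2) obtain p q where pq: "(p, q) \<in> E" "v = fst p \<and> w = fst q \<or> v = fst q \<and> w = fst p"
    unfolding necklace_adj_def by blast
  then have pE: "(p, q) \<in> all_edges T" using E(1) by blast
  from pq(2) show ?case
  proof
    assume "v = fst p \<and> w = fst q"
    then have "((v, 0), p) \<in> child_rel T" "(p, (w, 0)) \<in> child_rel T"
      using ends[OF pE] down[of p] edge[OF pq(1)] by auto
    with step.IH show ?thesis by (meson rtrancl_into_rtrancl)
  next
    assume vw: "v = fst q \<and> w = fst p"
    then have q: "(v, 0) = q" using ends[OF pE] by simp
    have "(c, q) \<in> (child_rel T)\<^sup>*" using step.IH q by simp
    moreover have "c \<noteq> q" using E(2) pq(1) by blast
    ultimately obtain y where y: "(c, y) \<in> (child_rel T)\<^sup>*" "(y, q) \<in> child_rel T"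
      by (metis rtranclE)
    have "(y, q) \<in> all_edges T"
      using y(2) q unfolding child_rel_def by auto
    then have "y = p" using matching_unique[OF Q(2), of q y p] pE by blast
    with y(1) have cp: "(c, p) \<in> (child_rel T)\<^sup>*" by simp
    have "c \<noteq> p" using ends[OF pE] c by (auto simp: mem_box_pearls)
    then obtain z where z: "(c, z) \<in> (child_rel T)\<^sup>*" "(z, p) \<in> child_rel T"
      using cp by (metis rtranclE)
    have "(z, p) \<notin> all_edges T" using ends[of z p] ends[OF pE] by (metis snd_conv)
    then have "z = (w, 0)" using z(2) vw unfolding child_rel_def by auto
    with z(1) show ?thesis by simp
  qed
qed

lemma child_rel_pearl:
  assumes "(c, (v, 0)) \<in> (child_rel T)\<^sup>*" "x \<in> pearls T" "fst x = v"
  shows "(c, x) \<in> (child_rel T)\<^sup>*"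
proof (cases "snd x = 0")
  case True
  then have "x = (v, 0)" using assms(3) by (simp add: prod_eq_iff)
  with assms(1) show ?thesis by simp
next
  case False
  then have "((v, 0), x) \<in> child_rel T"
    using assms(2,3) unfolding child_rel_def by (cases x) (auto simp: gr0_conv_Suc)
  with assms(1) show ?thesis by (rule rtrancl_into_rtrancl)
qed

lemma planted_subtree_root:
  assumes Q: "Q_tree Q T"
  shows "planted_subtree T (root_pearl T) = pearls T"
proof -
  have nc: "necklace_config Q T" "blue_edges T = {}" "is_tree T" "root_pearl T \<in> box_pearls T"
    and inc: "\<And>p. p \<in> pearls T \<Longrightarrow> card (incident_edges T p) =
        (if p = root_pearl T \<or> p \<in> letter_pearls T Triangle then 0 else 1)"
    using Q unfolding Q_tree_def by auto
  have m: "matching (all_edges T)"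
    unfolding matching_all_edges[OF nc(1)]
  proof
    show "card (incident_edges T p) \<le> 1" for p
      using inc[of p] incident_outside[OF nc(1), of p] by (cases "p \<in> pearls T") auto
  qed
  have rP: "root_pearl T \<in> pearls T" using nc(4) by (simp add: mem_box_pearls)
  have "incident_edges T (root_pearl T) = {}" using inc[OF rP] finite_incident[OF nc(1)] by simp
  then have no: "(p, root_pearl T) \<notin> all_edges T" for p
    using free_pearl_iff[of T "root_pearl T"] unfolding free_pearl_def by blast
  show ?thesis
  proof (intro equalityI subsetI)
    fix x assume x: "x \<in> pearls T"
    have "(fst (root_pearl T), fst x) \<in> (necklace_adj (all_edges T))\<^sup>*"
      using nc(3) rP x unfolding is_tree_forest by blast
    from child_rel_pearl[OF child_rel_reach[OF nc(1) m nc(2,4) _ no this] x]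
    show "x \<in> planted_subtree T (root_pearl T)" unfolding planted_subtree_def by simp
  next
    fix x assume "x \<in> planted_subtree T (root_pearl T)"
    then have "(root_pearl T, x) \<in> (child_rel T)\<^sup>*" unfolding planted_subtree_def by simp
    then show "x \<in> pearls T"
    proof induction
      case (step y z)
      then show ?case using config_edges_sub[OF nc(1)] unfolding child_rel_def by auto
    qed (rule rP)
  qed
qed

section \<open>Matchings of a cyclic walk and arcs over the list cut at the root\<close>

declare split_paired_All [simp del] split_paired_Ex [simp del]

text \<open>Reversal turns every arc around and keeps the nesting. The map \<open>h\<close> will be
  the partner map, which replaces left corners by right ones.\<close>

lemma noncrossing_rev_map:
  assumes h: "inj_on h (set L)" and C: "C \<subseteq> set L \<times> set L" and U: "U \<subseteq> set L"
  shows "noncrossing (rev (map h L)) ((\<lambda>(x, y). (h y, h x)) ` C) (h ` U) \<longleftrightarrow> noncrossing L C U"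
proof -
  have b: "before (rev (map h L)) (h y) (h x) \<longleftrightarrow> before L x y" if "x \<in> set L" "y \<in> set L" for x y
    unfolding before_rev using before_map[OF h that] .
  have btw: "between (rev (map h L)) (h y) (h z) (h x) \<longleftrightarrow> between L x z y"
    if "x \<in> set L" "y \<in> set L" "z \<in> set L" for x y z
    unfolding between_def using b that by auto
  have mem: "x \<in> set L \<and> y \<in> set L" if "(x, y) \<in> C" for x y using C that by auto
  have *: "(before (rev (map h L)) (h y) (h x) \<and> (\<forall>z\<in>h ` U. \<not> between (rev (map h L)) (h y) z (h x)) \<and>
      (\<forall>(x', y')\<in>(\<lambda>(x, y). (h y, h x)) ` C. between (rev (map h L)) (h y) x' (h x) \<longleftrightarrow> between (rev (map h L)) (h y) y' (h x))) \<longleftrightarrow>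
     (before L x y \<and> (\<forall>z\<in>U. \<not> between L x z y) \<and>
      (\<forall>(x', y')\<in>C. between L x x' y \<longleftrightarrow> between L x y' y))" if xy: "(x, y) \<in> C" for x y
  proof -
    have "(\<forall>z\<in>h ` U. \<not> between (rev (map h L)) (h y) z (h x)) \<longleftrightarrow> (\<forall>z\<in>U. \<not> between L x z y)"
    proof -
      have "z \<in> set L" if "z \<in> U" for z using U that by auto
      then show ?thesis unfolding ball_simps(9) by (intro ball_cong) (simp_all add: btw mem[OF xy])
    qed
    moreover have "(\<forall>(x', y')\<in>(\<lambda>(x, y). (h y, h x)) ` C. between (rev (map h L)) (h y) x' (h x) \<longleftrightarrow> between (rev (map h L)) (h y) y' (h x))
       \<longleftrightarrow> (\<forall>(x', y')\<in>C. between L x x' y \<longleftrightarrow> between L x y' y)"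
    proof -
      have "(between (rev (map h L)) (h y) (h y') (h x) \<longleftrightarrow> between (rev (map h L)) (h y) (h x') (h x)) \<longleftrightarrow>
        (between L x x' y \<longleftrightarrow> between L x y' y)" if "(x', y') \<in> C" for x' y'
        using mem[OF that] mem[OF xy] btw by auto
      then show ?thesis unfolding ball_simps(9) by (intro ball_cong) auto
    qed
    ultimately show ?thesis using b mem[OF xy] by simp
  qed
  define ok1 where "ok1 u v \<longleftrightarrow> before (rev (map h L)) u v \<and>
      (\<forall>z\<in>h ` U. \<not> between (rev (map h L)) u z v) \<and>
      (\<forall>(x', y')\<in>(\<lambda>(x, y). (h y, h x)) ` C.
         between (rev (map h L)) u x' v \<longleftrightarrow> between (rev (map h L)) u y' v)" for u v
  define ok2 where "ok2 x y \<longleftrightarrow> before L x y \<and> (\<forall>z\<in>U. \<not> between L x z y) \<and>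
      (\<forall>(x', y')\<in>C. between L x x' y \<longleftrightarrow> between L x y' y)" for x y
  have "noncrossing (rev (map h L)) ((\<lambda>(x, y). (h y, h x)) ` C) (h ` U) \<longleftrightarrow>
      (\<forall>(u, v)\<in>(\<lambda>(x, y). (h y, h x)) ` C. ok1 u v)"
    unfolding noncrossing_def ok1_def ..
  also have "\<dots> \<longleftrightarrow> (\<forall>(x, y)\<in>C. ok1 (h y) (h x))" by auto
  also have "\<dots> \<longleftrightarrow> (\<forall>(x, y)\<in>C. ok2 x y)"
  proof (intro ball_cong refl)
    fix e assume "e \<in> C"
    moreover obtain x y where "e = (x, y)" by (cases e)
    ultimately show "(case e of (x, y) \<Rightarrow> ok1 (h y) (h x)) = (case e of (x, y) \<Rightarrow> ok2 x y)"
      using *[of x y, folded ok1_def ok2_def] by simp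
  qed
  also have "\<dots> \<longleftrightarrow> noncrossing L C U" unfolding noncrossing_def ok2_def ..
  finally show ?thesis .
qed

text \<open>Every closer in the interval is matched, and to an opener in the interval: an arc
  starting further left would pass over the unmatched \<open>a\<close>.\<close>

lemma noncrossing_count:
  assumes nc: "noncrossing L M (unmatched A B M)" and M: "one_one M" "M \<subseteq> A \<times> B"
    and L: "distinct L" and a: "a \<in> A - Domain M" and ab: "before L a b" and "finite A"
    and full: "\<And>z. between L a z b \<Longrightarrow> z \<notin> unmatched A B M"
  shows "card (B \<inter> {z. between L a z b}) \<le> card (A \<inter> {z. between L a z b})"
proof -
  have "\<exists>x. (x, y) \<in> M \<and> between L a x b" if y: "y \<in> B" "between L a y b" for y
  proof -
    from full[OF y(2)] y(1) obtain x where x: "(x, y) \<in> M" unfolding unmatched_def by auto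
    have xy: "before L x y" using nc x unfolding noncrossing_def by blast
    have "\<not> between L x a y" using nc x a unfolding noncrossing_def unmatched_def by blast
    moreover have "before L a y" "before L y b" using y(2) unfolding between_def by auto
    moreover have "x \<noteq> a" using x a by auto
    moreover have "x \<in> set L" "a \<in> set L" using before_in_set[OF xy] before_in_set[OF ab] by auto
    ultimately have "before L a x" using before_total[of x L a] unfolding between_def by blast
    moreover have "before L x b" using before_trans[OF L xy] y(2) unfolding between_def by blast
    ultimately show ?thesis using x unfolding between_def by blast
  qed
  then obtain g where g: "\<And>y. y \<in> B \<Longrightarrow> between L a y b \<Longrightarrow> (g y, y) \<in> M \<and> between L a (g y) b"
    by metis
  show ?thesis
  proof (rule card_inj_on_le)
    show "inj_on g (B \<inter> {z. between L a z b})"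
    proof (rule inj_onI)
      fix y y' assume "y \<in> B \<inter> {z. between L a z b}" "y' \<in> B \<inter> {z. between L a z b}" "g y = g y'"
      then show "y = y'" using g[of y] g[of y'] one_oneD[OF M(1), of "g y" y "g y'" y'] by simp
    qed
    show "g ` (B \<inter> {z. between L a z b}) \<subseteq> A \<inter> {z. between L a z b}"
      using g M(2) by blast
  qed (use \<open>finite A\<close> in simp)
qed

text \<open>A step of the cyclic matching might run past the root. An unmatched corner on the
  stretch \<open>seg a\<close> after each unmatched opener \<open>a\<close> stops it in time;
  \<open>open_seg\<close> asks for one only at those partial matchings that the induction meets. In
  a non-negative tree \<open>seg a\<close> is the interval up to the box of \<open>a\<close>, in a
  companion tree the rest of the list followed by the root.\<close>

lemma final_matching_noncrossing:
  assumes L: "walks f r L r" "distinct (r # L)" and A: "A \<subseteq> set L" "A \<inter> B = {}"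
    and M: "final_matching f A B M" "r \<notin> Range M"
    and seg: "\<And>a. a \<in> A \<Longrightarrow> \<exists>\<alpha> \<delta>. L @ [r] = \<alpha> @ a # seg a @ \<delta>"
    and open_seg: "\<And>N a. N \<subseteq> A \<times> B \<Longrightarrow> one_one N \<Longrightarrow> N \<subseteq> M \<Longrightarrow> noncrossing L N (unmatched A B N) \<Longrightarrow>
      a \<in> A - Domain N \<Longrightarrow> \<exists>z\<in>set (seg a). z \<in> unmatched A B N"
  shows "noncrossing L M (unmatched A B M)" "A \<subseteq> Domain M"
    "\<And>a b. (a, b) \<in> M \<Longrightarrow> b \<in> set (seg a)"
proof -
  let ?U = "unmatched A B"
  have reach: "(match_step f A B)\<^sup>*\<^sup>* {} M" using M(1) unfolding final_matching_def by simp
  \<comment> \<open>The stretch may end with the root, so it is a prefix of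
    \<open>\<gamma> @ [r]\<close> and not necessarily of \<gamma>.\<close>
  have tail: "\<exists>\<alpha> \<gamma> \<delta>. L = \<alpha> @ a # \<gamma> \<and> \<gamma> @ [r] = seg a @ \<delta>" if a: "a \<in> A" for a
  proof -
    obtain \<alpha> \<delta> where e: "L @ [r] = \<alpha> @ a # seg a @ \<delta>" using seg[OF a] by blast
    have "a \<noteq> r" using a A(1) L(2) by auto
    with e have "seg a @ \<delta> \<noteq> []" by auto
    then obtain \<gamma> x where g: "seg a @ \<delta> = \<gamma> @ [x]" by (metis rev_exhaust)
    with e have "L @ [r] = (\<alpha> @ a # \<gamma>) @ [x]" by simp
    then have "L = \<alpha> @ a # \<gamma>" "x = r" unfolding append1_eq_conv by auto
    with g show ?thesis by metis
  qed
  have inv: "N \<subseteq> M \<longrightarrow> noncrossing L N (?U N) \<and> (\<forall>(a, b)\<in>N. b \<in> set (seg a))"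
    if "(match_step f A B)\<^sup>*\<^sup>* {} N" for N
    using that
  proof (induction rule: rtranclp_induct)
    case base
    show ?case unfolding noncrossing_def by simp
  next
    case (step N N')
    note N = match_step_reachable_invariant[OF step(1)]
    show ?case
    proof
      assume N'M: "N' \<subseteq> M"
      from step(2) obtain a b us where s: "a \<in> A - Domain N" "b \<in> B - Range N" "walks f a us b"
        "set us \<inter> ?U N = {}" "N' = insert (a, b) N" by (rule match_stepE)
      have NM: "N \<subseteq> M" and br: "b \<noteq> r" using N'M s(5) M(2) by auto
      from tail s(1) obtain \<alpha> \<gamma> \<delta> where La: "L = \<alpha> @ a # \<gamma>" "\<gamma> @ [r] = seg a @ \<delta>" by blast
      obtain z where z: "z \<in> set (seg a)" "z \<in> ?U N"
        using open_seg[OF _ _ NM _ s(1)] N step.IH NM by blast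
      then have zus: "z \<notin> set us" using s(4) by blast
      have "walks f a \<gamma> r" using L(1) unfolding La by simp
      \<comment> \<open>A step running past the root would pass the unmatched corner
        \<open>z\<close> before reaching \<open>b\<close>.\<close>
      have "\<exists>ws. \<gamma> = us @ b # ws"
        using walks_prefix[OF s(3) \<open>walks f a \<gamma> r\<close>]
      proof (elim disjE exE)
        fix ws assume "\<gamma> @ [r] = us @ [b] @ ws"
        then show ?thesis using br by (cases ws rule: rev_exhaust) auto
      next
        fix ws assume e: "us @ [b] = \<gamma> @ [r] @ ws"
        show ?thesis
        proof (cases ws rule: rev_exhaust)
          case (snoc ws' x)
          with e have "us = \<gamma> @ r # ws'" by simp
          then have "set us = set (\<gamma> @ [r]) \<union> set ws'" by auto
          with z zus show ?thesis unfolding La(2) by simp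
        qed (use e br in simp)
      qed
      then obtain ws where \<gamma>: "\<gamma> = us @ b # ws" by blast
      with La have Lb: "L = \<alpha> @ a # us @ b # ws" by simp
      have b_seg: "b \<in> set (seg a)"
      proof (rule ccontr)
        assume nb: "b \<notin> set (seg a)"
        have "us @ b # ws @ [r] = seg a @ \<delta>" using La(2) unfolding \<gamma> by simp
        then consider vs where "us = seg a @ vs" | vs where "seg a = us @ vs" "b # ws @ [r] = vs @ \<delta>"
          unfolding append_eq_append_conv2 by metis
        then have "set (seg a) \<subseteq> set us"
        proof cases
          case (2 vs)
          then have "vs = []" using nb by (cases vs) auto
          with 2 show ?thesis by simp
        qed simp
        with z zus show False by blast
      qed
      have ab: "before L a b" unfolding Lb by simp
      have btw_ab: "between L a z b \<longleftrightarrow> z \<in> set us" for z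
        using between_split[of \<alpha> a us b ws z] L(2) Lb by simp
      have abU: "a \<in> ?U N" "b \<in> ?U N" using s(1,2) unfolding unmatched_def by auto
      have endsN: "x \<notin> ?U N \<and> y \<notin> ?U N" if "(x, y) \<in> N" for x y
        using that N A(2) unfolding unmatched_def by blast
      have "noncrossing L (insert (a, b) N) (?U N)"
      proof (rule noncrossing_insert)
        show "\<not> between L a z b" if "z \<in> ?U N" for z using that s(4) unfolding btw_ab by auto
      qed (use step.IH NM L(2) abU ab endsN in auto)
      moreover have "?U N' \<subseteq> ?U N" unfolding s(5) unmatched_def by auto
      ultimately have "noncrossing L N' (?U N')" unfolding s(5) using noncrossing_mono by blast
      then show "noncrossing L N' (?U N') \<and> (\<forall>(a, b)\<in>N'. b \<in> set (seg a))"
        using step.IH NM b_seg unfolding s(5) by auto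
    qed
  qed
  show nc: "noncrossing L M (?U M)" using inv[OF reach] by simp
  show "b \<in> set (seg a)" if "(a, b) \<in> M" for a b using inv[OF reach] that by blast
  \<comment> \<open>The last unmatched opener could still be matched, because the next unmatched
    corner after it must be a closer.\<close>
  show "A \<subseteq> Domain M"
  proof (rule ccontr)
    assume "\<not> A \<subseteq> Domain M"
    then have "A - Domain M \<noteq> {}" "A - Domain M \<subseteq> set L" using A(1) by auto
    from before_last[OF this] L(2) obtain a where a: "a \<in> A - Domain M"
      "\<And>x. x \<in> A - Domain M \<Longrightarrow> x \<noteq> a \<Longrightarrow> before L x a" by auto
    from tail a(1) obtain \<alpha> \<gamma> \<delta> where La: "L = \<alpha> @ a # \<gamma>" "\<gamma> @ [r] = seg a @ \<delta>" by blast
    have w: "walks f a \<gamma> r" using L(1) unfolding La by simp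
    have "\<exists>z\<in>set (seg a). z \<in> ?U M"
      using open_seg[OF _ _ order_refl nc a(1)] match_step_reachable_invariant[OF reach] by blast
    from split_list_first_prop[OF this] obtain us b vs where us: "seg a = us @ b # vs" "b \<in> ?U M"
      "\<forall>z\<in>set us. z \<notin> ?U M" by blast
    then have e: "\<gamma> @ [r] = us @ b # vs @ \<delta>" using La(2) by simp
    have "b \<notin> A - Domain M"
    proof
      assume b: "b \<in> A - Domain M"
      have "b \<in> set (\<gamma> @ [r])" unfolding e by simp
      moreover have "b \<noteq> r" using b A(1) L(2) by auto
      ultimately have "b \<in> set \<gamma>" by (metis Un_iff empty_iff empty_set insert_iff list.set(2) set_append)
      then have "before L a b" unfolding La by simp
      then show False
        using a(2)[OF b] before_asym[of L a b] before_irrefl[of L a] L(2) by auto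
    qed
    then have "b \<in> B - Range M" using us(2) unfolding unmatched_def by blast
    moreover have "walks f a us b"
    proof (cases "vs @ \<delta>" rule: rev_exhaust)
      case Nil
      then show ?thesis using e w by simp
    next
      case (snoc ws x)
      then have "\<gamma> @ [r] = (us @ b # ws) @ [x]" using e by simp
      then have "\<gamma> = us @ b # ws" unfolding append1_eq_conv by simp
      then show ?thesis using w by simp
    qed
    ultimately have "match_step f A B M (insert (a, b) M)"
      using a(1) us(3) by (intro match_stepI) auto
    then show False using M(1) unfolding final_matching_def by blast
  qed
qed

lemma one_one_graphE:
  assumes "one_one M" "A = Domain M"
  obtains g where "inj_on g A" "M = {(a, g a) | a. a \<in> A}"
proof -
  have "\<forall>a\<in>A. \<exists>b. (a, b) \<in> M" using assms(2) by blast
  then obtain g where g: "\<And>a. a \<in> A \<Longrightarrow> (a, g a) \<in> M" by metis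
  have "b = g a" "a \<in> A" if "(a, b) \<in> M" for a b
    using one_oneD[OF assms(1) that g[of a]] that assms(2) by auto
  then have "M = {(a, g a) | a. a \<in> A}" using g by auto
  moreover have "inj_on g A" by (rule inj_onI) (use g one_oneD[OF assms(1)] in metis)
  ultimately show thesis using that by blast
qed

context necklace_rotation
begin

text \<open>A right corner is the left corner of the partner, so the reversed image of the clockwise
  list follows the counterclockwise walk. The root is free and remains the cut.\<close>

lemma reverse_walk_list:
  assumes T: "tree_list E r L" and r: "partner E r = r" and inv: "\<And>x. x \<in> P \<Longrightarrow> \<rho>' (\<rho> x) = x"
  shows "walks (\<lambda>z. \<rho>' (partner E z)) r (rev (map (partner E) L)) r"
    "distinct (r # rev (map (partner E) L))" "set (r # rev (map (partner E) L)) = P"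
    "inj_on (partner E) (set L)"
proof -
  have E: "matching E" "E \<subseteq> P \<times> P" and L: "walks (walk E) r L r" "distinct (r # L)" "set (r # L) = P"
    using T unfolding tree_list_def by auto
  have "r \<in> P" "set L \<subseteq> P" using L(3) by auto
  then show "walks (\<lambda>z. \<rho>' (partner E z)) r (rev (map (partner E) L)) r"
    using walks_reverse[OF E inv L(1)] r by simp
  have inj: "inj (partner E)" using partner_partner[OF E(1)] by (metis injI)
  then show "inj_on (partner E) (set L)" by (rule inj_on_subset) simp
  have "distinct (map (partner E) (r # L))"
    unfolding distinct_map using L(2) inj by (meson inj_on_subset subset_UNIV)
  moreover have "set (map (partner E) (r # L)) = partner E ` P"
    unfolding set_map L(3) ..
  moreover have "partner E ` P = P"
  proof (intro equalityI subsetI)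
    show "x \<in> partner E ` P" if "x \<in> P" for x
      using partner_partner[OF E(1), of x] partner_in[OF E that] by (metis imageI)
    show "x \<in> P" if "x \<in> partner E ` P" for x using that partner_in[OF E] by blast
  qed
  ultimately show "distinct (r # rev (map (partner E) L))" "set (r # rev (map (partner E) L)) = P"
    using r by auto
qed

end

text \<open>\<open>strictly_between\<close> speaks of the first arrival on the cyclic walk; without
  repetitions this is the occurrence in the list.\<close>

lemma strictly_between_walk:
  assumes "walks f r G r" "distinct (r # G)" "before G a b"
  shows "strictly_between f a x b \<longleftrightarrow> between G a x b"
proof -
  obtain us where us: "walks f a us b" "\<And>z. z \<in> set us \<longleftrightarrow> between G a z b"
    using walks_before[OF assms] by blast
  have "b \<notin> set us" using us(2) before_irrefl[of G b] assms(2) unfolding between_def by auto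
  let ?n = "Suc (length us)"
  have w: "(f ^^ ?n) a = b" "\<And>i. i < length us \<Longrightarrow> us ! i = (f ^^ Suc i) a"
    using us(1) unfolding walks_iff_funpow by auto
  have in_us: "(f ^^ j) a \<in> set us" if "0 < j" "j < ?n" for j
  proof -
    have "j = Suc (j - 1)" "j - 1 < length us" using that by auto
    then show ?thesis using w(2)[of "j - 1"] nth_mem[of "j - 1" us] by metis
  qed
  show ?thesis
  proof
    assume "strictly_between f a x b"
    then obtain i n where i: "0 < i" "i < n" "(f ^^ i) a = x" "(f ^^ n) a = b"
      "\<forall>j. 0 < j \<and> j < n \<longrightarrow> (f ^^ j) a \<noteq> b" unfolding strictly_between_def by blast
    have "\<not> ?n < n" using i(5) w(1) by blast
    then have "i < ?n" using i(2) by simp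
    from in_us[OF i(1) this] us(2) i(3) show "between G a x b" by simp
  next
    assume "between G a x b"
    then obtain i where "i < length us" "us ! i = x" using us(2) by (metis in_set_conv_nth)
    then have "0 < Suc i" "Suc i < ?n" "(f ^^ Suc i) a = x" using w(2) by auto
    moreover have "\<forall>j. 0 < j \<and> j < ?n \<longrightarrow> (f ^^ j) a \<noteq> b" using in_us \<open>b \<notin> set us\<close> by metis
    ultimately show "strictly_between f a x b" unfolding strictly_between_def using w(1) by blast
  qed
qed

section \<open>The common core of trees and companion trees rooted at a free box\<close>

locale rooted_config =
  fixes Q :: "letter list set" and T :: "'v config"
  assumes config: "necklace_config Q T" and match: "matching (all_edges T)" and tree: "is_tree T"
    and root_box: "root_pearl T \<in> box_pearls T" and root_free: "free_pearl T (root_pearl T)"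

sublocale rooted_config \<subseteq> necklace_rotation "pearls T" "cw_rot T"
  by (rule necklace_rotation_config) (use config in \<open>simp add: necklace_config_def\<close>)

lemma (in rooted_config) card_incident:
  "card (incident_edges T p) = (if free_pearl T p then 0 else 1)"
proof -
  have "card (incident_edges T p) \<le> 1" using match unfolding matching_all_edges[OF config] by blast
  then show ?thesis unfolding free_pearl_def using finite_incident[OF config, of p]
    by (auto simp: le_Suc_eq)
qed

lemma rooted_configI:
  assumes "necklace_config Q T" "\<And>p. p \<in> pearls T \<Longrightarrow> card (incident_edges T p) \<le> 1" "is_tree T"
    "root_pearl T \<in> box_pearls T" "free_pearl T (root_pearl T)"
  shows "rooted_config Q T"
proof
  show "matching (all_edges T)" unfolding matching_all_edges[OF assms(1)]
  proof
    show "card (incident_edges T p) \<le> 1" for p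
      using assms(2)[of p] incident_outside[OF assms(1), of p] by (cases "p \<in> pearls T") auto
  qed
qed (use assms in auto)

text \<open>Degrees are at most one, so incidence counts reduce to which pearls are free. The same
  reduction in \<open>companion_tree_iff\<close> leaves only this and the colours to distinguish the
  two kinds of trees.\<close>

lemma Q_tree_iff:
  "Q_tree Q T \<longleftrightarrow> rooted_config Q T \<and> blue_edges T = {} \<and>
     (\<forall>p\<in>pearls T. free_pearl T p \<longleftrightarrow> p = root_pearl T \<or> p \<in> letter_pearls T Triangle)"
proof
  assume Q: "Q_tree Q T"
  then have c: "necklace_config Q T" and inc: "\<And>p. p \<in> pearls T \<Longrightarrow> card (incident_edges T p) =
        (if p = root_pearl T \<or> p \<in> letter_pearls T Triangle then 0 else 1)"
    unfolding Q_tree_def by auto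
  have free: "free_pearl T p \<longleftrightarrow> p = root_pearl T \<or> p \<in> letter_pearls T Triangle" if "p \<in> pearls T" for p
    using inc[OF that] finite_incident[OF c, of p] unfolding free_pearl_def by (auto split: if_splits)
  have "rooted_config Q T"
  proof (rule rooted_configI[OF c])
    show "free_pearl T (root_pearl T)" using free[of "root_pearl T"] Q
      unfolding Q_tree_def by (simp add: mem_box_pearls)
  qed (use Q inc in \<open>auto simp: Q_tree_def\<close>)
  with free Q show "rooted_config Q T \<and> blue_edges T = {} \<and>
     (\<forall>p\<in>pearls T. free_pearl T p \<longleftrightarrow> p = root_pearl T \<or> p \<in> letter_pearls T Triangle)"
    unfolding Q_tree_def by blast
next
  assume *: "rooted_config Q T \<and> blue_edges T = {} \<and>
     (\<forall>p\<in>pearls T. free_pearl T p \<longleftrightarrow> p = root_pearl T \<or> p \<in> letter_pearls T Triangle)"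
  then interpret rooted_config Q T by simp
  show "Q_tree Q T" unfolding Q_tree_def card_incident
    using * config tree root_box by simp
qed

lemma companion_tree_iff:
  "companion_tree Q T \<and> root_pearl T \<in> box_pearls T \<longleftrightarrow> rooted_config Q T \<and> red_edges T = {} \<and>
     (\<forall>p\<in>letter_pearls T Dot \<union> letter_pearls T Diamond. \<not> free_pearl T p)"
proof
  assume Q: "companion_tree Q T \<and> root_pearl T \<in> box_pearls T"
  then have c: "necklace_config Q T" "free_pearl T (root_pearl T)" "root_pearl T \<in> box_pearls T"
    and inc1: "\<And>p. p \<in> letter_pearls T Dot \<union> letter_pearls T Diamond - {root_pearl T} \<Longrightarrow> card (incident_edges T p) = 1"
    and inc: "\<And>p. p \<in> box_pearls T \<union> letter_pearls T Triangle \<Longrightarrow> card (incident_edges T p) \<le> 1"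
    unfolding companion_tree_def by auto
  have ne: "p \<noteq> root_pearl T" if "p \<in> letter_pearls T Dot \<union> letter_pearls T Diamond" for p
    using c(3) that letter_pearls_sub[of p T] by (auto simp: mem_box_pearls)
  have "rooted_config Q T"
  proof (rule rooted_configI[OF c(1) _ _ c(3,2)])
    fix p assume "p \<in> pearls T"
    then show "card (incident_edges T p) \<le> 1"
      by (rule pearl_cases) (use inc inc1 ne in auto)
  qed (use Q in \<open>auto simp: companion_tree_def\<close>)
  moreover have "\<not> free_pearl T p" if "p \<in> letter_pearls T Dot \<union> letter_pearls T Diamond" for p
    using inc1[of p] ne[OF that] that unfolding free_pearl_def by auto
  ultimately show "rooted_config Q T \<and> red_edges T = {} \<and>
     (\<forall>p\<in>letter_pearls T Dot \<union> letter_pearls T Diamond. \<not> free_pearl T p)"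
    using Q unfolding companion_tree_def by blast
next
  assume *: "rooted_config Q T \<and> red_edges T = {} \<and>
     (\<forall>p\<in>letter_pearls T Dot \<union> letter_pearls T Diamond. \<not> free_pearl T p)"
  then interpret rooted_config Q T by simp
  show "companion_tree Q T \<and> root_pearl T \<in> box_pearls T"
    unfolding companion_tree_def card_incident using * config tree root_box root_free by simp
qed

context rooted_config
begin

lemma root_pearl_in: "root_pearl T \<in> pearls T" "snd (root_pearl T) = 0"
  using root_box by (simp_all add: mem_box_pearls)

lemma obtain_list:
  obtains L where "tree_list (all_edges T) (root_pearl T) L"
proof (rule tree_list_exists[OF config_edges_sub[OF config] match _ _ root_pearl_in(1)])
  show "forest (all_edges T)" using tree unfolding is_tree_forest by simp
  show "(fst x, fst y) \<in> (necklace_adj (all_edges T))\<^sup>*" if "x \<in> pearls T" "y \<in> pearls T" for x y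
    using tree that unfolding is_tree_forest by blast
qed (rule that)

lemma cw_next_walk: "cw_next T = walk (all_edges T)"
  unfolding cw_next_eq by (rule ext) (simp add: walk_def)

lemma partner_root: "partner (all_edges T) (root_pearl T) = root_pearl T"
  by (rule partner_free) (use root_free in \<open>simp add: free_pearl_iff\<close>)

lemma ccw_next_inj: "inj_on (ccw_next T) (pearls T)" "ccw_next T ` pearls T \<subseteq> pearls T"
proof -
  note E = match config_edges_sub[OF config]
  show "inj_on (ccw_next T) (pearls T)"
  proof (rule inj_onI)
    fix x y assume "x \<in> pearls T" "y \<in> pearls T" "ccw_next T x = ccw_next T y"
    then have "partner (all_edges T) x = partner (all_edges T) y"
      using inj_onD[OF ccw_rot_inj _ partner_in[OF E] partner_in[OF E]] unfolding ccw_next_eq by blast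
    then show "x = y" using partner_partner[OF match] by metis
  qed
  show "ccw_next T ` pearls T \<subseteq> pearls T"
    using ccw_rot_in[OF partner_in[OF E]] unfolding ccw_next_eq by blast
qed

lemma cw_next_inj: "inj_on (cw_next T) (pearls T)" "cw_next T ` pearls T \<subseteq> pearls T"
  unfolding cw_next_walk
  using walk_inj[OF match config_edges_sub[OF config]] walk_in[OF match config_edges_sub[OF config]] by auto

lemma finite_letter: "finite (letter_pearls T a)"
  using finite_pearls letter_pearls_sub by (metis finite_subset subsetI)

lemma edge_types:
  "(x, y) \<in> black_edges T \<Longrightarrow> x \<in> letter_pearls T Dot \<and> y \<in> box_pearls T"
  "(x, y) \<in> red_edges T \<Longrightarrow> x \<in> letter_pearls T Diamond \<and> y \<in> box_pearls T"
  "(x, y) \<in> blue_edges T \<Longrightarrow> x \<in> letter_pearls T Diamond \<and> y \<in> letter_pearls T Triangle"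
  using config unfolding necklace_config_def by auto

lemma defects_eq:
  assumes "red_edges T = {}"
  shows "defects T = letter_pearls T Triangle - Range (blue_edges T)"
proof -
  have "free_pearl T t \<longleftrightarrow> t \<notin> Range (blue_edges T)" "t \<noteq> root_pearl T"
    if t: "t \<in> letter_pearls T Triangle" for t
  proof -
    have "(t, y) \<notin> all_edges T" for y
      using config_edge(1)[OF config, of t y] letter_pearls_disjoint[OF t] by blast
    moreover have "(y, t) \<notin> black_edges T" for y
      using edge_types(1)[of y t] letter_pearls_sub[OF t] by (auto simp: mem_box_pearls)
    ultimately show "free_pearl T t \<longleftrightarrow> t \<notin> Range (blue_edges T)"
      unfolding free_pearl_iff all_edges_def using assms by auto
    show "t \<noteq> root_pearl T" using letter_pearls_sub[OF t] root_pearl_in by auto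
  qed
  then show ?thesis unfolding defects_def by blast
qed

end

section \<open>Planted subtrees of a Q-tree as intervals, and the blue matching\<close>

locale Q_tree_config = rooted_config +
  assumes no_blue: "blue_edges T = {}"
    and free_iff: "p \<in> pearls T \<Longrightarrow> free_pearl T p \<longleftrightarrow> p = root_pearl T \<or> p \<in> letter_pearls T Triangle"
begin

lemma edgeD: "(x, y) \<in> all_edges T \<Longrightarrow> snd x \<noteq> 0 \<and> snd y = 0 \<and> x \<in> pearls T \<and> y \<in> pearls T"
  using edge_types[of x y] no_blue letter_pearls_sub[of x T] unfolding all_edges_def
  by (auto simp: mem_box_pearls)

lemma diamond_edge:
  assumes "d \<in> letter_pearls T Diamond"
  shows "(d, partner (all_edges T) d) \<in> red_edges T"
proof -
  have "\<not> free_pearl T d" using free_iff[of d] assms letter_pearls_sub[OF assms] root_pearl_in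
    letter_pearls_disjoint[OF assms, of Triangle] by auto
  then obtain b where b: "(d, b) \<in> all_edges T \<or> (b, d) \<in> all_edges T" unfolding free_pearl_iff by blast
  have "(b, d) \<notin> all_edges T" using edgeD[of b d] letter_pearls_sub[OF assms] by auto
  with b have "(d, b) \<in> all_edges T" by simp
  moreover have "partner (all_edges T) d = b" using partner_eq[OF match b] .
  moreover have "(d, b) \<notin> black_edges T" using edge_types(1)[of d b] letter_pearls_disjoint[OF assms, of Dot] by auto
  ultimately show ?thesis using no_blue unfolding all_edges_def by auto
qed

lemma red_edges_eq: "red_edges T = {(d, partner (all_edges T) d) | d. d \<in> letter_pearls T Diamond}"
proof (intro equalityI subsetI)
  fix e assume e: "e \<in> red_edges T"
  obtain x y where xy: "e = (x, y)" by (cases e)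
  with e have "(x, y) \<in> all_edges T \<or> (y, x) \<in> all_edges T" unfolding all_edges_def by auto
  from partner_eq[OF match this] edge_types(2)[of x y] e xy
  show "e \<in> {(d, partner (all_edges T) d) | d. d \<in> letter_pearls T Diamond}" by auto
qed (use diamond_edge in auto)

lemma excess_root:
  "excess T (root_pearl T) =
     int (card (letter_pearls T Triangle)) - int (card (letter_pearls T Diamond))"
proof -
  have "Q_tree Q T"
    unfolding Q_tree_iff using rooted_config_axioms no_blue free_iff by blast
  moreover have "pearls T \<inter> letter_pearls T a = letter_pearls T a" for a
    using letter_pearls_sub by blast
  ultimately show ?thesis unfolding excess_def by (simp add: planted_subtree_root)
qed

lemma Domain_red: "Domain (red_edges T) = letter_pearls T Diamond"
  unfolding red_edges_eq by auto

text \<open>Edges of a Q-tree join letters to boxes, so the earlier end of the edge enclosing a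
  leftmost counterexample is again a box that precedes its partner.\<close>

lemma no_box_before_partner:
  assumes L: "tree_list (all_edges T) (root_pearl T) L"
    and p: "snd p = 0" "before L p (partner (all_edges T) p)"
  shows False
proof -
  let ?E = "all_edges T"
  have dist: "distinct L" using L unfolding tree_list_def by auto
  define X where "X = {p. snd p = 0 \<and> before L p (partner ?E p)}"
  have "X \<noteq> {}" using p unfolding X_def by blast
  moreover have "X \<subseteq> set L"
  proof
    show "x \<in> set L" if "x \<in> X" for x using that before_in_set[of L x] unfolding X_def by blast
  qed
  ultimately obtain x where x: "x \<in> X" "\<And>y. y \<in> X \<Longrightarrow> y \<noteq> x \<Longrightarrow> before L x y"
    using before_first[OF _ _ dist] by metis
  have xL: "x \<in> set L" using \<open>X \<subseteq> set L\<close> x(1) by auto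
  have "snd x = 0" "before L x (partner ?E x)" using x(1) unfolding X_def by auto
  from enclosing_edge[OF L root_pearl_in(2) partner_root xL this(1) disjI2[OF this(2)]]
  obtain m q where q: "partner ?E q = m" "before L m q" "before L m x" "snd q \<noteq> 0" by metis
  have ne: "m \<noteq> q" using q(2) before_irrefl[OF dist] by metis
  then have "(q, m) \<in> ?E \<or> (m, q) \<in> ?E" using q(1) by (metis partner_cases[OF match, of q])
  then have "snd m = 0" using edgeD[of q m] edgeD[of m q] q(4) by auto
  moreover have "partner ?E m = q" using partner_partner[OF match, of q] q(1) by simp
  ultimately have "m \<in> X" using q(2) unfolding X_def by simp
  moreover have "m \<noteq> x" using q(3) before_irrefl[OF dist] by metis
  ultimately show False using x(2) q(3) before_asym[OF dist] by metis
qed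

text \<open>By \<open>edge_split\<close> the interval is the component cut off by the red edge of
  \<open>d\<close>. It is closed under \<open>child_rel\<close>, and \<open>child_rel_reach\<close>
  shows that all of it lies below the box.\<close>

lemma planted_diamond:
  assumes L: "tree_list (all_edges T) (root_pearl T) L" and d: "d \<in> letter_pearls T Diamond"
  shows "before L d (partner (all_edges T) d)"
    and "planted_subtree T d = insert d (insert (partner (all_edges T) d)
           {z. between L d z (partner (all_edges T) d)})"
proof -
  let ?E = "all_edges T" and ?b = "partner (all_edges T) d"
  have E: "(d, ?b) \<in> ?E" using diamond_edge[OF d] unfolding all_edges_def by simp
  have dist: "distinct L" and set: "set L = pearls T - {root_pearl T}" using L unfolding tree_list_def by auto
  have "d \<noteq> root_pearl T" "?b \<noteq> root_pearl T" "d \<noteq> ?b"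
    using edgeD[OF E] root_pearl_in(2) root_free E unfolding free_pearl_iff by auto
  then have "before L d ?b \<or> before L ?b d"
    using before_total[of d L ?b] edgeD[OF E] set by auto
  moreover have "partner ?E ?b = d" using partner_partner[OF match] .
  ultimately show db: "before L d ?b" using no_box_before_partner[OF L, of ?b] edgeD[OF E] by auto
  then obtain \<alpha> \<xi> \<gamma> where Ld: "L = \<alpha> @ d # \<xi> @ ?b # \<gamma>" by (rule before_split)
  have btw: "between L d z ?b \<longleftrightarrow> z \<in> set \<xi>" for z
    using between_split[of \<alpha> d \<xi> ?b \<gamma> z] dist Ld by simp
  note comp = edge_split[OF L[unfolded Ld] E disjI1[OF refl]]
  have "planted_subtree T d = insert d (set (\<xi> @ [?b]))"
  proof (intro equalityI subsetI)
    fix x assume "x \<in> planted_subtree T d"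
    then have "(d, x) \<in> (child_rel T)\<^sup>*" unfolding planted_subtree_def by simp
    then show "x \<in> insert d (set (\<xi> @ [?b]))"
    proof induction
      case (step y z)
      from step(2) consider (neck) v i where "y = (v, 0)" "z = (v, Suc i)" "z \<in> pearls T" | (edge) "(y, z) \<in> ?E"
        unfolding child_rel_def by blast
      then show ?case
      proof cases
        case neck
        then have "y \<noteq> d" using edgeD[OF E] by auto
        then have "y \<in> set (\<xi> @ [?b])" using step.IH by simp
        then show ?thesis unfolding comp using neck by auto
      next
        case edge
        show ?thesis
        proof (cases "y = d")
          case True
          then show ?thesis using partner_eq[OF match, of d z] edge by auto
        next
          case False
          then show ?thesis
            using edge_split_edges[OF L[unfolded Ld] E disjI1[OF refl] edge] step.IH by auto
        qed
      qed
    qed simp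
  next
    fix x assume x: "x \<in> insert d (set (\<xi> @ [?b]))"
    show "x \<in> planted_subtree T d"
    proof (cases "x = d")
      case False
      then have "x \<in> set (\<xi> @ [?b])" using x by auto
      then have *: "x \<in> pearls T" "(fst ?b, fst x) \<in> (necklace_adj (?E - {(d, ?b)}))\<^sup>*"
        unfolding comp using necklace_adj_rtrancl_sym[of "fst x"] by auto
      have bbox: "?b \<in> box_pearls T" using edgeD[OF E] by (simp add: mem_box_pearls)
      have no: "(p, ?b) \<notin> ?E - {(d, ?b)}" for p
        using matching_unique[OF match, of ?b p d] E by auto
      have "(?b, x) \<in> (child_rel T)\<^sup>*"
        using child_rel_pearl[OF child_rel_reach[OF config match no_blue bbox _ no *(2)] *(1)] by auto
      moreover have "(d, ?b) \<in> child_rel T" using E unfolding child_rel_def by simp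
      ultimately show ?thesis unfolding planted_subtree_def by (simp add: converse_rtrancl_into_rtrancl)
    qed (simp add: planted_subtree_def)
  qed
  then show "planted_subtree T d = insert d (insert ?b {z. between L d z ?b})"
    unfolding btw by auto
qed

text \<open>A diamond that is not matched in its own planted subtree would make the excess there negative.\<close>

lemma unmatched_in_subtree:
  assumes L: "tree_list (all_edges T) (root_pearl T) L" and exc: "\<forall>x\<in>pearls T. 0 \<le> excess T x"
    and a: "a \<in> letter_pearls T Diamond - Domain M"
    and M: "M \<subseteq> letter_pearls T Diamond \<times> letter_pearls T Triangle" "one_one M"
      "noncrossing L M (unmatched (letter_pearls T Diamond) (letter_pearls T Triangle) M)"
  shows "\<exists>z. between L a z (partner (all_edges T) a) \<and>
    z \<in> unmatched (letter_pearls T Diamond) (letter_pearls T Triangle) M"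
proof (rule ccontr)
  let ?D = "letter_pearls T Diamond" and ?B = "letter_pearls T Triangle" and ?b = "partner (all_edges T) a"
  assume none: "\<not> ?thesis"
  have aD: "a \<in> ?D" using a by simp
  have dist: "distinct L" using L unfolding tree_list_def by auto
  note pl = planted_diamond[OF L aD]
  let ?Y = "{z. between L a z ?b}"
  have le: "card (?B \<inter> ?Y) \<le> card (?D \<inter> ?Y)"
    by (rule noncrossing_count[OF M(3,2,1) dist a pl(1) finite_letter]) (use none in blast)
  have b0: "snd ?b = 0" using edge_types(2)[OF diamond_edge[OF aD]] by (simp add: mem_box_pearls)
  then have b: "?b \<notin> ?D" "?b \<notin> ?B" using letter_pearls_sub[of ?b T] by auto
  have aB: "a \<notin> ?B" using letter_pearls_disjoint[OF aD, of Triangle] by auto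
  have aY: "a \<notin> ?Y" using before_irrefl[OF dist, of a] by (auto simp: between_def)
  have "planted_subtree T a \<inter> ?B = ?B \<inter> ?Y" unfolding pl(2) using b aB by auto
  moreover have "planted_subtree T a \<inter> ?D = insert a (?D \<inter> ?Y)" unfolding pl(2) using b aD by auto
  moreover have "card (insert a (?D \<inter> ?Y)) = Suc (card (?D \<inter> ?Y))"
    using aY finite_letter by simp
  ultimately have "excess T a < 0" unfolding excess_def using le by simp
  then show False using exc letter_pearls_sub[OF aD] by force
qed

text \<open>The intervals from diamonds to their boxes serve as \<open>seg\<close>, and
  \<open>unmatched_in_subtree\<close> keeps them from being exhausted. The last conclusion is the
  order of triangle and box from which the exchanges start.\<close>

lemma blue_matching:
  assumes L: "tree_list (all_edges T) (root_pearl T) L" and exc: "\<forall>x\<in>pearls T. 0 \<le> excess T x"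
    and M: "M = iter_matching (cw_next T) (letter_pearls T Diamond) (letter_pearls T Triangle)"
  shows "M \<subseteq> letter_pearls T Diamond \<times> letter_pearls T Triangle" "one_one M"
    "letter_pearls T Diamond \<subseteq> Domain M"
    "noncrossing L M (unmatched (letter_pearls T Diamond) (letter_pearls T Triangle) M)"
    "\<And>a b. (a, b) \<in> M \<Longrightarrow> before L b (partner (all_edges T) a)"
proof -
  let ?D = "letter_pearls T Diamond" and ?B = "letter_pearls T Triangle"
  let ?b = "partner (all_edges T)" and ?r = "root_pearl T"
  have L': "walks (cw_next T) ?r L ?r" "distinct (?r # L)" "set (?r # L) = pearls T"
    using L unfolding tree_list_def cw_next_walk by auto
  have DP: "?D \<subseteq> pearls T" using letter_pearls_sub by blast
  have rB: "?r \<notin> ?B" and "?r \<notin> ?D" using root_pearl_in letter_pearls_sub by blast+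
  moreover have "pearls T = insert ?r (set L)" using L'(3) by simp
  ultimately have DL: "?D \<subseteq> set L" using DP by (metis subset_insert)
  have disj: "?D \<inter> ?B = {}" using letter_pearls_disjoint by blast
  have fin: "final_matching (cw_next T) ?D ?B M"
    unfolding M by (rule iter_matching_final[OF cw_next_inj DP finite_letter finite_letter])
  then show MDB: "M \<subseteq> ?D \<times> ?B" and "one_one M"
    using match_step_reachable_invariant[of "cw_next T" ?D ?B M] unfolding final_matching_def by auto
  then have rM: "?r \<notin> Range M" using rB by auto
  have "\<exists>\<xi>. \<exists>\<alpha> \<gamma>. L = \<alpha> @ d # \<xi> @ ?b d # \<gamma>" if "d \<in> ?D" for d
    using before_split[OF planted_diamond(1)[OF L that]] by metis
  then obtain seg where seg: "\<And>d. d \<in> ?D \<Longrightarrow> \<exists>\<alpha> \<gamma>. L = \<alpha> @ d # seg d @ ?b d # \<gamma>" by metis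
  have btw: "between L d z (?b d) \<longleftrightarrow> z \<in> set (seg d)" if d: "d \<in> ?D" for d z
  proof -
    obtain \<alpha> \<gamma> where "L = \<alpha> @ d # seg d @ ?b d # \<gamma>" using seg[OF d] by blast
    then show ?thesis using between_split[of \<alpha> d "seg d" "?b d" \<gamma> z] L'(2) by simp
  qed
  have 1: "\<exists>\<alpha> \<delta>. L @ [?r] = \<alpha> @ d # seg d @ \<delta>" if d: "d \<in> ?D" for d
  proof -
    obtain \<alpha> \<gamma> where "L = \<alpha> @ d # seg d @ ?b d # \<gamma>" using seg[OF d] by blast
    then have "L @ [?r] = \<alpha> @ d # seg d @ (?b d # \<gamma> @ [?r])" by simp
    then show ?thesis by blast
  qed
  have 2: "\<exists>z\<in>set (seg d). z \<in> unmatched ?D ?B N"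
    if "N \<subseteq> ?D \<times> ?B" "one_one N" "noncrossing L N (unmatched ?D ?B N)" "d \<in> ?D - Domain N" for N d
  proof -
    have d: "d \<in> ?D" using that(4) by simp
    show ?thesis using unmatched_in_subtree[OF L exc that(4,1,2,3)] btw[OF d] by blast
  qed
  have *: "noncrossing L M (unmatched ?D ?B M)" "?D \<subseteq> Domain M"
    "\<And>a b. (a, b) \<in> M \<Longrightarrow> b \<in> set (seg a)"
    by (rule final_matching_noncrossing[OF L'(1,2) DL disj fin rM, of seg]; (rule 1 2; assumption | assumption))+
  then show "?D \<subseteq> Domain M" "noncrossing L M (unmatched ?D ?B M)" by auto
  show "before L b (?b a)" if ab: "(a, b) \<in> M" for a b
  proof -
    have "a \<in> ?D" using ab MDB by blast
    from btw[OF this] *(3)[OF ab] show ?thesis unfolding between_def by blast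
  qed
qed

end

subsection \<open>Rewiring and inverse rewiring\<close>

lemma same_neck:
  assumes "neck T' = neck T"
  shows "pearls T' = pearls T" "box_pearls T' = box_pearls T" "letter_pearls T' a = letter_pearls T a"
    "verts_of T' = verts_of T" "cw_rot T' = cw_rot T" "ccw_rot T' = ccw_rot T"
  using assms unfolding pearls_def box_pearls_def letter_pearls_def verts_of_def cw_rot_def ccw_rot_def
  by auto

text \<open>With all diamonds switched, the partner of \<open>tr d\<close> is \<open>d\<close> while
  \<open>bx d\<close> is free. So the clockwise arc from \<open>bx d\<close> to \<open>tr d\<close>
  turns into the counterclockwise arc from \<open>d\<close> to \<open>bx d\<close>, the shape of a
  red edge of the inverse closure.\<close>

lemma (in switching) reverse_arcs:
  assumes L: "tree_list (active D) r L" and Z: "Z \<subseteq> P - {r}" "\<And>z. z \<in> Z \<Longrightarrow> partner (active D) z = z"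
  shows "noncrossing (rev (map (partner (active D)) L)) {(d, bx d) | d. d \<in> D} Z \<longleftrightarrow>
    noncrossing L (arcs D) Z"
proof -
  let ?h = "partner (active D)"
  have m: "matching (active D)" and set: "set L = P - {r}" using L unfolding tree_list_def by auto
  have arcs_eq: "arcs D = {(bx d, tr d) | d. d \<in> D}" unfolding arcs_def by auto
  have tr: "?h (tr d) = d" if "d \<in> D" for d
    by (rule partner_eq[OF m]) (use that in \<open>auto simp: active_def\<close>)
  have bx: "?h (bx d) = bx d" if "d \<in> D" for d
    by (rule partner_free) (rule free_bx[OF that that])
  have "arcs D \<subseteq> set L \<times> set L"
    unfolding arcs_eq set using diamond root(2) by fastforce
  moreover have "inj_on ?h (set L)"
  proof (rule inj_onI)
    fix x y assume "?h x = ?h y"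
    then show "x = y" using partner_partner[OF m] by metis
  qed
  moreover have "?h ` Z = Z" using Z(2) by force
  moreover have "(\<lambda>(x, y). (?h y, ?h x)) ` arcs D = {(d, bx d) | d. d \<in> D}"
  proof -
    have "(\<lambda>(x, y). (?h y, ?h x)) ` arcs D = (\<lambda>d. (?h (tr d), ?h (bx d))) ` D"
      unfolding arcs_eq by force
    also have "\<dots> = (\<lambda>d. (d, bx d)) ` D" using tr bx by (intro image_cong) auto
    finally show ?thesis by blast
  qed
  ultimately show ?thesis
    using noncrossing_rev_map[of ?h L "arcs D" Z] Z(1) set by auto
qed

lemma card_Diff_image:
  assumes "inj_on g D" "g ` D \<subseteq> B" "finite B"
  shows "int (card (B - g ` D)) = int (card B) - int (card D)"
proof -
  have "finite (g ` D)" using assms(2,3) by (rule finite_subset)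
  then show ?thesis
    using card_Diff_subset[OF _ assms(2)] card_mono[OF assms(3,2)] card_image[OF assms(1)]
    by (simp add: of_nat_diff)
qed

lemma one_one_graph: "inj_on g A \<Longrightarrow> one_one {(a, g a) | a. a \<in> A}"
  unfolding one_one_def inj_on_def by blast

lemma noncrossing_outside:
  assumes "noncrossing L C U" "U' \<inter> set L = {}"
  shows "noncrossing L C (U \<union> U')"
proof -
  have "\<not> between L x z y" if "z \<in> U'" for x y z
    using assms(2) that before_in_set[of L x z] unfolding between_def by blast
  with assms(1) show ?thesis unfolding noncrossing_def by blast
qed

text \<open>Everything about the image is read off the final state of the exchanges. The last
  conclusion, that the matching is reached by steps, is recorded for the transport along
  renamings.\<close>

lemma rewire_nonneg_tree:
  assumes T: "nonneg_Q_tree Q T"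
  shows "balanced_companion_tree Q (rewire T)" "inv_rewire (rewire T) = T"
    "internal_defects (rewire T) = {}"
    "int (card (external_defects (rewire T))) = excess T (root_pearl T)"
    "final_matching (cw_next T) (Domain (red_edges T)) (letter_pearls T Triangle)
      (iter_matching (cw_next T) (Domain (red_edges T)) (letter_pearls T Triangle))"
proof -
  have Q: "Q_tree Q T" and exc: "\<forall>x\<in>pearls T. 0 \<le> excess T x"
    using T unfolding nonneg_Q_tree_def by auto
  interpret Q_tree_config Q T
    using Q unfolding Q_tree_iff Q_tree_config_def Q_tree_config_axioms_def by blast
  define D B E r where "D = letter_pearls T Diamond" and "B = letter_pearls T Triangle"
    and "E = all_edges T" and "r = root_pearl T"
  define M where "M = iter_matching (cw_next T) D B"
  have DP: "D \<subseteq> pearls T" unfolding D_def using letter_pearls_sub by blast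
  show "final_matching (cw_next T) (Domain (red_edges T)) (letter_pearls T Triangle)
      (iter_matching (cw_next T) (Domain (red_edges T)) (letter_pearls T Triangle))"
    unfolding Domain_red
    by (rule iter_matching_final[OF cw_next_inj DP[unfolded D_def] finite_letter finite_letter])
  obtain L where L: "tree_list E r L" using obtain_list unfolding E_def r_def by blast
  note bm = blue_matching[OF L[unfolded E_def r_def] exc M_def[unfolded D_def B_def], folded D_def B_def E_def]
  have bd: "\<And>b. p \<in> B \<Longrightarrow> p \<notin> D" for p unfolding B_def D_def using letter_pearls_disjoint[of p T] by blast
  define bx where "bx = partner E"
  have "D = Domain M" using bm(1,3) by blast
  from one_one_graphE[OF bm(2) this] obtain tr where inj_tr: "inj_on tr D" and M_eq: "M = {(d, tr d) | d. d \<in> D}"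
    by blast
  have tr_M: "(d, tr d) \<in> M" if "d \<in> D" for d using that unfolding M_eq by blast
  have tr_B: "tr d \<in> B" if "d \<in> D" for d using tr_M[OF that] bm(1) by auto
  have red: "red_edges T = {(d, bx d) | d. d \<in> D}" unfolding red_edges_eq D_def bx_def E_def ..
  have E_eq: "E = black_edges T \<union> red_edges T" unfolding E_def all_edges_def using no_blue by simp
  \<comment> \<open>The triangles left unmatched, which turn out to be the defects of the rewired
    tree.\<close>
  define Z where "Z = B - Range M"
  have rP: "r \<in> pearls T" "snd r = 0" unfolding r_def using root_pearl_in by auto
  have r_free: "(r, z) \<notin> E \<and> (z, r) \<notin> E" for z
    using root_free unfolding free_pearl_iff E_def r_def by blast
  have match': "matching E" using match unfolding E_def .
  have D_pearl: "d \<in> pearls T" "snd d \<noteq> 0" if "d \<in> D" for d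
    using that letter_pearls_sub[of d T] unfolding D_def by auto
  have B_pearl: "d \<in> pearls T" "snd d \<noteq> 0" if "d \<in> B" for d
    using that letter_pearls_sub[of d T] unfolding B_def by auto
  have bx_red: "(d, bx d) \<in> red_edges T" if "d \<in> D" for d using that red by blast
  interpret S: switching "pearls T" "cw_rot T" r "black_edges T" D bx tr Z
  proof
    fix x y assume xy: "(x, y) \<in> black_edges T"
    then have xyE: "(x, y) \<in> E" unfolding E_eq by simp
    have x: "x \<in> letter_pearls T Dot" "y \<in> box_pearls T" using edge_types(1)[OF xy] by auto
    have xD: "x \<notin> D" "x \<notin> B" unfolding D_def B_def using letter_pearls_disjoint[OF x(1)] by blast+
    have "y \<notin> bx ` D"
    proof
      assume "y \<in> bx ` D"
      then obtain d where d: "d \<in> D" "y = bx d" by blast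
      then have "(d, y) \<in> E" using bx_red[OF d(1)] unfolding E_eq by simp
      then have "d = x" using matching_unique[OF match', of y d x] xyE by blast
      with d xD show False by simp
    qed
    then show "x \<in> pearls T \<and> y \<in> pearls T \<and> snd x \<noteq> 0 \<and> snd y = 0 \<and> y \<noteq> r \<and>
      x \<notin> D \<and> x \<notin> tr ` D \<and> y \<notin> bx ` D"
      using x xD tr_B letter_pearls_sub[OF x(1)] r_free[of x] xyE by (auto simp: mem_box_pearls)
  next
    fix d assume d: "d \<in> D"
    have "(d, bx d) \<in> E" using bx_red[OF d] unfolding E_eq by simp
    then have "bx d \<noteq> r" using r_free[of d] by auto
    moreover have "bx d \<in> box_pearls T" using edge_types(2)[OF bx_red[OF d]] by simp
    moreover have "d \<notin> tr ` D" using tr_B bd d by blast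
    moreover have "tr d \<notin> Z" unfolding Z_def using tr_M[OF d] by auto
    ultimately show "d \<in> pearls T \<and> snd d \<noteq> 0 \<and> d \<notin> tr ` D \<and> bx d \<in> pearls T \<and> snd (bx d) = 0 \<and>
      bx d \<noteq> r \<and> tr d \<in> pearls T \<and> snd (tr d) \<noteq> 0 \<and> tr d \<notin> Z"
      using D_pearl[OF d] B_pearl[OF tr_B[OF d]] by (simp add: mem_box_pearls)
  next
    show "inj_on bx D"
      unfolding bx_def by (rule inj_onI) (use partner_partner[OF match'] in metis)
  qed (use rP inj_tr in auto)
  have act0: "S.active {} = E" unfolding S.active_def E_eq red by auto
  have actD: "S.active D = black_edges T \<union> M" unfolding S.active_def M_eq by auto
  have arcs0: "S.arcs {} = M" unfolding S.arcs_def M_eq by auto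
  \<comment> \<open>Non-negativity enters here through \<open>bm\<close>: it gives the arcs over the
    list and puts each triangle before the box of its diamond.\<close>
  have "S.state {} L"
    unfolding S.state_def act0 arcs0
  proof (intro conjI ballI)
    show "noncrossing L M Z"
      by (rule noncrossing_mono[OF bm(4)]) (auto simp: Z_def unmatched_def)
    show "before L (tr d) (bx d)" if "d \<in> D - {}" for d
      using bm(5)[OF tr_M[of d]] that unfolding bx_def by simp
  qed (use L in auto)
  from S.switch_all_forward[OF this] obtain L' where st: "S.state D L'" by blast
  define E' where "E' = black_edges T \<union> M"
  have L': "tree_list E' r L'" and nc': "noncrossing L' (S.arcs D) Z"
    using S.stateD(2,3)[OF st] unfolding actD E'_def by auto
  define T' where "T' = rewire T"
  have T'_eq: "T' = T\<lparr>blue_edges := M, red_edges := {}\<rparr>"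
    unfolding T'_def rewire_def cw_closure_def Domain_red M_def D_def B_def by simp
  have T'_sel: "neck T' = neck T" "root_pearl T' = r" "black_edges T' = black_edges T"
    "red_edges T' = {}" "blue_edges T' = M" unfolding T'_eq r_def by simp_all
  note nk = same_neck[OF T'_sel(1)]
  have E'_eq: "all_edges T' = E'" unfolding all_edges_def T'_sel E'_def by simp
  have free': "free_pearl T' p \<longleftrightarrow> (\<forall>q. (p, q) \<notin> E' \<and> (q, p) \<notin> E')" for p
    unfolding free_pearl_iff E'_eq ..
  have r_free': "(r, z) \<notin> E' \<and> (z, r) \<notin> E'" for z
    using S.free_root[of z D] unfolding actD E'_def .
  have conf': "necklace_config Q T'"
    using config bm(1) rP unfolding necklace_config_def T'_sel nk D_def B_def by auto
  interpret C: rooted_config Q T'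
  proof
    show "matching (all_edges T')" "is_tree T'"
      using L' unfolding is_tree_forest E'_eq nk tree_list_def by auto
    show "root_pearl T' \<in> box_pearls T'" unfolding nk T'_sel using rP by (simp add: mem_box_pearls)
    show "free_pearl T' (root_pearl T')" unfolding free' T'_sel using r_free' by simp
  qed (rule conf')
  have nonfree: "\<not> free_pearl T' p" if "p \<in> letter_pearls T' Dot \<union> letter_pearls T' Diamond" for p
  proof (cases "p \<in> D")
    case True
    then show ?thesis using tr_M unfolding free' E'_def by blast
  next
    case False
    then have p: "p \<in> letter_pearls T Dot" using that unfolding nk D_def by auto
    then have "\<not> free_pearl T p"
      using free_iff[of p] letter_pearls_sub[OF p] letter_pearls_disjoint[OF p, of Triangle] root_pearl_in(2)
      by auto
    then obtain q where q: "(p, q) \<in> E \<or> (q, p) \<in> E" unfolding free_pearl_iff E_def by blast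
    have "snd p \<noteq> 0" using letter_pearls_sub[OF p] by simp
    with q have pq: "(p, q) \<in> E" using edgeD[of q p] unfolding E_def by auto
    have "(p, q) \<notin> red_edges T" using edge_types(2)[of p q] False unfolding D_def by auto
    with pq show ?thesis unfolding free' E'_def E_eq by auto
  qed
  have comp: "companion_tree Q T' \<and> root_pearl T' \<in> box_pearls T'"
    unfolding companion_tree_iff using C.rooted_config_axioms nonfree T'_sel(4) by blast
  define FB where "FB = free_boxes T'"
  define G where "G = rev (map (partner E') L')"
  have ZP: "Z \<subseteq> pearls T - {r}" using B_pearl(1) B_pearl(2)[of r] rP unfolding Z_def by blast
  have def_Z: "defects T' = Z" using C.defects_eq unfolding T'_sel nk Z_def B_def by simp
  then have Z_free: "(z, y) \<notin> E' \<and> (y, z) \<notin> E'" if "z \<in> Z" for y z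
    using that unfolding defects_def free' by blast
  have ncG: "noncrossing G (red_edges T) Z"
    using S.reverse_arcs[of L'] L' nc' ZP partner_free[of _ E'] Z_free
    unfolding actD E'_def[symmetric] G_def red by blast
  have pr: "partner E' r = r" by (rule partner_free) (rule r_free')
  note G = reverse_walk_list[OF L' pr ccw_cw_rot, folded G_def]
  have ccw: "ccw_next T' = (\<lambda>z. ccw_rot T (partner E' z))" unfolding ccw_next_eq E'_eq nk ..
  have wG: "walks (ccw_next T') r G r" using G(1) unfolding ccw by simp
  have FB_iff: "b \<in> FB \<longleftrightarrow> b \<in> pearls T \<and> snd b = 0 \<and> (\<forall>q. (b, q) \<notin> E' \<and> (q, b) \<notin> E')" for b
    unfolding FB_def free_boxes_def nk free' by (auto simp: mem_box_pearls)
  have DM: "Domain (blue_edges T') = D" unfolding T'_sel M_eq by auto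
  have inv: "iter_matching (ccw_next T') D FB = red_edges T"
  proof (rule noncrossing_iter_matching[OF wG G(2) G(3)[symmetric]])
    show "inj_on (ccw_next T') (pearls T)" using C.ccw_next_inj(1) unfolding nk .
    show "D \<subseteq> pearls T" by (rule DP)
    show "finite D" unfolding D_def by (rule finite_letter)
    show "finite FB" using finite_pearls by (rule rev_finite_subset) (auto simp: FB_iff)
    show "red_edges T \<subseteq> D \<times> FB"
    proof
      fix e assume "e \<in> red_edges T"
      then obtain d where d: "d \<in> D" "e = (d, bx d)" unfolding red by blast
      then show "e \<in> D \<times> FB" using S.diamond[OF d(1)] S.free_bx[OF d(1) d(1)]
        unfolding actD E'_def[symmetric] by (simp add: FB_iff)
    qed
    show "one_one (red_edges T)" unfolding red by (rule one_one_graph[OF S.inj_bx])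
    show "D \<subseteq> Domain (red_edges T)" unfolding red by auto
    \<comment> \<open>Every box of \<open>T\<close> but the root has a black or red edge, so a free
      box of \<open>T'\<close> without a red edge is the root. The root is not in the list
      \<open>G\<close>, hence under no arc.\<close>
    have "unmatched D FB (red_edges T) \<subseteq> {r}"
    proof
      fix p assume p: "p \<in> unmatched D FB (red_edges T)"
      have "p \<notin> D \<or> p \<in> Domain (red_edges T)" unfolding red by auto
      then have p': "p \<in> FB" "p \<notin> Range (red_edges T)" using p unfolding unmatched_def by auto
      have "p \<notin> B" using p'(1) B_pearl[of p] by (auto simp: FB_iff)
      show "p \<in> {r}"
      proof (rule ccontr)
        assume "p \<notin> {r}"
        then have "\<not> free_pearl T p" using free_iff[of p] p'(1) \<open>p \<notin> B\<close> unfolding B_def r_def by (auto simp: FB_iff)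
        then obtain q where q: "(p, q) \<in> E \<or> (q, p) \<in> E" unfolding free_pearl_iff E_def by blast
        have "(p, q) \<notin> E" using edgeD[of p q] p'(1) unfolding E_def FB_iff by auto
        with q have "(q, p) \<in> E" by simp
        then show False using p' unfolding FB_iff E_eq E'_def by auto
      qed
    qed
    moreover have "{r} \<inter> set G = {}" using G(2) by auto
    ultimately show "noncrossing G (red_edges T) (unmatched D FB (red_edges T))"
      using noncrossing_mono[OF noncrossing_outside[OF ncG, of "{r}"], of "red_edges T"] by blast
  qed
  have inv_cl: "inv_closure T' = T'\<lparr>red_edges := red_edges T\<rparr>"
    unfolding inv_closure_def DM FB_def[symmetric] inv ..
  have edges_cl: "all_edges (inv_closure T') = E \<union> M"
    unfolding all_edges_def inv_cl E_eq by (auto simp: T'_sel)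
  have "{b \<in> box_pearls T'. free_pearl (inv_closure T') b} = {r}"
  proof (intro equalityI subsetI)
    fix b assume "b \<in> {b \<in> box_pearls T'. free_pearl (inv_closure T') b}"
    then have b: "b \<in> pearls T" "snd b = 0" "free_pearl T b"
      unfolding nk free_pearl_iff edges_cl E_def by (auto simp: mem_box_pearls)
    then have "b \<notin> B" using B_pearl[of b] by auto
    then show "b \<in> {r}" using free_iff[OF b(1)] b(3) unfolding r_def B_def by auto
  next
    fix b assume "b \<in> {r}"
    then show "b \<in> {b \<in> box_pearls T'. free_pearl (inv_closure T') b}"
      using r_free r_free' rP unfolding nk free_pearl_iff edges_cl E'_def by (auto simp: mem_box_pearls)
  qed
  with comp show "balanced_companion_tree Q (rewire T)"
    unfolding balanced_companion_tree_def T'_def[symmetric] T'_sel by simp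
  show "inv_rewire (rewire T) = T"
    unfolding T'_def[symmetric] inv_rewire_def inv_cl unfolding T'_eq using no_blue by (cases T) simp
  have red_cl: "red_edges (inv_closure T') = red_edges T" unfolding inv_cl by simp
  show int: "internal_defects (rewire T) = {}"
  proof (rule ccontr)
    assume "internal_defects (rewire T) \<noteq> {}"
    then obtain t d b where t: "t \<in> Z" "(d, b) \<in> red_edges T" "strictly_between (ccw_next T') d t b"
      unfolding internal_defects_def T'_def[symmetric] red_cl def_Z by blast
    have "before G d b" "\<not> between G d t b" using ncG t(1,2) unfolding noncrossing_def by blast+
    with strictly_between_walk[OF wG G(2)] t(3) show False by blast
  qed
  have "external_defects (rewire T) = Z"
    unfolding external_defects_def int using def_Z unfolding T'_def by simp
  moreover have "int (card Z) = int (card B) - int (card D)"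
  proof -
    have "Range M = tr ` D" unfolding M_eq by auto
    moreover have "tr ` D \<subseteq> B" using tr_B by blast
    ultimately show ?thesis
      unfolding Z_def using card_Diff_image[OF inj_tr] finite_letter B_def by simp
  qed
  ultimately show "int (card (external_defects (rewire T))) = excess T (root_pearl T)"
    unfolding excess_root B_def D_def by simp
qed

text \<open>Here the hypotheses supply the state with all diamonds switched: balancedness keeps the
  red arcs from passing the root, and the absence of internal defects keeps them off
  \<open>Z\<close>. Exchanging back to \<open>S.state {}\<close> then yields the tree, its
  non-negativity and its blue matching.\<close>

lemma inv_rewire_balanced:
  assumes T: "balanced_companion_tree Q T'" and no_int: "internal_defects T' = {}"
  shows "nonneg_Q_tree Q (inv_rewire T')" "rewire (inv_rewire T') = T'"
    "int (card (external_defects T')) = excess (inv_rewire T') (root_pearl T')"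
    "final_matching (ccw_next T') (Domain (blue_edges T')) (free_boxes T')
      (iter_matching (ccw_next T') (Domain (blue_edges T')) (free_boxes T'))"
proof -
  have "companion_tree Q T' \<and> root_pearl T' \<in> box_pearls T'"
    using T unfolding balanced_companion_tree_def by simp
  then have conf: "rooted_config Q T'" and no_red: "red_edges T' = {}"
    and nonfree: "\<And>p. p \<in> letter_pearls T' Dot \<union> letter_pearls T' Diamond \<Longrightarrow> \<not> free_pearl T' p"
    unfolding companion_tree_iff by auto
  interpret C: rooted_config Q T' by (rule conf)
  define D B E r where "D = letter_pearls T' Diamond" and "B = letter_pearls T' Triangle"
    and "E = all_edges T'" and "r = root_pearl T'"
  define M where "M = blue_edges T'"
  define FB where "FB = free_boxes T'"
  have match: "matching E" using C.match unfolding E_def .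
  have E_eq: "E = black_edges T' \<union> M" unfolding E_def all_edges_def M_def using no_red by simp
  have D_pearl: "d \<in> pearls T'" "snd d \<noteq> 0" if "d \<in> D" for d
    using that letter_pearls_sub[of d T'] unfolding D_def by auto
  have B_pearl: "d \<in> pearls T'" "snd d \<noteq> 0" if "d \<in> B" for d
    using that letter_pearls_sub[of d T'] unfolding B_def by auto
  have bd: "p \<notin> D" if "p \<in> B" for p
    using that unfolding B_def D_def using letter_pearls_disjoint[of p T' Diamond Triangle] by auto
  have rP: "r \<in> pearls T'" "snd r = 0" unfolding r_def using C.root_pearl_in by auto
  have r_free: "(r, z) \<notin> E \<and> (z, r) \<notin> E" for z
    using C.root_free unfolding free_pearl_iff E_def r_def by blast
  have M_sub: "M \<subseteq> D \<times> B" using C.config unfolding necklace_config_def M_def D_def B_def by simp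
  have ends: "x \<in> pearls T' \<and> snd x \<noteq> 0 \<and> (snd y = 0 \<or> y \<in> B)" if "(x, y) \<in> E" for x y
    using config_edge[OF C.config, of x y] that letter_pearls_sub[of x T'] unfolding E_def B_def
    by (auto simp: mem_box_pearls)
  define tr where "tr = partner E"
  have tr_M: "(d, tr d) \<in> M" if d: "d \<in> D" for d
  proof -
    obtain q where q: "(d, q) \<in> E \<or> (q, d) \<in> E"
      using nonfree[of d] d unfolding free_pearl_iff E_def D_def by blast
    have "(q, d) \<notin> E" using ends[of q d] D_pearl[OF d] bd[of d] d by auto
    with q have "(d, q) \<in> E" by simp
    moreover have "(d, q) \<notin> black_edges T'"
      using C.edge_types(1)[of d q] letter_pearls_disjoint[of d T' Dot Diamond] d unfolding D_def by auto
    ultimately have "(d, q) \<in> M" unfolding E_eq by simp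
    moreover have "tr d = q" unfolding tr_def by (rule partner_eq[OF match q])
    ultimately show ?thesis by simp
  qed
  have tr_B: "tr d \<in> B" if "d \<in> D" for d using tr_M[OF that] M_sub by blast
  have inj_tr: "inj_on tr D"
    unfolding tr_def by (rule inj_onI) (use partner_partner[OF match] in metis)
  have M_eq: "M = {(d, tr d) | d. d \<in> D}"
  proof (intro equalityI subsetI)
    fix e assume e: "e \<in> M"
    obtain d t where dt: "e = (d, t)" by (cases e)
    then have "d \<in> D" "(d, t) \<in> E" using e M_sub unfolding E_eq by auto
    then have "tr d = t" unfolding tr_def using partner_eq[OF match, of d t] by simp
    with dt \<open>d \<in> D\<close> show "e \<in> {(d, tr d) | d. d \<in> D}" by blast
  qed (use tr_M in blast)
  have DM: "Domain (blue_edges T') = D" unfolding M_def[symmetric] M_eq by blast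
  obtain L' where L': "C.tree_list E r L'" using C.obtain_list unfolding E_def r_def by blast
  define G where "G = rev (map (partner E) L')"
  have pr: "partner E r = r" by (rule partner_free) (rule r_free)
  note G = C.reverse_walk_list[OF L' pr ccw_cw_rot, folded G_def]
  have wG: "walks (ccw_next T') r G r" using G(1) unfolding ccw_next_eq E_def by simp
  have FB_iff: "b \<in> FB \<longleftrightarrow> b \<in> pearls T' \<and> snd b = 0 \<and> (\<forall>q. (b, q) \<notin> E \<and> (q, b) \<notin> E)" for b
    unfolding FB_def free_boxes_def free_pearl_iff E_def by (auto simp: mem_box_pearls)
  have D_FB: "x \<notin> FB" if "x \<in> D" for x using D_pearl[OF that] by (simp add: FB_iff)
  define R where "R = iter_matching (ccw_next T') D FB"
  have DP: "D \<subseteq> pearls T'" using D_pearl by blast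
  have fin: "finite D" "finite B" "finite FB"
    unfolding D_def B_def
    by (rule C.finite_letter, rule C.finite_letter, rule finite_subset[OF _ C.finite_pearls])
      (auto simp: FB_iff)
  have final: "final_matching (ccw_next T') D FB R"
    unfolding R_def by (rule iter_matching_final[OF C.ccw_next_inj DP fin(1,3)])
  then show "final_matching (ccw_next T') (Domain (blue_edges T')) (free_boxes T')
      (iter_matching (ccw_next T') (Domain (blue_edges T')) (free_boxes T'))"
    unfolding DM FB_def R_def .
  from final have R_rel: "R \<subseteq> D \<times> FB \<and> one_one R"
    using match_step_reachable_invariant[of "ccw_next T'" D FB R] unfolding final_matching_def by simp
  have inv_cl: "inv_closure T' = T'\<lparr>red_edges := R\<rparr>"
    unfolding inv_closure_def DM FB_def[symmetric] R_def ..
  have bal: "{b \<in> box_pearls T'. free_pearl (inv_closure T') b} = {r}"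
    using T unfolding balanced_companion_tree_def r_def by simp
  have free_cl: "free_pearl (inv_closure T') b \<longleftrightarrow> (\<forall>q. (b, q) \<notin> E \<union> R \<and> (q, b) \<notin> E \<union> R)" for b
    unfolding free_pearl_iff inv_cl all_edges_def E_eq M_def using no_red by auto
  have rR: "r \<notin> Range R"
  proof -
    have "free_pearl (inv_closure T') r" using bal by blast
    then show ?thesis unfolding free_cl by blast
  qed
  have FB_R: "b \<in> Range R" if b: "b \<in> FB" "b \<noteq> r" for b
  proof (rule ccontr)
    assume nb: "b \<notin> Range R"
    have "(b, q) \<notin> R" for q using R_rel D_FB[of b] b(1) by blast
    then have "free_pearl (inv_closure T') b" using b(1) nb unfolding free_cl FB_iff by blast
    moreover have "b \<in> box_pearls T'" using b(1) by (simp add: FB_iff mem_box_pearls)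
    ultimately have "b \<in> {r}" using bal by blast
    with b(2) show False by simp
  qed
  have rFB: "r \<in> FB" using rP r_free by (simp add: FB_iff)
  have DG: "D \<subseteq> set G"
  proof
    fix x assume "x \<in> D"
    then have "x \<in> pearls T'" "x \<noteq> r" using D_pearl[of x] rP by auto
    then show "x \<in> set G" using G(3) by auto
  qed
  have disj: "D \<inter> FB = {}" using D_FB by blast
  have "\<exists>\<xi>. \<exists>\<alpha>. G = \<alpha> @ d # \<xi>" if "d \<in> D" for d
    using split_list[of d G] that DG by blast
  then obtain seg where seg: "\<And>d. d \<in> D \<Longrightarrow> \<exists>\<alpha>. G = \<alpha> @ d # seg d" by metis
  have 1: "\<exists>\<alpha> \<delta>. G @ [r] = \<alpha> @ d # (seg d @ [r]) @ \<delta>" if "d \<in> D" for d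
    using seg[OF that] by force
  \<comment> \<open>Balancedness leaves the root unmatched in \<open>R\<close>, hence in each part
    of \<open>R\<close>: it is the obstacle at the end of every stretch.\<close>
  have 2: "\<exists>z\<in>set (seg d @ [r]). z \<in> unmatched D FB N" if "N \<subseteq> R" for N d
    using rR rFB that unfolding unmatched_def by auto
  have nc: "noncrossing G R (unmatched D FB R)" and DR: "D \<subseteq> Domain R"
    by (rule final_matching_noncrossing[OF wG G(2) DG disj final rR, of "\<lambda>d. seg d @ [r]"];
      (rule 1 2; assumption | assumption))+
  have R_fun: "one_one R" "D = Domain R" using DR R_rel by blast+
  from one_one_graphE[OF this] obtain bx where inj_bx: "inj_on bx D"
    and R_eq: "R = {(d, bx d) | d. d \<in> D}" by blast
  have bx_R: "(d, bx d) \<in> R" if "d \<in> D" for d using that unfolding R_eq by blast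
  have bx_FB: "bx d \<in> FB" if "d \<in> D" for d using bx_R[OF that] R_rel by blast
  define Z where "Z = B - Range M"
  interpret S: switching "pearls T'" "cw_rot T'" r "black_edges T'" D bx tr Z
  proof
    fix x y assume xy: "(x, y) \<in> black_edges T'"
    then have xyE: "(x, y) \<in> E" unfolding E_eq by simp
    have x: "x \<in> letter_pearls T' Dot" "y \<in> box_pearls T'" using C.edge_types(1)[OF xy] by auto
    have xD: "x \<notin> D" "x \<notin> B" unfolding D_def B_def using letter_pearls_disjoint[OF x(1)] by blast+
    have "y \<notin> bx ` D" using bx_FB xyE by (auto simp: FB_iff)
    then show "x \<in> pearls T' \<and> y \<in> pearls T' \<and> snd x \<noteq> 0 \<and> snd y = 0 \<and> y \<noteq> r \<and>
      x \<notin> D \<and> x \<notin> tr ` D \<and> y \<notin> bx ` D"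
      using x xD tr_B letter_pearls_sub[OF x(1)] r_free[of x] xyE by (auto simp: mem_box_pearls)
  next
    fix d assume d: "d \<in> D"
    have "bx d \<noteq> r" using bx_R[OF d] rR by auto
    moreover have "bx d \<in> FB" by (rule bx_FB[OF d])
    moreover have "d \<notin> tr ` D" using tr_B bd d by blast
    moreover have "tr d \<notin> Z" unfolding Z_def using tr_M[OF d] by auto
    ultimately show "d \<in> pearls T' \<and> snd d \<noteq> 0 \<and> d \<notin> tr ` D \<and> bx d \<in> pearls T' \<and> snd (bx d) = 0 \<and>
      bx d \<noteq> r \<and> tr d \<in> pearls T' \<and> snd (tr d) \<noteq> 0 \<and> tr d \<notin> Z"
      using D_pearl[OF d] B_pearl[OF tr_B[OF d]] by (simp add: FB_iff)
  qed (use rP inj_tr inj_bx in auto)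
  have actD: "S.active D = E" unfolding S.active_def E_eq M_eq by auto
  have act0: "S.active {} = black_edges T' \<union> R" unfolding S.active_def R_eq by auto
  have arcs0: "S.arcs {} = M" unfolding S.arcs_def M_eq by auto
  have ZP: "Z \<subseteq> pearls T' - {r}" using B_pearl(1) B_pearl(2)[of r] rP unfolding Z_def by blast
  have def_Z: "defects T' = Z" using C.defects_eq[OF no_red] unfolding Z_def B_def M_def .
  then have Z_free: "(z, y) \<notin> E \<and> (y, z) \<notin> E" if "z \<in> Z" for y z
    using that unfolding defects_def free_pearl_iff E_def by blast
  have red_cl: "red_edges (inv_closure T') = R" unfolding inv_cl by simp
  \<comment> \<open>A red arc over a defect would make that defect internal.\<close>
  have uncovered: "\<not> between G d z b" if "z \<in> Z" "(d, b) \<in> R" for d z b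
  proof
    assume btw: "between G d z b"
    have "before G d b" using nc that(2) unfolding noncrossing_def by blast
    with strictly_between_walk[OF wG G(2)] btw have "strictly_between (ccw_next T') d z b" by blast
    then have "z \<in> internal_defects T'"
      unfolding internal_defects_def red_cl def_Z using that by blast
    then show False using no_int by simp
  qed
  have ncZ: "noncrossing G R Z"
    using nc uncovered unfolding noncrossing_def by blast
  have "noncrossing L' (S.arcs D) Z"
    using S.reverse_arcs[of L'] L' ncZ ZP partner_free[of _ E] Z_free
    unfolding actD G_def R_eq by blast
  then have "S.state D L'" unfolding S.state_def actD using L' by simp
  from S.switch_all_backward[OF this] obtain L where st: "S.state {} L" by blast
  define E0 where "E0 = black_edges T' \<union> R"
  have L: "C.tree_list E0 r L" and nc0: "noncrossing L M Z"
    and order: "\<And>d. d \<in> D \<Longrightarrow> before L (tr d) (bx d)"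
    using S.stateD(2-4)[OF st] unfolding act0 E0_def arcs0 by auto
  define T where "T = inv_rewire T'"
  have T_eq: "T = T'\<lparr>red_edges := R, blue_edges := {}\<rparr>"
    unfolding T_def inv_rewire_def inv_cl by simp
  have T_sel: "neck T = neck T'" "root_pearl T = r" "black_edges T = black_edges T'"
    "red_edges T = R" "blue_edges T = {}" unfolding T_eq r_def by simp_all
  note nk = same_neck[OF T_sel(1)]
  have E0_eq: "all_edges T = E0" unfolding all_edges_def T_sel E0_def by simp
  have free0: "free_pearl T p \<longleftrightarrow> (\<forall>q. (p, q) \<notin> E0 \<and> (q, p) \<notin> E0)" for p
    unfolding free_pearl_iff E0_eq ..
  have r_free0: "(r, z) \<notin> E0 \<and> (z, r) \<notin> E0" for z
    using S.free_root[of z "{}"] unfolding act0 E0_def .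
  have FB_box: "FB \<subseteq> box_pearls T'" unfolding FB_def free_boxes_def by auto
  have conf0: "necklace_config Q T"
    using C.config R_rel FB_box rP unfolding necklace_config_def T_sel nk D_def by auto
  interpret T: rooted_config Q T
  proof
    show "matching (all_edges T)" "is_tree T"
      using L unfolding is_tree_forest E0_eq nk C.tree_list_def by auto
    show "root_pearl T \<in> box_pearls T" unfolding nk T_sel using rP by (simp add: mem_box_pearls)
    show "free_pearl T (root_pearl T)" unfolding free0 T_sel using r_free0 by simp
  qed (rule conf0)
  have types0: "x \<in> letter_pearls T' Dot \<union> D \<and> y \<in> box_pearls T'" if "(x, y) \<in> E0" for x y
    using that C.edge_types(1)[of x y] R_rel FB_box unfolding E0_def by auto
  have free_iff: "free_pearl T p \<longleftrightarrow> p = root_pearl T \<or> p \<in> letter_pearls T Triangle" if p: "p \<in> pearls T'" for p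
  proof
    assume "p = root_pearl T \<or> p \<in> letter_pearls T Triangle"
    then show "free_pearl T p"
    proof
      assume pB: "p \<in> letter_pearls T Triangle"
      then have "p \<in> B" unfolding nk B_def .
      then have "p \<notin> letter_pearls T' Dot" "p \<notin> D" "p \<notin> box_pearls T'"
        using bd[of p] B_pearl[of p] letter_pearls_disjoint[of p T' Dot Triangle] unfolding B_def
        by (auto simp: mem_box_pearls)
      then show ?thesis unfolding free0 using types0[of p] types0[of _ p] by blast
    qed (use T.root_free in simp)
  next
    assume free: "free_pearl T p"
    from p show "p = root_pearl T \<or> p \<in> letter_pearls T Triangle"
    proof (cases rule: pearl_cases)
      case 1
      then have pbox: "snd p = 0" by (simp add: mem_box_pearls)
      show ?thesis
      proof (rule ccontr)
        assume "\<not> ?thesis"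
        then have pr: "p \<noteq> r" unfolding T_sel by simp
        have "p \<notin> Range R" using free unfolding free0 E0_def by blast
        then have "p \<notin> FB" using FB_R[of p] pr by blast
        then obtain q where "(p, q) \<in> E \<or> (q, p) \<in> E" using p pbox by (auto simp: FB_iff)
        moreover have "(p, q) \<notin> E" using ends[of p q] pbox by auto
        ultimately have "(q, p) \<in> E" by simp
        moreover have "(q, p) \<notin> M" using M_sub B_pearl[of p] pbox by auto
        ultimately show False using free unfolding free0 E0_def E_eq by blast
      qed
    next
      case 2
      then obtain q where "(p, q) \<in> E \<or> (q, p) \<in> E"
        using nonfree[of p] unfolding free_pearl_iff E_def by blast
      moreover have "p \<notin> D" "p \<notin> B" unfolding D_def B_def using letter_pearls_disjoint[OF 2] by blast+
      ultimately have "(p, q) \<in> black_edges T' \<or> (q, p) \<in> black_edges T'"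
        using M_sub unfolding E_eq by blast
      then show ?thesis using free unfolding free0 E0_def by blast
    next
      case 3
      then have "(p, bx p) \<in> R" using bx_R[of p] unfolding D_def by simp
      then show ?thesis using free unfolding free0 E0_def by blast
    next
      case 4
      then show ?thesis unfolding nk by simp
    qed
  qed
  have QT: "Q_tree Q T"
    unfolding Q_tree_iff nk(1) using T.rooted_config_axioms T_sel(5) free_iff by blast
  interpret T: Q_tree_config Q T
    using QT unfolding Q_tree_iff Q_tree_config_def Q_tree_config_axioms_def by blast
  have TL: "T.tree_list (all_edges T) (root_pearl T) L" using L unfolding E0_eq T_sel nk .
  have pE0: "partner E0 d = bx d" if "d \<in> D" for d
    by (rule partner_eq[OF T.match[unfolded E0_eq]]) (use bx_R[OF that] in \<open>simp add: E0_def\<close>)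
  \<comment> \<open>The arc puts \<open>tr d\<close> after \<open>d\<close> and the state puts it
    before \<open>bx d\<close>, so it lies in the interval that is the subtree planted at
    \<open>d\<close>.\<close>
  have tr_below: "tr d \<in> planted_subtree T d" if d: "d \<in> D" for d
  proof -
    have "d \<in> letter_pearls T Diamond" using d unfolding nk D_def .
    note pl = T.planted_diamond(2)[OF TL this, unfolded E0_eq pE0[OF d]]
    have "before L d (tr d)" using nc0 tr_M[OF d] unfolding noncrossing_def by blast
    then show ?thesis using order[OF d] unfolding pl between_def by simp
  qed
  \<comment> \<open>Planted subtrees are closed downwards, so \<open>tr\<close> injects the diamonds
    of any of them into its triangles.\<close>
  have "0 \<le> excess T x" for x
  proof -
    have "card (planted_subtree T x \<inter> D) \<le> card (planted_subtree T x \<inter> B)"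
    proof (rule card_inj_on_le)
      show "inj_on tr (planted_subtree T x \<inter> D)" using inj_tr by (rule inj_on_subset) simp
      show "tr ` (planted_subtree T x \<inter> D) \<subseteq> planted_subtree T x \<inter> B"
      proof
        fix t assume "t \<in> tr ` (planted_subtree T x \<inter> D)"
        then obtain d where d: "d \<in> D" "t = tr d" "d \<in> planted_subtree T x" by blast
        have "(x, d) \<in> (child_rel T)\<^sup>*" "(d, t) \<in> (child_rel T)\<^sup>*"
          using d tr_below[OF d(1)] unfolding planted_subtree_def by auto
        then show "t \<in> planted_subtree T x \<inter> B"
          using tr_B[OF d(1)] d(2) unfolding planted_subtree_def by auto
      qed
    qed (use fin in simp)
    then show ?thesis unfolding excess_def nk D_def B_def by simp
  qed
  then show "nonneg_Q_tree Q (inv_rewire T')"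
    unfolding nonneg_Q_tree_def T_def[symmetric] using QT by simp
  have DomR: "Domain (red_edges T) = D" unfolding T_sel R_eq by auto
  have "iter_matching (cw_next T) D B = M"
  proof (rule noncrossing_iter_matching)
    show "walks (cw_next T) r L r" "distinct (r # L)" "pearls T = set (r # L)"
      using TL unfolding T.tree_list_def T.cw_next_walk T_sel by auto
    show "inj_on (cw_next T) (pearls T)" by (rule T.cw_next_inj(1))
    show "D \<subseteq> pearls T" unfolding nk by (rule DP)
    show "one_one M" unfolding M_eq by (rule one_one_graph[OF inj_tr])
    show "D \<subseteq> Domain M" unfolding M_eq by auto
    then have "unmatched D B M = Z" unfolding unmatched_def Z_def by auto
    then show "noncrossing L M (unmatched D B M)" using nc0 by simp
  qed (use fin M_sub in auto)
  then have cw: "cw_closure T = T\<lparr>blue_edges := M\<rparr>"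
    unfolding cw_closure_def DomR nk B_def by simp
  show "rewire (inv_rewire T') = T'"
    unfolding T_def[symmetric] rewire_def cw unfolding T_eq M_def using no_red by (cases T') simp
  have "external_defects T' = Z"
    unfolding external_defects_def no_int using def_Z by simp
  moreover have "int (card Z) = int (card B) - int (card D)"
  proof -
    have "Range M = tr ` D" unfolding M_eq by auto
    moreover have "tr ` D \<subseteq> B" using tr_B by blast
    ultimately show ?thesis unfolding Z_def using card_Diff_image[OF inj_tr _ fin(2)] by simp
  qed
  ultimately show "int (card (external_defects T')) = excess (inv_rewire T') (root_pearl T')"
    using T.excess_root unfolding T_def[symmetric] T_sel r_def nk B_def D_def by simp
qed

subsection \<open>Renaming of vertices\<close>

text \<open>A walk started in the range of \<open>h\<close> never leaves it, so it is the image of a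
  walk.\<close>

lemma walks_map:
  assumes "\<And>x. f' (h x) = h (f x)"
  shows "walks f' (h a) us y \<longleftrightarrow> (\<exists>vs z. us = map h vs \<and> y = h z \<and> walks f a vs z)"
proof (induction us arbitrary: a)
  case Nil
  show ?case using assms by auto
next
  case (Cons u us)
  show ?case
  proof
    assume "walks f' (h a) (u # us) y"
    then have u: "u = h (f a)" "walks f' (h (f a)) us y" using assms by auto
    with Cons.IH obtain vs z where "us = map h vs" "y = h z" "walks f (f a) vs z" by blast
    then have "u # us = map h (f a # vs)" "y = h z" "walks f a (f a # vs) z" using u by auto
    then show "\<exists>vs z. u # us = map h vs \<and> y = h z \<and> walks f a vs z" by (intro exI conjI)
  next
    assume "\<exists>vs z. u # us = map h vs \<and> y = h z \<and> walks f a vs z"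
    then obtain vs z where vs: "u # us = map h vs" "y = h z" "walks f a vs z" by metis
    then obtain v ws where "vs = v # ws" by (cases vs) auto
    with vs have "u = h (f a)" "us = map h ws" "walks f (f a) ws z" by auto
    with Cons.IH[of "f a"] vs(2) show "walks f' (h a) (u # us) y" using assms by auto
  qed
qed

lemma Domain_map_prod: "Domain (map_prod h k ` M) = h ` Domain M"
  by force

lemma Range_map_prod: "Range (map_prod h k ` M) = k ` Range M"
  by force

lemma mem_map_prod_image:
  assumes "inj h"
  shows "(h p, q) \<in> map_prod h h ` E \<longleftrightarrow> (\<exists>q'. q = h q' \<and> (p, q') \<in> E)"
    and "(q, h p) \<in> map_prod h h ` E \<longleftrightarrow> (\<exists>q'. q = h q' \<and> (q', p) \<in> E)"
proof -
  have "p = x" if "h p = h x" for x using injD[OF assms that] .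
  then show "(h p, q) \<in> map_prod h h ` E \<longleftrightarrow> (\<exists>q'. q = h q' \<and> (p, q') \<in> E)"
    "(q, h p) \<in> map_prod h h ` E \<longleftrightarrow> (\<exists>q'. q = h q' \<and> (q', p) \<in> E)"
    by (auto simp: map_prod_def)
qed

lemma unmatched_map:
  "inj h \<Longrightarrow> unmatched (h ` A) (h ` B) (map_prod h h ` M) = h ` unmatched A B M"
  unfolding unmatched_def Domain_map_prod Range_map_prod by (simp add: image_Un image_set_diff)

lemma match_step_map:
  assumes h: "inj h" and f: "\<And>x. f' (h x) = h (f x)"
  shows "match_step f' (h ` A) (h ` B) (map_prod h h ` M) N' \<longleftrightarrow>
    (\<exists>N. N' = map_prod h h ` N \<and> match_step f A B M N)"
proof
  assume "match_step f' (h ` A) (h ` B) (map_prod h h ` M) N'"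
  then obtain a' b' us where s: "a' \<in> h ` A - Domain (map_prod h h ` M)"
    "b' \<in> h ` B - Range (map_prod h h ` M)" "walks f' a' us b'"
    "set us \<inter> unmatched (h ` A) (h ` B) (map_prod h h ` M) = {}"
    "N' = insert (a', b') (map_prod h h ` M)" by (rule match_stepE)
  then obtain a where a: "a' = h a" "a \<in> A - Domain M" unfolding Domain_map_prod by blast
  from s(2) obtain b where b: "b' = h b" "b \<in> B - Range M" unfolding Range_map_prod by blast
  from s(3) obtain vs z where vs: "us = map h vs" "h b = h z" "walks f a vs z"
    unfolding a(1) b(1) walks_map[where f' = f' and h = h and f = f, OF f] by blast
  then have "walks f a vs b" using injD[OF h] by metis
  moreover have "set vs \<inter> unmatched A B M = {}"
    using s(4) unfolding unmatched_map[OF h] vs(1) by auto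
  ultimately have "match_step f A B M (insert (a, b) M)"
    using a(2) b(2) by (intro match_stepI)
  moreover have "N' = map_prod h h ` insert (a, b) M" unfolding s(5) a(1) b(1) by simp
  ultimately show "\<exists>N. N' = map_prod h h ` N \<and> match_step f A B M N" by blast
next
  assume "\<exists>N. N' = map_prod h h ` N \<and> match_step f A B M N"
  then obtain N where N: "N' = map_prod h h ` N" "match_step f A B M N" by blast
  from N(2) obtain a b us where s: "a \<in> A - Domain M" "b \<in> B - Range M" "walks f a us b"
    "set us \<inter> unmatched A B M = {}" "N = insert (a, b) M" by (rule match_stepE)
  have "match_step f' (h ` A) (h ` B) (map_prod h h ` M) (insert (h a, h b) (map_prod h h ` M))"
  proof (rule match_stepI)
    show "h a \<in> h ` A - Domain (map_prod h h ` M)" "h b \<in> h ` B - Range (map_prod h h ` M)"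
      unfolding Domain_map_prod Range_map_prod using s(1,2) injD[OF h] by blast+
    show "walks f' (h a) (map h us) (h b)" unfolding walks_map[where f' = f' and h = h and f = f, OF f] using s(3) by blast
    show "set (map h us) \<inter> unmatched (h ` A) (h ` B) (map_prod h h ` M) = {}"
      unfolding unmatched_map[OF h] using s(4) injD[OF h] by auto
  qed
  then show "match_step f' (h ` A) (h ` B) (map_prod h h ` M) N'" unfolding N(1) s(5) by simp
qed

lemma final_matching_map:
  assumes h: "inj h" and f: "\<And>x. f' (h x) = h (f x)" and M: "final_matching f A B M"
  shows "final_matching f' (h ` A) (h ` B) (map_prod h h ` M)"
proof -
  have "(match_step f A B)\<^sup>*\<^sup>* {} N \<Longrightarrow>
      (match_step f' (h ` A) (h ` B))\<^sup>*\<^sup>* {} (map_prod h h ` N)" for N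
  proof (induction rule: rtranclp_induct)
    case (step N N')
    then have "match_step f' (h ` A) (h ` B) (map_prod h h ` N) (map_prod h h ` N')"
      unfolding match_step_map[where f' = f' and h = h and f = f, OF h f] by blast
    with step.IH show ?case by (rule rtranclp.rtrancl_into_rtrancl)
  qed simp
  with M show ?thesis unfolding final_matching_def match_step_map[where f' = f' and h = h and f = f, OF h f] by blast
qed

text \<open>The \<open>THE\<close> is not transported directly: the known final matching is mapped
  step by step and its image recognised by uniqueness.\<close>

lemma iter_matching_map:
  assumes h: "inj h" and f: "\<And>x. f' (h x) = h (f x)"
    and P: "inj_on f P" "f ` P \<subseteq> P" "A \<subseteq> P" and M: "final_matching f A B (iter_matching f A B)"
  shows "iter_matching f' (h ` A) (h ` B) = map_prod h h ` iter_matching f A B"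
proof (rule iter_matching_eq[OF _ _ _ final_matching_map[where f' = f' and h = h and f = f, OF h f M]])
  show "inj_on f' (h ` P)"
  proof (rule inj_onI)
    fix x y assume "x \<in> h ` P" "y \<in> h ` P" "f' x = f' y"
    then obtain u v where "x = h u" "y = h v" "u \<in> P" "v \<in> P" "h (f u) = h (f v)" using f by auto
    then show "x = y" using injD[OF h] inj_onD[OF P(1)] by metis
  qed
  show "f' ` h ` P \<subseteq> h ` P" using P(2) f by auto
  show "h ` A \<subseteq> h ` P" using P(3) by auto
qed

section \<open>Renaming by a permutation of all vertex names\<close>

abbreviation edge_map :: "('v \<Rightarrow> 'v) \<Rightarrow> 'v pearl \<times> 'v pearl \<Rightarrow> 'v pearl \<times> 'v pearl" where
  "edge_map g \<equiv> map_prod (map_prod g id) (map_prod g id)"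

definition relabel :: "('v \<Rightarrow> 'v) \<Rightarrow> 'v config \<Rightarrow> 'v config" where
  "relabel g T = \<lparr>neck = neck T \<circ> inv g, root_pearl = map_prod g id (root_pearl T),
     black_edges = edge_map g ` black_edges T,
     red_edges = edge_map g ` red_edges T,
     blue_edges = edge_map g ` blue_edges T\<rparr>"

context
  fixes g :: "'v \<Rightarrow> 'v"
  assumes g: "bij g"
begin

lemma relabel_pearl_inj: "inj (map_prod g id :: 'v pearl \<Rightarrow> 'v pearl)"
  using g by (simp add: bij_def prod.inj_map)

lemma relabel_pearl_surj:
  fixes x :: "'v pearl"
  obtains y where "x = map_prod g id y"
proof -
  obtain v where "fst x = g v" using g by (metis bij_pointE)
  then have "x = map_prod g id (v, snd x)" by (simp add: prod_eq_iff)
  with that show thesis .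
qed

lemma relabel_neck: "neck (relabel g T) (g v) = neck T v"
  using g unfolding relabel_def by (simp add: bij_def)

lemma relabel_letter_pearls: "letter_pearls (relabel g T) a = map_prod g id ` letter_pearls T a"
proof -
  have "(u, i) \<in> letter_pearls (relabel g T) a \<longleftrightarrow> (u, i) \<in> map_prod g id ` letter_pearls T a" for u i
  proof -
    obtain v where v: "u = g v" using g by (metis bij_pointE)
    have "(u, i) \<in> map_prod g id ` letter_pearls T a \<longleftrightarrow> (v, i) \<in> letter_pearls T a"
      unfolding v using inj_image_mem_iff[OF relabel_pearl_inj, of "(v, i)"] by simp
    then show ?thesis unfolding mem_letter_pearls v relabel_neck by simp
  qed
  then show ?thesis by auto
qed

lemma relabel_box_pearls: "box_pearls (relabel g T) = map_prod g id ` box_pearls T"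
proof -
  have "(u, i) \<in> box_pearls (relabel g T) \<longleftrightarrow> (u, i) \<in> map_prod g id ` box_pearls T" for u i
  proof -
    obtain v where v: "u = g v" using g by (metis bij_pointE)
    have "(u, i) \<in> map_prod g id ` box_pearls T \<longleftrightarrow> (v, i) \<in> box_pearls T"
      unfolding v using inj_image_mem_iff[OF relabel_pearl_inj, of "(v, i)"] by simp
    then show ?thesis unfolding mem_box_pearls mem_pearls v relabel_neck by simp
  qed
  then show ?thesis by auto
qed

lemma relabel_all_edges:
  "all_edges (relabel g T) = edge_map g ` all_edges T"
  unfolding all_edges_def relabel_def by (simp add: image_Un)

lemma relabel_edge:
  "(map_prod g id p, q) \<in> all_edges (relabel g T) \<longleftrightarrow> (\<exists>q'. q = map_prod g id q' \<and> (p, q') \<in> all_edges T)"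
  "(q, map_prod g id p) \<in> all_edges (relabel g T) \<longleftrightarrow> (\<exists>q'. q = map_prod g id q' \<and> (q', p) \<in> all_edges T)"
  unfolding relabel_all_edges by (rule mem_map_prod_image[OF relabel_pearl_inj])+

lemma relabel_free_pearl: "free_pearl (relabel g T) (map_prod g id p) \<longleftrightarrow> free_pearl T p"
  unfolding free_pearl_iff relabel_edge by blast

lemma relabel_free_boxes: "free_boxes (relabel g T) = map_prod g id ` free_boxes T"
  unfolding free_boxes_def relabel_box_pearls using relabel_free_pearl by auto

lemma relabel_mate:
  assumes "matching (all_edges T)"
  shows "mate (relabel g T) (map_prod g id p) = map_prod g id (mate T p)"
  unfolding mate_partner
proof (rule partner_cases[OF assms, of p])
  assume "(p, partner (all_edges T) p) \<in> all_edges T \<or> (partner (all_edges T) p, p) \<in> all_edges T"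
  then have *: "(map_prod g id p, map_prod g id (partner (all_edges T) p)) \<in> all_edges (relabel g T) \<or>
      (map_prod g id (partner (all_edges T) p), map_prod g id p) \<in> all_edges (relabel g T)"
    unfolding relabel_edge by blast
  have "matching (all_edges (relabel g T))"
    unfolding matching_def
  proof (intro conjI allI impI notI)
    fix x q q' assume xq: "(x, q) \<in> all_edges (relabel g T) \<or> (q, x) \<in> all_edges (relabel g T)"
      "(x, q') \<in> all_edges (relabel g T) \<or> (q', x) \<in> all_edges (relabel g T)"
    obtain y where y: "x = map_prod g id y" by (rule relabel_pearl_surj)
    from xq(1)[unfolded y relabel_edge]
    obtain u where u: "q = map_prod g id u" "(y, u) \<in> all_edges T \<or> (u, y) \<in> all_edges T"
      by (elim disjE exE conjE) auto
    from xq(2)[unfolded y relabel_edge]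
    obtain u' where u': "q' = map_prod g id u'" "(y, u') \<in> all_edges T \<or> (u', y) \<in> all_edges T"
      by (elim disjE exE conjE) auto
    show "q = q'" using matching_unique[OF assms u(2) u'(2)] u(1) u'(1) by simp
  next
    fix x assume xx: "(x, x) \<in> all_edges (relabel g T)"
    obtain y where y: "x = map_prod g id y" by (rule relabel_pearl_surj)
    from xx[unfolded y relabel_edge(1)]
    obtain y' where "map_prod g id y = map_prod g id y'" "(y, y') \<in> all_edges T"
      by (elim exE conjE)
    moreover from this(1) have "y = y'" by (rule injD[OF relabel_pearl_inj])
    ultimately show False using matching_irrefl[OF assms, of y] by simp
  qed
  from partner_eq[OF this *]
  show "partner (all_edges (relabel g T)) (map_prod g id p) = map_prod g id (partner (all_edges T) p)" .
next
  assume free: "partner (all_edges T) p = p" "\<And>q. (p, q) \<notin> all_edges T \<and> (q, p) \<notin> all_edges T"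
  have "partner (all_edges (relabel g T)) (map_prod g id p) = map_prod g id p"
    by (rule partner_free) (use free(2) in \<open>simp add: relabel_edge\<close>)
  then show "partner (all_edges (relabel g T)) (map_prod g id p) = map_prod g id (partner (all_edges T) p)"
    using free(1) by simp
qed

lemma relabel_cw_next:
  assumes "matching (all_edges T)"
  shows "cw_next (relabel g T) (map_prod g id p) = map_prod g id (cw_next T p)"
  unfolding cw_next_def relabel_mate[OF assms]
  by (cases "mate T p") (simp add: cw_rot_def relabel_neck)

lemma relabel_ccw_next:
  assumes "matching (all_edges T)"
  shows "ccw_next (relabel g T) (map_prod g id p) = map_prod g id (ccw_next T p)"
  unfolding ccw_next_def relabel_mate[OF assms]
  by (cases "mate T p") (simp add: ccw_rot_def relabel_neck)

lemma rewire_relabel: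
  assumes T: "nonneg_Q_tree Q T"
  shows "rewire (relabel g T) = relabel g (rewire T)"
proof -
  have "Q_tree Q T" using T unfolding nonneg_Q_tree_def by simp
  then interpret Q_tree_config Q T
    unfolding Q_tree_iff Q_tree_config_def Q_tree_config_axioms_def by blast
  let ?h = "map_prod g id :: 'v pearl \<Rightarrow> 'v pearl"
  have DP: "Domain (red_edges T) \<subseteq> pearls T" unfolding Domain_red using letter_pearls_sub by blast
  have dom: "Domain (red_edges (relabel g T)) = ?h ` Domain (red_edges T)"
    unfolding relabel_def by (simp add: Domain_map_prod)
  have "iter_matching (cw_next (relabel g T)) (Domain (red_edges (relabel g T))) (letter_pearls (relabel g T) Triangle) =
    map_prod ?h ?h ` iter_matching (cw_next T) (Domain (red_edges T)) (letter_pearls T Triangle)"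
    unfolding dom relabel_letter_pearls
    by (rule iter_matching_map[where f' = "cw_next (relabel g T)" and f = "cw_next T",
      OF relabel_pearl_inj relabel_cw_next[OF match] cw_next_inj DP
      rewire_nonneg_tree(5)[OF T]])
  then show ?thesis
    unfolding rewire_def cw_closure_def by (simp add: relabel_def)
qed

lemma inv_rewire_relabel:
  assumes T: "balanced_companion_tree Q T" "internal_defects T = {}"
  shows "inv_rewire (relabel g T) = relabel g (inv_rewire T)"
proof -
  have "companion_tree Q T \<and> root_pearl T \<in> box_pearls T"
    using T unfolding balanced_companion_tree_def by simp
  then interpret rooted_config Q T unfolding companion_tree_iff by blast
  let ?h = "map_prod g id :: 'v pearl \<Rightarrow> 'v pearl"
  have "Domain (blue_edges T) \<subseteq> letter_pearls T Diamond"
    using edge_types(3) by blast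
  then have DP: "Domain (blue_edges T) \<subseteq> pearls T" using letter_pearls_sub by blast
  have dom: "Domain (blue_edges (relabel g T)) = ?h ` Domain (blue_edges T)"
    unfolding relabel_def by (simp add: Domain_map_prod)
  have "iter_matching (ccw_next (relabel g T)) (Domain (blue_edges (relabel g T))) (free_boxes (relabel g T)) =
    map_prod ?h ?h ` iter_matching (ccw_next T) (Domain (blue_edges T)) (free_boxes T)"
    unfolding dom relabel_free_boxes
    by (rule iter_matching_map[where f' = "ccw_next (relabel g T)" and f = "ccw_next T",
      OF relabel_pearl_inj relabel_ccw_next[OF match] ccw_next_inj DP
      inv_rewire_balanced(4)[OF T]])
  then show ?thesis
    unfolding inv_rewire_def inv_closure_def by (simp add: relabel_def)
qed

lemma relabel_iso: "(T, relabel g T) \<in> config_iso"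
proof -
  have "verts_of (relabel g T) = g ` verts_of T"
  proof (intro equalityI subsetI)
    fix u assume u: "u \<in> verts_of (relabel g T)"
    obtain v where "u = g v" using g by (metis bij_pointE)
    with u show "u \<in> g ` verts_of T" unfolding verts_of_def by (auto simp: relabel_neck dom_def)
  qed (auto simp: verts_of_def dom_def relabel_neck)
  then have "bij_betw g (verts_of T) (verts_of (relabel g T))"
    using g by (metis bij_betw_subset subset_UNIV)
  then show ?thesis
    unfolding config_iso_def using relabel_neck by (auto simp: relabel_def)
qed

end

text \<open>Complements of finite sets of natural numbers are countably infinite, so their
  enumerations extend \<open>f\<close>. An isomorphism, given on the vertices only, thereby becomes
  a permutation of all names.\<close>

lemma bij_extend:
  fixes f :: "nat \<Rightarrow> nat"
  assumes "bij_betw f A B" "finite A"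
  obtains g where "bij g" "\<And>x. x \<in> A \<Longrightarrow> g x = f x"
proof -
  have "finite B" using assms bij_betw_finite by blast
  then have inf: "infinite (- A)" "infinite (- B)" using assms(2) by (simp_all add: Compl_eq_Diff_UNIV)
  obtain h where h: "bij_betw h (- A) (- B)"
    using bij_betw_trans[OF bij_betw_inv_into[OF bij_enumerate[OF inf(1)]] bij_enumerate[OF inf(2)]] by blast
  define g where "g x = (if x \<in> A then f x else h x)" for x
  have "bij_betw g A B" using assms(1) by (rule bij_betw_cong[THEN iffD1, rotated]) (simp add: g_def)
  moreover have "bij_betw g (- A) (- B)" using h by (rule bij_betw_cong[THEN iffD1, rotated]) (simp add: g_def)
  ultimately have "bij_betw g (A \<union> - A) (B \<union> - B)" by (rule bij_betw_combine) auto
  then have "bij g" by simp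
  with that[of g] show thesis by (simp add: g_def)
qed

lemma config_isoE:
  assumes "(S, T) \<in> config_iso"
  obtains f where "bij_betw f (verts_of S) (verts_of T)"
    "\<forall>v\<in>verts_of S. neck T (f v) = neck S v"
    "root_pearl T = map_prod f id (root_pearl S)"
    "black_edges T = edge_map f ` black_edges S"
    "red_edges T = edge_map f ` red_edges S"
    "blue_edges T = edge_map f ` blue_edges S"
  using assms unfolding config_iso_def mem_Collect_eq prod.case
  by (elim exE conjE) (rule that)

lemma iso_relabel:
  fixes S T :: "nat config"
  assumes iso: "(S, T) \<in> config_iso" and S: "necklace_config Q S"
  obtains g where "bij g" "T = relabel g S"
proof -
  from iso obtain f where f: "bij_betw f (verts_of S) (verts_of T)"
    "\<forall>v\<in>verts_of S. neck T (f v) = neck S v"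
    "root_pearl T = map_prod f id (root_pearl S)"
    "black_edges T = edge_map f ` black_edges S"
    "red_edges T = edge_map f ` red_edges S"
    "blue_edges T = edge_map f ` blue_edges S" by (rule config_isoE)
  have "finite (verts_of S)" using S unfolding necklace_config_def by simp
  from bij_extend[OF f(1) this] obtain g where g: "bij g" "\<And>v. v \<in> verts_of S \<Longrightarrow> g v = f v" by blast
  have vert: "fst p \<in> verts_of S" if "p \<in> pearls S" for p
    using that by (cases p) (auto simp: mem_pearls verts_of_def)
  have pearl: "map_prod f id p = map_prod g id p" if "p \<in> pearls S" for p :: "nat pearl"
    using g(2)[OF vert[OF that]] by (cases p) simp
  have edge: "edge_map f ` E = edge_map g ` E"
    if "E \<subseteq> all_edges S" for E :: "(nat pearl \<times> nat pearl) set"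
  proof (rule image_cong[OF refl])
    fix e assume "e \<in> E"
    then have "e \<in> pearls S \<times> pearls S" using that config_edges_sub[OF S] by blast
    then show "edge_map f e = edge_map g e"
      using pearl[of "fst e"] pearl[of "snd e"] by (cases e) (simp del: map_prod_simp add: map_prod_def[of "map_prod _ _"])
  qed
  have "neck T u = neck S (inv g u)" for u
  proof -
    obtain v where v: "u = g v" using g(1) by (metis bij_pointE)
    have inv: "inv g u = v" unfolding v using g(1) by (simp add: bij_def)
    show ?thesis
    proof (cases "v \<in> verts_of S")
      case True
      then show ?thesis using f(2) True g(2)[OF True] v inv by simp
    next
      case False
      \<comment> \<open>Off the vertex sets both necklace maps are \<open>None\<close>; this makes
        \<open>T\<close> equal to the renamed \<open>S\<close>.\<close>
      have "u \<notin> verts_of T"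
      proof
        assume "u \<in> verts_of T"
        then obtain w where w: "w \<in> verts_of S" "u = f w" using f(1) unfolding bij_betw_def by blast
        then have "g w = g v" using g(2) v by simp
        then show False using g(1) w(1) False by (metis bij_def injD)
      qed
      with False inv show ?thesis unfolding verts_of_def by (simp add: dom_def)
    qed
  qed
  then have neck: "neck T = neck S \<circ> inv g" by (simp add: fun_eq_iff)
  have "root_pearl S \<in> pearls S" using S unfolding necklace_config_def by simp
  then have "root_pearl T = map_prod g id (root_pearl S)" using f(3) pearl by simp
  moreover have "black_edges T = edge_map g ` black_edges S"
    "red_edges T = edge_map g ` red_edges S"
    "blue_edges T = edge_map g ` blue_edges S"
    unfolding f(4-6) by (rule edge; auto simp: all_edges_def)+
  ultimately have "T = relabel g S"
    unfolding relabel_def using neck by (intro config.equality) simp_all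
  with g(1) that show thesis by blast
qed

section \<open>Isomorphism classes and the induced maps\<close>

lemma config_iso_refl: "(T, T) \<in> config_iso"
  unfolding config_iso_def by (auto intro!: exI[of _ id] simp: map_prod.id)

lemma config_iso_trans:
  assumes "(S, T) \<in> config_iso" "(T, U) \<in> config_iso"
  shows "(S, U) \<in> config_iso"
proof -
  from assms(1) obtain f where f: "bij_betw f (verts_of S) (verts_of T)"
    "\<forall>v\<in>verts_of S. neck T (f v) = neck S v"
    "root_pearl T = map_prod f id (root_pearl S)"
    "black_edges T = edge_map f ` black_edges S"
    "red_edges T = edge_map f ` red_edges S"
    "blue_edges T = edge_map f ` blue_edges S" by (rule config_isoE)
  from assms(2) obtain h where h: "bij_betw h (verts_of T) (verts_of U)"
    "\<forall>v\<in>verts_of T. neck U (h v) = neck T v"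
    "root_pearl U = map_prod h id (root_pearl T)"
    "black_edges U = edge_map h ` black_edges T"
    "red_edges U = edge_map h ` red_edges T"
    "blue_edges U = edge_map h ` blue_edges T" by (rule config_isoE)
  have pearl: "map_prod h id (map_prod f id p) = map_prod (h \<circ> f) id p" for p :: "'a pearl"
    by (cases p) simp
  have comp: "edge_map h ` edge_map f ` E =
    edge_map (h \<circ> f) ` E" for E :: "('a pearl \<times> 'a pearl) set"
    unfolding image_image
  proof (rule image_cong[OF refl])
    show "edge_map h (edge_map f e) =
      edge_map (h \<circ> f) e" for e :: "'a pearl \<times> 'a pearl"
      by (cases e) (simp add: pearl)
  qed
  have "bij_betw (h \<circ> f) (verts_of S) (verts_of U)" using bij_betw_trans[OF f(1) h(1)] .
  moreover have "neck U ((h \<circ> f) v) = neck S v" if "v \<in> verts_of S" for v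
  proof -
    have "f v \<in> verts_of T" using f(1) that by (rule bij_betwE[THEN bspec])
    then show ?thesis using f(2) h(2) that by simp
  qed
  ultimately show ?thesis
    unfolding config_iso_def mem_Collect_eq prod.case h(3-6) f(3-6) comp pearl by blast
qed

lemma necklaces_iso:
  assumes "(S, T) \<in> config_iso"
  shows "necklaces T = necklaces S"
proof -
  from assms obtain f where f: "bij_betw f (verts_of S) (verts_of T)"
    "\<forall>v\<in>verts_of S. neck T (f v) = neck S v" by (rule config_isoE)
  have "mset_set (verts_of T) = image_mset f (mset_set (verts_of S))"
    using f(1) image_mset_mset_set[of f "verts_of S"] unfolding bij_betw_def by simp
  then have "necklaces T = image_mset (\<lambda>v. the (neck T (f v))) (mset_set (verts_of S))"
    unfolding necklaces_def by (simp add: image_mset.compositionality comp_def)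
  also have "\<dots> = necklaces S"
    unfolding necklaces_def
  proof (rule image_mset_cong)
    fix v assume v: "v \<in># mset_set (verts_of S)"
    \<comment> \<open>For an infinite vertex set \<open>mset_set\<close> is empty, so there is no
      such \<open>v\<close>.\<close>
    have "v \<in> verts_of S"
    proof (cases "finite (verts_of S)")
      case False
      then show ?thesis using v by simp
    qed (use v in simp)
    then show "the (neck T (f v)) = the (neck S v)" using f(2) by simp
  qed
  finally show ?thesis .
qed

text \<open>\<open>on_class\<close> collects what is isomorphic to the image of any representative;
  if \<open>f\<close> respects isomorphism, one representative determines it.\<close>

lemma on_class_image:
  assumes "\<And>S. (T, S) \<in> config_iso \<Longrightarrow> (f T, f S) \<in> config_iso"
  shows "on_class f (config_iso `` {T}) = config_iso `` {f T}"
proof (intro equalityI subsetI)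
  fix U assume "U \<in> on_class f (config_iso `` {T})"
  then obtain S where "(T, S) \<in> config_iso" "(f S, U) \<in> config_iso" unfolding on_class_def by auto
  then show "U \<in> config_iso `` {f T}" using config_iso_trans[OF assms] by simp
next
  fix U assume "U \<in> config_iso `` {f T}"
  then show "U \<in> on_class f (config_iso `` {T})"
    unfolding on_class_def using config_iso_refl[of T] by blast
qed

lemma on_class_rewire:
  fixes T :: "nat config"
  assumes T: "nonneg_Q_tree Q T"
  shows "on_class rewire (config_iso `` {T}) = config_iso `` {rewire T}"
proof (rule on_class_image)
  fix S assume S: "(T, S) \<in> config_iso"
  have "necklace_config Q T" using T unfolding nonneg_Q_tree_def Q_tree_def by simp
  from iso_relabel[OF S this] obtain g where g: "bij g" "S = relabel g T" .
  show "(rewire T, rewire S) \<in> config_iso"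
    unfolding g(2) rewire_relabel[OF g(1) T] by (rule relabel_iso[OF g(1)])
qed

lemma on_class_inv_rewire:
  fixes T :: "nat config"
  assumes T: "balanced_companion_tree Q T" "internal_defects T = {}"
  shows "on_class inv_rewire (config_iso `` {T}) = config_iso `` {inv_rewire T}"
proof (rule on_class_image)
  fix S assume S: "(T, S) \<in> config_iso"
  have "necklace_config Q T" using T unfolding balanced_companion_tree_def companion_tree_def by simp
  from iso_relabel[OF S this] obtain g where g: "bij g" "S = relabel g T" .
  show "(inv_rewire T, inv_rewire S) \<in> config_iso"
    unfolding g(2) inv_rewire_relabel[OF g(1) T] by (rule relabel_iso[OF g(1)])
qed

text \<open>Rewiring alters edges only, so the claim reduces to the invariance of
  \<open>necklaces\<close> under isomorphism.\<close>

lemma necklace_preservingI: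
  assumes f: "\<And>T. neck (f T) = neck T"
  shows "necklace_preserving (on_class f) (X // config_iso)"
  unfolding necklace_preserving_def
proof (intro ballI)
  fix C S U assume C: "C \<in> X // config_iso" and S: "S \<in> C" and U: "U \<in> on_class f C"
  from C obtain T where T: "C = config_iso `` {T}" by (rule quotientE)
  from U obtain S' where S': "S' \<in> C" "(f S', U) \<in> config_iso"
    unfolding on_class_def by auto
  have "necklaces (f S') = necklaces S'" unfolding necklaces_def verts_of_def f ..
  moreover have "necklaces S' = necklaces T" "necklaces S = necklaces T"
    using S S'(1) necklaces_iso[of T S] necklaces_iso[of T S'] unfolding T by auto
  ultimately show "necklaces U = necklaces S" using necklaces_iso[OF S'(2)] by simp
qed

theorem theorem3p1:
  fixes Q :: "letter list set" and k :: nat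
  assumes "\<exists>w\<in>Q. Dot \<notin> set w \<and> Diamond \<notin> set w"
  shows "bij_betw (on_class rewire) (F_class Q k) (B_class Q k) \<and>
         bij_betw (on_class inv_rewire) (B_class Q k) (F_class Q k) \<and>
         (\<forall>C\<in>F_class Q k. on_class inv_rewire (on_class rewire C) = C) \<and>
         (\<forall>C\<in>B_class Q k. on_class rewire (on_class inv_rewire C) = C) \<and>
         necklace_preserving (on_class rewire) (F_class Q k) \<and>
         necklace_preserving (on_class inv_rewire) (B_class Q k)"
proof -
  define F where "F = {T :: nat config. nonneg_Q_tree Q T \<and> excess T (root_pearl T) = int k}"
  define B where "B = {T :: nat config. balanced_companion_tree Q T \<and>
     card (external_defects T) = k \<and> internal_defects T = {}}"
  have classes: "F_class Q k = F // config_iso" "B_class Q k = B // config_iso"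
    unfolding F_class_def B_class_def F_def B_def by simp_all
  have root: "root_pearl (inv_rewire T) = root_pearl T" for T :: "nat config"
    unfolding inv_rewire_def inv_closure_def by simp
  have FB: "rewire T \<in> B" "inv_rewire (rewire T) = T" if "T \<in> F" for T
    using that rewire_nonneg_tree[of Q T] unfolding F_def B_def by auto
  have BF: "inv_rewire T \<in> F" "rewire (inv_rewire T) = T" if "T \<in> B" for T
    using that inv_rewire_balanced[of Q T] root[of T] unfolding F_def B_def by auto
  have onF: "on_class rewire (config_iso `` {T}) = config_iso `` {rewire T}" if "T \<in> F" for T
    using that on_class_rewire[of Q T] unfolding F_def by simp
  have onB: "on_class inv_rewire (config_iso `` {T}) = config_iso `` {inv_rewire T}" if "T \<in> B" for T
    using that on_class_inv_rewire[of Q T] unfolding B_def by simp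
  have imgF: "on_class rewire C \<in> B_class Q k" "on_class inv_rewire (on_class rewire C) = C"
    if "C \<in> F_class Q k" for C
  proof -
    from that obtain T where T: "C = config_iso `` {T}" "T \<in> F" unfolding classes by (rule quotientE)
    show "on_class rewire C \<in> B_class Q k"
      unfolding T(1) onF[OF T(2)] classes by (rule quotientI[OF FB(1)[OF T(2)]])
    show "on_class inv_rewire (on_class rewire C) = C"
      unfolding T(1) onF[OF T(2)] onB[OF FB(1)[OF T(2)]] FB(2)[OF T(2)] ..
  qed
  have imgB: "on_class inv_rewire C \<in> F_class Q k" "on_class rewire (on_class inv_rewire C) = C"
    if "C \<in> B_class Q k" for C
  proof -
    from that obtain T where T: "C = config_iso `` {T}" "T \<in> B" unfolding classes by (rule quotientE)
    show "on_class inv_rewire C \<in> F_class Q k"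
      unfolding T(1) onB[OF T(2)] classes by (rule quotientI[OF BF(1)[OF T(2)]])
    show "on_class rewire (on_class inv_rewire C) = C"
      unfolding T(1) onB[OF T(2)] onF[OF BF(1)[OF T(2)]] BF(2)[OF T(2)] ..
  qed
  have "bij_betw (on_class rewire) (F_class Q k) (B_class Q k)"
    by (rule bij_betw_byWitness[where f' = "on_class inv_rewire"]) (use imgF imgB in auto)
  moreover have "bij_betw (on_class inv_rewire) (B_class Q k) (F_class Q k)"
    by (rule bij_betw_byWitness[where f' = "on_class rewire"]) (use imgF imgB in auto)
  moreover have "necklace_preserving (on_class rewire) (F_class Q k)"
    unfolding classes by (rule necklace_preservingI) (simp add: rewire_def cw_closure_def)
  moreover have "necklace_preserving (on_class inv_rewire) (B_class Q k)"
    unfolding classes by (rule necklace_preservingI) (simp add: inv_rewire_def inv_closure_def)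
  ultimately show ?thesis using imgF(2) imgB(2) by blast
qed

end
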